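(* Consider the Poisson small-world random graph on $n$ with parameters $\alpha = 2$, $\overline{d} = 1$ (the expected number of shortcuts per node) and $c > 0$, where the constant $c$ is sufficiently large that $P(\mathcal{P}_n) \to 1$ as $n \to \infty$ (the event $\mathcal{P}_n$ is defined in the context). Then, with high probability, the number of hops used by the approximately greedy decentralised routing algorithm (described in the context) to deliver a message between any pair of nodes is of order $\log^2 n$; that is, there is a constant $K$ not depending on $n$ such that, with probability tending to $1$ as $n \to \infty$, for any pair of nodes $s,t$ the algorithm delivers the message from $s$ to $t$ in at most $K \log^2 n$ hops.
   Context: **Model.** For each $n \in \mathbb{N}$ a random graph is defined as follows. Nodes are the points of a Poisson process of rate $1$ on the square $[0,\sqrt{n}]^2$. The distance $r(u,v)$ is the Euclidean distance, with edge effects ignored, i.e. distances are those on the torus obtained by identifying opposite edges of the square. Each node $x$ is linked to all nodes at distance less than $\sqrt{c \log n}$ from it; these links are called local edges and the corresponding nodes the local contacts of $x$. For two nodes $u,v$ with $r(u,v) > \sqrt{c\log n}$, the edge $(u,v)$ is present with probability $\min(a_n r(u,v)^{-\alpha}, 1)$, independently for different node pairs (given the node positions); such edges are called shortcuts. The parameter $a_n$ is chosen so that the expected number of shortcuts per node equals the specified constant $\overline{d}$. "With high probability" means with probability tending to $1$ as $n \to \infty$. **The event $\mathcal{P}_n$.** $\mathcal{P}_n$ is the event that for all points $x,y \in [0,\sqrt n]^2$ (not necessarily nodes) with $r(x,y) \ge \sqrt{c\log n}$ there exists a node $u$ of the Poisson process with $r(u,y) < r(x,y)$ and $r(u,x)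 \le \sqrt{c \log n}$. **The routing algorithm.** Routing is decentralised: each node knows its own location, the locations of all its neighbours (local and shortcut), and the location of the destination $t$, and its decisions use only this information and what the message carries. Let $C(u,\rho)$ denote the circle (disc) of radius $\rho$ centred at $u$, and let $A(t,r) = C(t, r/2) \setminus C(t, r/4)$. The message carries the coordinates of $t$ and a radius $r$, initialised to $r(s,t)$. If the source $s$ has a direct link to $t$, or more generally if the current node has $t$ as a local contact, the message is delivered to $t$ immediately. Otherwise, suppose the message is at node $x$ with radius $r$. If $x$ has a shortcut to some node $y \in A(t,r)$, then $x$ forwards the message to such a $y$ (if there is more than one, the choice is arbitrary). Otherwise, $x$ forwards the message to one of its local contacts that is closer to $t$ than $x$ itself. When a node $y$ receives the message, it updates $r$ to $r/2$ if $r(y,t) \le r/2$, and leaves $r$ unchanged otherwise. Each forwarding of the message along an edge is one hop. *)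

theory Defs
  imports "HOL-Probability.Probability"
begin

type_synonym point = "real \<times> real"


section \<open>The torus\<close>

definition square :: "real \<Rightarrow> point set" where
  "square L = {0..L} \<times> {0..L}"

text \<open>Distance on the circle of length L, for representatives in the interval [0, L].\<close>

definition circle_dist :: "real \<Rightarrow> real \<Rightarrow> real \<Rightarrow> real" where
  "circle_dist L a b = min \<bar>a - b\<bar> (L - \<bar>a - b\<bar>)"

definition torus_dist :: "real \<Rightarrow> point \<Rightarrow> point \<Rightarrow> real" where
  "torus_dist L u v =
     sqrt ((circle_dist L (fst u) (fst v))\<^sup>2 + (circle_dist L (snd u) (snd v))\<^sup>2)"

definition side :: "nat \<Rightarrow> real" where
  "side n = sqrt (real n)"

definition local_radius :: "real \<Rightarrow> nat \<Rightarrow> real" where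
  "local_radius c n = sqrt (c * ln (real n))"


section \<open>The random graph\<close>

text \<open>
  A finite random point configuration is given by its number of points N and an enumeration X
  of its points; only the values of X at indices below N are points of the configuration.
\<close>

definition point_count :: "('a \<Rightarrow> nat) \<Rightarrow> ('a \<Rightarrow> nat \<Rightarrow> point) \<Rightarrow> point set \<Rightarrow> 'a \<Rightarrow> nat" where
  "point_count N X A \<omega> = card {i. i < N \<omega> \<and> X \<omega> i \<in> A}"

definition nodes :: "('a \<Rightarrow> nat) \<Rightarrow> ('a \<Rightarrow> nat \<Rightarrow> point) \<Rightarrow> 'a \<Rightarrow> point set" where
  "nodes N X \<omega> = X \<omega> ` {..<N \<omega>}"

text \<open>Poisson point process of rate 1 on the region Q.\<close>

definition poisson_process ::
  "'a measure \<Rightarrow> point set \<Rightarrow> ('a \<Rightarrow> nat) \<Rightarrow> ('a \<Rightarrow> nat \<Rightarrow> point) \<Rightarrow> bool" where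
  "poisson_process M Q N X \<longleftrightarrow>
     N \<in> measurable M (count_space UNIV) \<and>
     (\<forall>i. (\<lambda>\<omega>. X \<omega> i) \<in> borel_measurable M) \<and>
     (\<forall>\<omega>\<in>space M. nodes N X \<omega> \<subseteq> Q) \<and>
     (\<forall>A\<in>sets borel. A \<subseteq> Q \<longrightarrow>
        (\<forall>k. measure M {\<omega>\<in>space M. point_count N X A \<omega> = k} =
               exp (- measure lborel A) * measure lborel A ^ k / fact k)) \<and>
     (\<forall>A :: nat \<Rightarrow> point set.
        range A \<subseteq> sets borel \<and> (\<forall>i. A i \<subseteq> Q) \<and> disjoint_family A \<longrightarrow>
        prob_space.indep_vars M (\<lambda>_. count_space UNIV) (\<lambda>i. point_count N X (A i)) UNIV)"

text \<open>The sigma-algebra generated by the node positions (with their enumeration).\<close>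

definition position_algebra ::
  "'a measure \<Rightarrow> ('a \<Rightarrow> nat) \<Rightarrow> ('a \<Rightarrow> nat \<Rightarrow> point) \<Rightarrow> 'a measure" where
  "position_algebra M N X =
     vimage_algebra (space M) (\<lambda>\<omega>. (N \<omega>, X \<omega>))
       (count_space UNIV \<Otimes>\<^sub>M PiM UNIV (\<lambda>_. borel))"

definition shortcut_prob :: "real \<Rightarrow> real \<Rightarrow> real \<Rightarrow> real \<Rightarrow> real" where
  "shortcut_prob R a \<alpha> r = (if r > R then min (a * r powr (- \<alpha>)) 1 else 0)"

text \<open>
  The set E of shortcuts consists of pairs of node indices and is symmetric, so that an undirected
  shortcut contributes two pairs and \<open>card (E \<omega>)\<close> is the sum over all nodes of the number of
  their shortcuts. Conditional independence of the shortcuts given the positions is the product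
  formula for all finite families of node pairs.
\<close>

locale poisson_small_world = prob_space M
  for M :: "'a measure" +
  fixes n :: nat
    and c \<alpha> d a :: real
    and N :: "'a \<Rightarrow> nat"
    and X :: "'a \<Rightarrow> nat \<Rightarrow> point"
    and E :: "'a \<Rightarrow> (nat \<times> nat) set"
  assumes positions: "poisson_process M (square (side n)) N X"
    and shortcuts_measurable: "\<And>i j. {\<omega>\<in>space M. (i, j) \<in> E \<omega>} \<in> sets M"
    and shortcuts_between_nodes: "\<And>\<omega>. \<omega> \<in> space M \<Longrightarrow> E \<omega> \<subseteq> {..<N \<omega>} \<times> {..<N \<omega>}"
    and shortcuts_irrefl: "\<And>\<omega>. \<omega> \<in> space M \<Longrightarrow> irrefl (E \<omega>)"
    and shortcuts_sym: "\<And>\<omega>. \<omega> \<in> space M \<Longrightarrow> sym (E \<omega>)"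
    and shortcuts_cond_indep:
      "\<And>I. finite I \<Longrightarrow> I \<subseteq> {(i, j). i < j} \<Longrightarrow>
         AE \<omega> in M. I \<subseteq> {..<N \<omega>} \<times> {..<N \<omega>} \<longrightarrow>
           real_cond_exp M (position_algebra M N X) (indicator {\<omega>\<in>space M. I \<subseteq> E \<omega>}) \<omega> =
           (\<Prod>(i, j)\<in>I. shortcut_prob (local_radius c n) a \<alpha>
                           (torus_dist (side n) (X \<omega> i) (X \<omega> j)))"
    and a_pos: "0 < a"
    and mean_shortcuts_per_node:
      "expectation (\<lambda>\<omega>. real (card (E \<omega>))) / expectation (\<lambda>\<omega>. real (N \<omega>)) = d"

definition shortcuts :: "('a \<Rightarrow> nat \<Rightarrow> point) \<Rightarrow> ('a \<Rightarrow> (nat \<times> nat) set) \<Rightarrow> 'a \<Rightarrow> (point \<times> point) set" where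
  "shortcuts X E \<omega> = (\<lambda>(i, j). (X \<omega> i, X \<omega> j)) ` E \<omega>"

text \<open>
  Greedy progress by local steps is possible between all locations of the torus of side L, not only
  between the nodes V.
\<close>

definition progress_everywhere :: "real \<Rightarrow> real \<Rightarrow> point set \<Rightarrow> bool" where
  "progress_everywhere L R V \<longleftrightarrow>
     (\<forall>x\<in>square L. \<forall>y\<in>square L. torus_dist L x y \<ge> R \<longrightarrow>
        (\<exists>u\<in>V. torus_dist L u y < torus_dist L x y \<and> torus_dist L u x \<le> R))"


section \<open>Routing\<close>

definition local_contacts :: "real \<Rightarrow> real \<Rightarrow> point set \<Rightarrow> point \<Rightarrow> point set" where
  "local_contacts L R V x = {y\<in>V. y \<noteq> x \<and> torus_dist L x y < R}"

definition shortcut_contacts :: "(point \<times> point) set \<Rightarrow> point \<Rightarrow> point set" where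
  "shortcut_contacts S x = {y. (x, y) \<in> S}"

definition annulus :: "real \<Rightarrow> point \<Rightarrow> real \<Rightarrow> point set" where
  "annulus L t r = {y. r / 4 < torus_dist L t y \<and> torus_dist L t y \<le> r / 2}"

text \<open>
  Next hops allowed at a node x with local contacts C and shortcut contacts D, for a message with
  destination t carrying radius r, when t is not delivered to directly.
\<close>

definition allowed_hops ::
  "real \<Rightarrow> point \<Rightarrow> point set \<Rightarrow> point set \<Rightarrow> point \<Rightarrow> real \<Rightarrow> point set" where
  "allowed_hops L x C D t r =
     (if D \<inter> annulus L t r \<noteq> {} then D \<inter> annulus L t r
      else {y\<in>C. torus_dist L y t < torus_dist L x t})"

text \<open>
  A decentralised rule for the arbitrary choices of the algorithm maps the information available
  at a node (x, C, D, t, r as above) to the location of the next hop. Borel measurability in the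
  locations is imposed for every number of local contacts and of shortcut contacts. Nothing is
  required of the rule where no hop is allowed; the message is then stuck, see the inductive
  definition of \<open>forwards\<close>.
\<close>

type_synonym rule = "point \<Rightarrow> point set \<Rightarrow> point set \<Rightarrow> point \<Rightarrow> real \<Rightarrow> point"

definition routing_rule :: "real \<Rightarrow> rule \<Rightarrow> bool" where
  "routing_rule L \<rho> \<longleftrightarrow>
     (\<forall>x C D t r. finite C \<and> finite D \<and> allowed_hops L x C D t r \<noteq> {} \<longrightarrow>
        \<rho> x C D t r \<in> allowed_hops L x C D t r) \<and>
     (\<forall>(k::nat) (l::nat). (\<lambda>(x, t, r, y, z). \<rho> x (y ` {..<k}) (z ` {..<l}) t r) \<in>
        borel_measurable
          (borel \<Otimes>\<^sub>M borel \<Otimes>\<^sub>M borel \<Otimes>\<^sub>M PiM {..<k} (\<lambda>_. borel) \<Otimes>\<^sub>M PiM {..<l} (\<lambda>_. borel)))"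

text \<open>
  \<open>forwards L R V S \<rho> t x r k\<close>: a message at x, with current radius r, reaches t after exactly k
  further hops.
\<close>

inductive forwards ::
  "real \<Rightarrow> real \<Rightarrow> point set \<Rightarrow> (point \<times> point) set \<Rightarrow> rule \<Rightarrow> point \<Rightarrow> point \<Rightarrow> real \<Rightarrow> nat \<Rightarrow> bool"
  for L R V S \<rho> t where
  deliver: "t \<in> local_contacts L R V x \<Longrightarrow> forwards L R V S \<rho> t x r 1"
| forward: "t \<notin> local_contacts L R V x \<Longrightarrow>
    y = \<rho> x (local_contacts L R V x) (shortcut_contacts S x) t r \<Longrightarrow>
    y \<in> allowed_hops L x (local_contacts L R V x) (shortcut_contacts S x) t r \<Longrightarrow>
    forwards L R V S \<rho> t y (if torus_dist L y t \<le> r / 2 then r / 2 else r) k \<Longrightarrow>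
    forwards L R V S \<rho> t x r (Suc k)"

text \<open>A shortcut ending in t is used for direct delivery only at the source.\<close>

definition delivers ::
  "real \<Rightarrow> real \<Rightarrow> point set \<Rightarrow> (point \<times> point) set \<Rightarrow> rule \<Rightarrow> point \<Rightarrow> point \<Rightarrow> nat \<Rightarrow> bool" where
  "delivers L R V S \<rho> s t k \<longleftrightarrow>
     (if t \<in> local_contacts L R V s \<union> shortcut_contacts S s then k = 1
      else forwards L R V S \<rho> t s (torus_dist L s t) k)"

end

theory Submission
  imports Defs "HOL-Real_Asymp.Real_Asymp"
begin

text \<open>
  Why of order \<open>ln\<^sup>2 n\<close> hops suffice. Write R for the local radius. As long as the radius r of
  the message is large compared with R, the current node v satisfies \<open>r / 2 < dist v t \<le> r\<close>,
  and the annulus around t contains of order \<open>r\<^sup>2\<close> nodes at distance more than R and at most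
  \<open>3 / 2 * r\<close> from v. Each of them is a shortcut contact of v with probability at least of order
  \<open>min (a / r\<^sup>2) 1\<close>, so v has a shortcut into the annulus with probability at least of order
  \<open>min a 1\<close>, whatever the scale r is. The same scale
  invariance bounds a from below: each of the \<open>O(ln n)\<close> dyadic scales between R and the side of the
  torus contributes at most a constant times a to the mean number of shortcuts of a node, and this
  mean is 1; hence a is at least a constant over \<open>ln n\<close>
  (\<open>shortcut_intensity_lower_bound\<close>). A hop into the annulus halves r, which can happen only
  \<open>O(ln n)\<close> times, so \<open>O(ln\<^sup>2 n)\<close> attempts suffice, with a failure probability that is a high
  negative power of n and survives the union bound over the pairs of nodes.

  The choices of the routing rule may depend on all shortcuts of the nodes already visited. This
  does no harm: in the regime above every hop brings the message strictly closer to t, hence the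
  shortcuts inspected so far all have an endpoint farther from t than the points of the annulus and
  than the current node, and those that matter for the next hop are still independent. The lemma
  \<open>exploration\<close> makes this precise by an induction on the number T of attempts; with j halvings
  left, the probability of failure is at most \<open>2 ^ j * q ^ T\<close>, where q is the arithmetic mean of
  1 and a bound for the probability that a single attempt fails.

  Once r is below a fixed multiple of R, no luck with shortcuts is required: the distance to t decreases
  between two halvings of r, only \<open>O(ln n)\<close> nodes are that close to t, and only boundedly many
  halvings are left (\<open>deterministic_hops\<close>).

  What remains is to see that the positions are regular enough with high probability
  (\<open>prob_good_positions\<close>), by Chernoff bounds for Poisson counts over a grid of integer points and
  boxes, and to pass from fixed positions to the random ones (\<open>prob_edge_event_le\<close>). The
  hypothesis on greedy progress speaks of distance at most R, while local contacts are at distance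
  less than R; the two agree because almost surely no two nodes are at distance exactly R, which
  follows from the second factorial moment measure of the Poisson process. The same formula
  gives the mean number of shortcuts.
\<close>


section \<open>Means over independent edges\<close>

text \<open>
  The expectation of \<open>f\<close> of the random subset of \<open>P\<close> that contains each \<open>i\<close> independently with
  probability \<open>p i\<close>, for finite \<open>P\<close>. A finite sum is used in place of a product measure so that
  conditioning on the edges of a part of \<open>P\<close> becomes the rearrangement \<open>bernoulli_mean_Un\<close>.
\<close>
definition bernoulli_mean :: "('e \<Rightarrow> real) \<Rightarrow> 'e set \<Rightarrow> ('e set \<Rightarrow> real) \<Rightarrow> real" where
  "bernoulli_mean p P f = (\<Sum>e\<in>Pow P. (\<Prod>i\<in>e. p i) * (\<Prod>i\<in>P - e. 1 - p i) * f e)"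

lemma bernoulli_mean_empty [simp]: "bernoulli_mean p {} f = f {}"
  by (simp add: bernoulli_mean_def)

lemma bernoulli_mean_insert:
  assumes "finite P" "x \<notin> P"
  shows "bernoulli_mean p (insert x P) f =
    p x * bernoulli_mean p P (\<lambda>e. f (insert x e)) + (1 - p x) * bernoulli_mean p P f"
proof -
  let ?w = "\<lambda>P e. (\<Prod>i\<in>e. p i) * (\<Prod>i\<in>P - e. 1 - p i)"
  have inj: "inj_on (insert x) (Pow P)"
    using assms(2) by (auto simp: inj_on_def)
  have "bernoulli_mean p (insert x P) f =
      (\<Sum>e\<in>Pow P. ?w (insert x P) e * f e) + (\<Sum>e\<in>insert x ` Pow P. ?w (insert x P) e * f e)"
    unfolding bernoulli_mean_def Pow_insert
    using assms by (intro sum.union_disjoint) auto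
  also have "(\<Sum>e\<in>insert x ` Pow P. ?w (insert x P) e * f e) =
      (\<Sum>e\<in>Pow P. ?w (insert x P) (insert x e) * f (insert x e))"
    by (simp add: sum.reindex[OF inj])
  also have "\<dots> = (\<Sum>e\<in>Pow P. p x * (?w P e * f (insert x e)))"
  proof (rule sum.cong[OF refl])
    fix e assume e: "e \<in> Pow P"
    then have "finite e" "x \<notin> e" using assms finite_subset by auto
    moreover have "insert x P - insert x e = P - e" using assms(2) by auto
    ultimately show "?w (insert x P) (insert x e) * f (insert x e) = p x * (?w P e * f (insert x e))"
      by simp
  qed
  also have "(\<Sum>e\<in>Pow P. ?w (insert x P) e * f e) = (\<Sum>e\<in>Pow P. (1 - p x) * (?w P e * f e))"
  proof (rule sum.cong[OF refl])
    fix e assume e: "e \<in> Pow P"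
    then have "insert x P - e = insert x (P - e)" using assms by auto
    then show "?w (insert x P) e * f e = (1 - p x) * (?w P e * f e)"
      using assms by simp
  qed
  finally show ?thesis
    by (simp add: bernoulli_mean_def sum_distrib_left)
qed

lemma bernoulli_mean_mono:
  assumes "\<And>i. i \<in> P \<Longrightarrow> 0 \<le> p i \<and> p i \<le> 1" "\<And>e. e \<subseteq> P \<Longrightarrow> f e \<le> g e"
  shows "bernoulli_mean p P f \<le> bernoulli_mean p P g"
  unfolding bernoulli_mean_def
  using assms by (intro sum_mono mult_left_mono mult_nonneg_nonneg prod_nonneg) auto

lemma bernoulli_mean_const:
  assumes "finite P"
  shows "bernoulli_mean p P (\<lambda>_. k) = k"
  using assms by (induction P rule: finite_induct) (simp_all add: bernoulli_mean_insert algebra_simps)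

lemma bernoulli_mean_add:
  "bernoulli_mean p P (\<lambda>e. f e + g e) = bernoulli_mean p P f + bernoulli_mean p P g"
  by (simp add: bernoulli_mean_def algebra_simps sum.distrib)

lemma bernoulli_mean_cmult:
  "bernoulli_mean p P (\<lambda>e. k * f e) = k * bernoulli_mean p P f"
  by (simp add: bernoulli_mean_def sum_distrib_left mult_ac)

lemma bernoulli_mean_sum:
  "bernoulli_mean p P (\<lambda>e. \<Sum>k\<in>K. f k e) = (\<Sum>k\<in>K. bernoulli_mean p P (f k))"
  unfolding bernoulli_mean_def by (subst sum.swap) (simp add: sum_distrib_left)

text \<open>
  Fubini for independent edges: the edges in \<open>A\<close> are revealed first, and the inner mean is the
  conditional expectation given them.
\<close>
lemma bernoulli_mean_Un:
  assumes "finite A" "finite B" "A \<inter> B = {}"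
  shows "bernoulli_mean p (A \<union> B) f = bernoulli_mean p A (\<lambda>a. bernoulli_mean p B (\<lambda>b. f (a \<union> b)))"
  using assms
proof (induction A arbitrary: f rule: finite_induct)
  case (insert x A)
  then have "x \<notin> A \<union> B" "finite (A \<union> B)" by auto
  then show ?case
    using insert by (simp add: bernoulli_mean_insert)
qed simp

lemma bernoulli_mean_avoid:
  assumes "finite P" "Q \<subseteq> P"
  shows "bernoulli_mean p P (\<lambda>e. of_bool (e \<inter> Q = {})) = (\<Prod>i\<in>Q. 1 - p i)"
proof -
  have fin: "finite Q" "finite (P - Q)" using assms finite_subset by auto
  have none: "bernoulli_mean p Q (\<lambda>e. of_bool (e = {})) = (\<Prod>i\<in>Q. 1 - p i)"
    using fin(1) by (induction Q rule: finite_induct) 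
      (simp_all add: bernoulli_mean_insert bernoulli_mean_const)
  have "bernoulli_mean p P (\<lambda>e. of_bool (e \<inter> Q = {})) =
      bernoulli_mean p (Q \<union> (P - Q)) (\<lambda>e. of_bool (e \<inter> Q = {}))"
    using assms(2) by (simp add: Un_absorb1)
  also have "\<dots> = bernoulli_mean p Q (\<lambda>a. bernoulli_mean p (P - Q) (\<lambda>b. of_bool ((a \<union> b) \<inter> Q = {})))"
    using fin by (subst bernoulli_mean_Un) auto
  also have "\<dots> = bernoulli_mean p Q (\<lambda>a. of_bool (a = {}))"
  proof -
    have "bernoulli_mean p (P - Q) (\<lambda>b. of_bool ((a \<union> b) \<inter> Q = {})) = of_bool (a = {})"
      if "a \<subseteq> Q" for a
    proof -
      have "bernoulli_mean p (P - Q) (\<lambda>b. of_bool ((a \<union> b) \<inter> Q = {})) =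
          bernoulli_mean p (P - Q) (\<lambda>b. of_bool (a = {}))"
        unfolding bernoulli_mean_def
        using that by (intro sum.cong refl arg_cong2[where f = "(*)"] arg_cong[where f = of_bool]) auto
      then show ?thesis using fin by (simp add: bernoulli_mean_const)
    qed
    then show ?thesis
      unfolding bernoulli_mean_def[of p Q] by (intro sum.cong) auto
  qed
  finally show ?thesis using none by simp
qed


section \<open>Geometry of the torus\<close>

lemma circle_dist_commute: "circle_dist L a b = circle_dist L b a"
  by (simp add: circle_dist_def abs_minus_commute)

lemma circle_dist_nonneg:
  assumes "a \<in> {0..L}" "b \<in> {0..L}"
  shows "0 \<le> circle_dist L a b"
  using assms by (auto simp: circle_dist_def)

lemma circle_dist_triangle:
  assumes "a \<in> {0..L}" "b \<in> {0..L}" "c \<in> {0..L}"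
  shows "circle_dist L a c \<le> circle_dist L a b + circle_dist L b c"
  using assms unfolding circle_dist_def by (auto simp: min_def abs_if split: if_splits)

lemma torus_dist_commute: "torus_dist L u v = torus_dist L v u"
  by (simp add: torus_dist_def circle_dist_commute)

lemma torus_dist_nonneg: "0 \<le> torus_dist L u v"
  by (simp add: torus_dist_def)

lemma torus_dist_self: "0 \<le> L \<Longrightarrow> torus_dist L u u = 0"
  by (simp add: torus_dist_def circle_dist_def)

lemma torus_dist_triangle:
  assumes "u \<in> square L" "v \<in> square L" "w \<in> square L"
  shows "torus_dist L u w \<le> torus_dist L u v + torus_dist L v w"
proof -
  have m: "fst z \<in> {0..L}" "snd z \<in> {0..L}" if "z \<in> square L" for z
    using that by (auto simp: square_def)
  note pos = circle_dist_nonneg[of _ L] and tri = circle_dist_triangle[of _ L]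
  have "torus_dist L u w \<le>
      sqrt ((circle_dist L (fst u) (fst v) + circle_dist L (fst v) (fst w))\<^sup>2 +
            (circle_dist L (snd u) (snd v) + circle_dist L (snd v) (snd w))\<^sup>2)"
    unfolding torus_dist_def
    by (intro real_sqrt_le_mono add_mono power_mono tri pos m assms)
  also have "\<dots> \<le> torus_dist L u v + torus_dist L v w"
    unfolding torus_dist_def by (rule real_sqrt_sum_squares_triangle_ineq)
  finally show ?thesis .
qed

lemma torus_dist_le_side:
  assumes "u \<in> square L" "v \<in> square L"
  shows "torus_dist L u v \<le> L"
proof -
  have L: "0 \<le> L" using assms by (auto simp: square_def)
  have half: "0 \<le> circle_dist L a b \<and> circle_dist L a b \<le> L / 2"
    if "a \<in> {0..L}" "b \<in> {0..L}" for a b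
    using that by (auto simp: circle_dist_def min_def)
  have "(circle_dist L (fst u) (fst v))\<^sup>2 + (circle_dist L (snd u) (snd v))\<^sup>2 \<le> (L/2)\<^sup>2 + (L/2)\<^sup>2"
    using half assms by (intro add_mono power_mono) (auto simp: square_def)
  also have "\<dots> \<le> L\<^sup>2" by (simp add: power2_eq_square field_simps)
  finally show ?thesis
    unfolding torus_dist_def using L real_le_lsqrt by (simp add: real_le_lsqrt)
qed

lemma borel_measurable_torus_dist [measurable]:
  assumes [measurable]: "f \<in> borel_measurable M" "g \<in> borel_measurable M"
  shows "(\<lambda>\<omega>. torus_dist L (f \<omega>) (g \<omega>)) \<in> borel_measurable M"
proof -
  have [measurable]: "(\<lambda>\<omega>. fst (h \<omega>)) \<in> borel_measurable M" "(\<lambda>\<omega>. snd (h \<omega>)) \<in> borel_measurable M"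
    if "h \<in> borel_measurable M" for h :: "_ \<Rightarrow> point"
    by (rule measurable_compose[OF that borel_measurable_continuous_onI];
        intro continuous_intros)+
  show ?thesis
    unfolding torus_dist_def circle_dist_def by measurable
qed

lemma square_borel [measurable]: "square L \<in> sets borel"
  unfolding square_def by (intro borel_closed closed_Times) auto

lemma emeasure_square: "0 \<le> L \<Longrightarrow> emeasure lborel (square L) = ennreal (L\<^sup>2)"
  unfolding square_def lborel_prod[symmetric]
  by (subst lborel.emeasure_pair_measure_Times) (auto simp: ennreal_mult power2_eq_square)

text \<open>
  On the circle, a ball of radius \<open>s\<close> is covered by an interval of length \<open>2 * s\<close> and its two translates
  by the circumference, which gives the factor \<open>(3 * 2)\<^sup>2 = 36\<close>.
\<close>
lemma emeasure_torus_ball_le: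
  assumes "z \<in> square L" "0 \<le> s"
  shows "emeasure lborel {y\<in>square L. torus_dist L z y \<le> s} \<le> ennreal (36 * s\<^sup>2)"
proof -
  let ?I = "\<lambda>a. {a - s..a + s} \<union> ({a + L - s..a + L + s} \<union> {a - L - s..a - L + s})"
  have I: "b \<in> ?I a" if "a \<in> {0..L}" "b \<in> {0..L}" "circle_dist L a b \<le> s" for a b
    using that by (auto simp: circle_dist_def min_def abs_if split: if_splits)
  have Im: "emeasure lborel (?I a) \<le> ennreal (6 * s)" for a
  proof -
    have "emeasure lborel (?I a) \<le> emeasure lborel {a - s..a + s} +
        (emeasure lborel {a + L - s..a + L + s} + emeasure lborel {a - L - s..a - L + s})"
      by (intro order.trans[OF emeasure_subadditive] add_mono order.refl) auto
    also have "\<dots> = ennreal (6 * s)"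
      using assms(2) by (simp flip: ennreal_plus)
    finally show ?thesis .
  qed
  have "{y\<in>square L. torus_dist L z y \<le> s} \<subseteq> ?I (fst z) \<times> ?I (snd z)"
  proof
    fix y assume y: "y \<in> {y\<in>square L. torus_dist L z y \<le> s}"
    obtain a b where ab': "y = (a, b)" by (cases y)
    have ab: "(a, b) \<in> square L" and d: "torus_dist L z (a, b) \<le> s" using y ab' by auto
    have m: "fst z \<in> {0..L}" "snd z \<in> {0..L}" "a \<in> {0..L}" "b \<in> {0..L}"
      using assms(1) ab by (auto simp: square_def)
    have "circle_dist L (fst z) a \<le> torus_dist L z (a, b)"
      "circle_dist L (snd z) b \<le> torus_dist L z (a, b)"
      unfolding torus_dist_def by (auto intro!: real_le_rsqrt)
    then have c: "circle_dist L (fst z) a \<le> s" "circle_dist L (snd z) b \<le> s" using d by auto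
    have "a \<in> ?I (fst z)" by (rule I) (use m c in auto)
    moreover have "b \<in> ?I (snd z)" by (rule I) (use m c in auto)
    ultimately show "y \<in> ?I (fst z) \<times> ?I (snd z)" unfolding ab' by simp
  qed
  then have "emeasure lborel {y\<in>square L. torus_dist L z y \<le> s} \<le>
      emeasure lborel (?I (fst z) \<times> ?I (snd z))"
    by (rule emeasure_mono) (auto intro!: borel_closed closed_Times closed_Un)
  also have "\<dots> = emeasure lborel (?I (fst z)) * emeasure lborel (?I (snd z))"
    unfolding lborel_prod[symmetric] by (rule lborel.emeasure_pair_measure_Times) auto
  also have "\<dots> \<le> ennreal (6 * s) * ennreal (6 * s)"
    by (intro mult_mono Im) auto
  also have "\<dots> = ennreal (36 * s\<^sup>2)"
    using assms(2) by (simp add: ennreal_mult[symmetric] power2_eq_square)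
  finally show ?thesis .
qed

text \<open>
  Each vertical line meets a sphere in finitely many points, so Fubini applies.
\<close>
lemma torus_sphere_null:
  "emeasure lborel {y. torus_dist L x y = R} = 0"
proof -
  have lev: "finite {b. (circle_dist L a b)\<^sup>2 = w}" for a w
  proof (rule finite_subset)
    let ?v = "sqrt w"
    show "{b. (circle_dist L a b)\<^sup>2 = w} \<subseteq>
      (\<lambda>e. a + e) ` {?v, -?v, L - ?v, ?v - L, L + ?v, - L - ?v}"
    proof
      fix b assume "b \<in> {b. (circle_dist L a b)\<^sup>2 = w}"
      then have "\<bar>circle_dist L a b\<bar> = ?v" by auto
      then have "b - a \<in> {?v, -?v, L - ?v, ?v - L, L + ?v, - L - ?v}"
        by (auto simp: circle_dist_def min_def abs_if split: if_splits)
      then show "b \<in> (\<lambda>e. a + e) ` {?v, -?v, L - ?v, ?v - L, L + ?v, - L - ?v}"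
        by (intro image_eqI[of _ _ "b - a"]) auto
    qed
  qed auto
  have [measurable]: "{y. torus_dist L x y = R} \<in> sets (lborel :: point measure)"
    by measurable
  have "emeasure (lborel \<Otimes>\<^sub>M lborel) {y. torus_dist L x y = R} =
      (\<integral>\<^sup>+a. emeasure lborel (Pair a -` {y. torus_dist L x y = R}) \<partial>lborel)"
    by (rule lborel.emeasure_pair_measure_alt, unfold lborel_prod) measurable
  also have "\<dots> = (\<integral>\<^sup>+a. 0 \<partial>(lborel :: real measure))"
  proof (rule nn_integral_cong)
    fix a
    have "Pair a -` {y. torus_dist L x y = R} \<subseteq>
        {b. (circle_dist L (snd x) b)\<^sup>2 = R\<^sup>2 - (circle_dist L (fst x) a)\<^sup>2}"
      by (auto simp: torus_dist_def)
    then have "finite (Pair a -` {y. torus_dist L x y = R})"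
      using lev finite_subset by blast
    then show "emeasure lborel (Pair a -` {y. torus_dist L x y = R}) = 0"
      by (rule emeasure_lborel_countable[OF countable_finite])
  qed
  finally show ?thesis by (simp add: lborel_prod)
qed

text \<open>
  A box of side \<open>r / 8\<close> is placed at horizontal offset between \<open>5 / 16 * r\<close> and \<open>7 / 16 * r\<close> and vertical
  offset at most \<open>r / 8\<close> from \<open>t\<close>. In each coordinate the direction is chosen such that the box does
  not wrap around; this is possible since \<open>7 / 16 * r\<close> is less than \<open>L / 2\<close>. The outer distance
  \<open>23 / 50 * r\<close> is strictly below \<open>r / 2\<close>, which keeps the box away from every
  point at distance more than \<open>r / 2\<close> from \<open>t\<close>.
\<close>
lemma annulus_contains_box:
  assumes t: "t \<in> square L" and r: "0 < r" "r \<le> L"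
  obtains u1 u2 where "0 \<le> u1" "0 \<le> u2" "u1 + r / 8 \<le> L" "u2 + r / 8 \<le> L"
    "\<And>y. y \<in> {u1..u1 + r / 8} \<times> {u2..u2 + r / 8} \<Longrightarrow>
       r / 4 < torus_dist L t y \<and> torus_dist L t y \<le> 23 / 50 * r"
proof -
  obtain t1 t2 where t12: "t = (t1, t2)" by (cases t)
  have t': "0 \<le> t1" "t1 \<le> L" "0 \<le> t2" "t2 \<le> L" using t by (auto simp: t12 square_def)
  define u1 where "u1 = (if t1 + 7 / 16 * r \<le> L then t1 + 5 / 16 * r else t1 - 7 / 16 * r)"
  define u2 where "u2 = (if t2 + r / 8 \<le> L then t2 else t2 - r / 8)"
  show thesis
  proof
    show "0 \<le> u1" "0 \<le> u2" "u1 + r / 8 \<le> L" "u2 + r / 8 \<le> L"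
      using t' r by (auto simp: u1_def u2_def)
    fix y assume "y \<in> {u1..u1 + r / 8} \<times> {u2..u2 + r / 8}"
    then obtain a b where y: "y = (a, b)" "u1 \<le> a" "a \<le> u1 + r / 8" "u2 \<le> b" "b \<le> u2 + r / 8"
      by auto
    have c1: "5 / 16 * r \<le> circle_dist L t1 a" "circle_dist L t1 a \<le> 7 / 16 * r"
      using y t' r by (auto simp: u1_def circle_dist_def min_def abs_if split: if_splits)
    have c2: "0 \<le> circle_dist L t2 b" "circle_dist L t2 b \<le> r / 8"
      using y t' r by (auto simp: u2_def circle_dist_def min_def abs_if split: if_splits)
    have "(r / 4)\<^sup>2 < (5 / 16 * r)\<^sup>2" using r by (intro power_strict_mono) auto
    also have "\<dots> \<le> (circle_dist L t1 a)\<^sup>2" using c1 r by (intro power_mono) auto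
    also have "\<dots> \<le> (circle_dist L t1 a)\<^sup>2 + (circle_dist L t2 b)\<^sup>2" by simp
    finally have lo: "r / 4 < torus_dist L t y"
      unfolding torus_dist_def t12 y by (intro real_less_rsqrt) simp
    have "(circle_dist L t1 a)\<^sup>2 + (circle_dist L t2 b)\<^sup>2 \<le> (7 / 16 * r)\<^sup>2 + (r / 8)\<^sup>2"
      using c1 c2 r by (intro add_mono power_mono) auto
    also have "\<dots> \<le> (23 / 50 * r)\<^sup>2" by (simp add: power2_eq_square)
    finally have "torus_dist L t y \<le> 23 / 50 * r"
      unfolding torus_dist_def t12 y by (intro real_le_lsqrt) (use r in auto)
    then show "r / 4 < torus_dist L t y \<and> torus_dist L t y \<le> 23 / 50 * r"
      using lo by simp
  qed
qed


section \<open>Routing between fixed positions\<close>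

text \<open>
  The shortcuts between points that arise from a set of index pairs, each undirected edge being listed
  once, in increasing order of its indices.
\<close>
definition links :: "(nat \<Rightarrow> point) \<Rightarrow> (nat \<times> nat) set \<Rightarrow> (point \<times> point) set" where
  "links x e = (\<lambda>(i, j). (x i, x j)) ` (e \<union> e\<inverse>)"

definition index_pairs :: "nat \<Rightarrow> (nat \<times> nat) set" where
  "index_pairs m = {(i, j). i < j \<and> j < m}"

lemma finite_index_pairs [simp]: "finite (index_pairs m)"
  by (rule finite_subset[of _ "{..<m} \<times> {..<m}"]) (auto simp: index_pairs_def)

lemma links_subset: "e \<subseteq> index_pairs m \<Longrightarrow> links x e \<subseteq> x ` {..<m} \<times> x ` {..<m}"
  by (force simp: links_def index_pairs_def)

text \<open>
  A fixed configuration of nodes and a fixed destination. Progress is required between nodes only,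
  and by a local contact, that is at distance strictly less than \<open>R\<close>.
\<close>
locale torus_routing =
  fixes L R :: real and m :: nat and x :: "nat \<Rightarrow> point" and \<rho> :: rule and t :: point
  assumes L_nonneg: "0 \<le> L"
    and R_pos: "0 < R"
    and in_square: "\<And>i. i < m \<Longrightarrow> x i \<in> square L"
    and rule: "routing_rule L \<rho>"
    and target: "t \<in> x ` {..<m}"
    and progress: "\<And>v. v \<in> x ` {..<m} \<Longrightarrow> R \<le> torus_dist L v t \<Longrightarrow>
      \<exists>u\<in>x ` {..<m}. torus_dist L u t < torus_dist L v t \<and> torus_dist L v u < R"
begin

abbreviation "V \<equiv> x ` {..<m}"
abbreviation "gap v \<equiv> torus_dist L v t"
abbreviation "near v \<equiv> local_contacts L R V v"
abbreviation "next_hop S v r \<equiv> \<rho> v (near v) (shortcut_contacts S v) t r"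
abbreviation "next_radius y r \<equiv> (if gap y \<le> r / 2 then r / 2 else r)"
abbreviation "reaches S \<equiv> forwards L R V S \<rho> t"

lemma gap_ge:
  assumes "v \<in> V" "v \<noteq> t" "t \<notin> near v"
  shows "R \<le> gap v"
  using assms target by (auto simp: local_contacts_def)

text \<open>
  A message that is not adjacent to its destination can always be forwarded, never lands on the
  destination by that hop, and the hop either goes into the annulus or is a step of length less
  than \<open>R\<close> towards \<open>t\<close>.
\<close>
lemma next_hop_cases:
  assumes S: "S \<subseteq> V \<times> V" and v: "v \<in> V" "v \<noteq> t" "t \<notin> near v" and r: "gap v \<le> r"
  defines "y \<equiv> next_hop S v r"
  shows "y \<in> allowed_hops L v (near v) (shortcut_contacts S v) t r" "y \<in> V" "y \<noteq> t"
    "shortcut_contacts S v \<inter> annulus L t r \<noteq> {} \<Longrightarrow> y \<in> annulus L t r"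
    "y \<in> annulus L t r \<or> (gap y < gap v \<and> torus_dist L v y < R)"
proof -
  have far: "R \<le> gap v" using gap_ge v by blast
  have fin: "finite (near v)" "finite (shortcut_contacts S v)"
    using S by (auto simp: local_contacts_def shortcut_contacts_def intro: finite_subset[of _ V])
  have ex: "allowed_hops L v (near v) (shortcut_contacts S v) t r \<noteq> {}"
  proof -
    obtain u where "u \<in> V" "gap u < gap v" "torus_dist L v u < R"
      using progress[OF v(1) far] by blast
    then have "u \<in> {u\<in>near v. gap u < gap v}" by (auto simp: local_contacts_def)
    then have "{u\<in>near v. gap u < gap v} \<noteq> {}" by (metis emptyE)
    then show ?thesis unfolding allowed_hops_def by (cases "shortcut_contacts S v \<inter> annulus L t r = {}") simp_all
  qed
  then show al: "y \<in> allowed_hops L v (near v) (shortcut_contacts S v) t r"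
    using rule fin unfolding routing_rule_def y_def by blast
  show "y \<in> V"
    using al S by (auto simp: allowed_hops_def local_contacts_def shortcut_contacts_def split: if_splits)
  have pos: "0 < r" using far r R_pos by linarith
  show "y \<noteq> t"
  proof
    assume yt: "y = t"
    have "t \<notin> annulus L t r" using pos L_nonneg by (auto simp: annulus_def torus_dist_self)
    then show False using al v(3) unfolding yt by (auto simp: allowed_hops_def split: if_splits)
  qed
  show "shortcut_contacts S v \<inter> annulus L t r \<noteq> {} \<Longrightarrow> y \<in> annulus L t r"
    using al by (auto simp: allowed_hops_def)
  show "y \<in> annulus L t r \<or> (gap y < gap v \<and> torus_dist L v y < R)"
    using al by (auto simp: allowed_hops_def local_contacts_def split: if_splits)
qed

lemma reaches_step:
  assumes "t \<notin> near v" "next_hop S v r \<in> allowed_hops L v (near v) (shortcut_contacts S v) t r"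
    "reaches S (next_hop S v r) (next_radius (next_hop S v r) r) k"
  shows "reaches S v r (Suc k)"
  using forward[OF assms(1) refl assms(2,3)] .

lemma annulus_gap: "y \<in> annulus L t r \<Longrightarrow> r / 4 < gap y \<and> gap y \<le> r / 2"
  by (simp add: annulus_def torus_dist_commute)

text \<open>
  Lexicographic descent in the number of halvings left and the number of nodes closer to \<open>t\<close>. A hop
  either halves the radius, which resets the second component to at most \<open>B\<close>, or goes to a strictly
  closer node. No halving is possible below \<open>R\<close>, because an undelivered message is at distance at
  least \<open>R\<close> and at most \<open>r\<close> from \<open>t\<close>.
\<close>
lemma deterministic_hops:
  assumes S: "S \<subseteq> V \<times> V" and v: "v \<in> V" "v \<noteq> t" "gap v \<le> r"
    and r: "r < 2 ^ J * R" and B: "card {u\<in>V. gap u \<le> r} \<le> B"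
  shows "\<exists>k\<le>1 + J * (B + 1) + card {u\<in>V. gap u < gap v}. reaches S v r k"
  using v r B
proof (induction "J * (B + 1) + card {u\<in>V. gap u < gap v}" arbitrary: J v r rule: less_induct)
  case less
  note v = less.prems(1-3) and r = less.prems(4) and B = less.prems(5)
  show ?case
  proof (cases "t \<in> near v")
    case True
    then have "reaches S v r 1" by (rule deliver)
    then show ?thesis by (intro exI[of _ 1]) auto
  next
    case False
    have far: "R \<le> gap v" using gap_ge v False by blast
    define y where "y = next_hop S v r"
    define r' where "r' = next_radius y r"
    note hop = next_hop_cases[OF S v(1,2) False v(3), folded y_def]
    have gy: "gap y \<le> r'" "r' \<le> r"
      using hop(5) v(3) annulus_gap[of y r] far R_pos by (auto simp: r'_def)
    have J: "J \<noteq> 0" using far v(3) r by (intro notI) simp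
    then obtain J' where J': "J = Suc J'" by (cases J) auto
    have cardB: "card {u\<in>V. gap u \<le> r'} \<le> B"
      by (rule order.trans[OF card_mono B]) (use gy in auto)
    have cardy: "card {u\<in>V. gap u < gap y} \<le> B"
      by (rule order.trans[OF card_mono cardB]) (use gy in auto)
    have "\<exists>k\<le>J * (B + 1) + card {u\<in>V. gap u < gap v}. reaches S y r' k"
    proof (cases "gap y \<le> r / 2")
      case True
      have dec: "J' * (B + 1) + card {u\<in>V. gap u < gap y} < J * (B + 1) + card {u\<in>V. gap u < gap v}"
        using cardy J' by simp
      have "r' < 2 ^ J' * R" using r True by (simp add: r'_def J')
      from less.hyps[OF dec hop(2,3) gy(1) this cardB] obtain k
        where "k \<le> 1 + J' * (B + 1) + card {u\<in>V. gap u < gap y}" "reaches S y r' k" by blast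
      then show ?thesis using dec by (intro exI[of _ k]) auto
    next
      case False
      then have closer: "gap y < gap v" using hop(5) annulus_gap[of y r] by auto
      have "card {u\<in>V. gap u < gap y} < card {u\<in>V. gap u < gap v}"
        by (rule psubset_card_mono) (use closer hop(2) in auto)
      then have dec: "J * (B + 1) + card {u\<in>V. gap u < gap y} < J * (B + 1) + card {u\<in>V. gap u < gap v}"
        by simp
      have "r' < 2 ^ J * R" using r gy by simp
      from less.hyps[OF dec hop(2,3) gy(1) this cardB] obtain k
        where "k \<le> 1 + J * (B + 1) + card {u\<in>V. gap u < gap y}" "reaches S y r' k" by blast
      then show ?thesis using dec by (intro exI[of _ k]) auto
    qed
    then obtain k where k: "k \<le> J * (B + 1) + card {u\<in>V. gap u < gap v}" "reaches S y r' k"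
      by blast
    then have "reaches S v r (Suc k)"
      using reaches_step[OF False, of S r k] hop(1) by (simp add: y_def r'_def)
    then show ?thesis using k(1) by (intro exI[of _ "Suc k"]) auto
  qed
qed

text \<open>
  At a node \<open>v\<close> the edges of \<open>inner_pairs (gap v)\<close> are those that earlier, more distant nodes cannot
  have revealed; \<open>strictly_inner_pairs (gap v)\<close> are those that are left after the edges
  of all nodes at the distance of \<open>v\<close> have been revealed.
\<close>
definition inner_pairs :: "real \<Rightarrow> (nat \<times> nat) set" where
  "inner_pairs s = {(i, k). i < k \<and> k < m \<and> gap (x i) \<le> s \<and> gap (x k) \<le> s}"

definition strictly_inner_pairs :: "real \<Rightarrow> (nat \<times> nat) set" where
  "strictly_inner_pairs s = {(i, k). i < k \<and> k < m \<and> gap (x i) < s \<and> gap (x k) < s}"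

lemma finite_inner_pairs [simp]: "finite (inner_pairs s)" "finite (strictly_inner_pairs s)"
  by (rule finite_subset[OF _ finite_index_pairs[of m]];
      auto simp: inner_pairs_def strictly_inner_pairs_def index_pairs_def)+

lemma shortcut_contacts_inner:
  assumes "b \<subseteq> strictly_inner_pairs (gap v)"
  shows "shortcut_contacts (links x (e \<union> b)) v = shortcut_contacts (links x e) v"
  using assms by (fastforce simp: shortcut_contacts_def links_def strictly_inner_pairs_def)

text \<open>
  The failure probability of \<open>T\<close> attempts, conditionally on any edges \<open>out\<close> seen before, with \<open>j\<close>
  halvings left before the radius falls below \<open>r1\<close>. An attempt that fails with probability at most \<open>q0\<close>
  multiplies the potential \<open>2 ^ j\<close> by 1 on failure and by \<open>1 / 2\<close> on success, so by at most
  \<open>(1 + q0) / 2\<close> in the mean. The invariant \<open>r / 2 < gap v\<close>, valid while \<open>r1 \<le> r\<close>, makes all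
  hops strictly decreasing in distance; it survives a halving by a local step because this step is shorter than
  \<open>R \<le> r1 / 4\<close>. Below \<open>r1\<close> the remaining \<open>T2\<close> hops are provided by \<open>deterministic_hops\<close>.
\<close>
lemma exploration:
  fixes p :: "nat \<times> nat \<Rightarrow> real"
  assumes p01: "\<And>i. 0 \<le> p i \<and> p i \<le> 1" and q0: "0 \<le> q0"
    and r1: "4 * R \<le> r1" "r1 \<le> 2 ^ J * R"
    and B: "card {u\<in>V. gap u \<le> r1} \<le> B"
    and T2: "T2 = 1 + J * (B + 1) + B"
    and success: "\<And>v r. v \<in> V \<Longrightarrow> r1 \<le> r \<Longrightarrow> r \<le> L \<Longrightarrow> r / 2 < gap v \<Longrightarrow> gap v \<le> r \<Longrightarrow>
      \<exists>Q\<subseteq>index_pairs m. (\<forall>(i, k)\<in>Q. (x i = v \<and> x k \<in> annulus L t r) \<or> (x k = v \<and> x i \<in> annulus L t r))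
        \<and> (\<Prod>e\<in>Q. 1 - p e) \<le> q0"
    and out: "out \<subseteq> index_pairs m"
    and v: "v \<in> V" "v \<noteq> t" "gap v \<le> r" "r1 \<le> r \<Longrightarrow> r / 2 < gap v" "r \<le> L" "r < 2 ^ j * r1"
  shows "bernoulli_mean p (inner_pairs (gap v))
      (\<lambda>e. of_bool (\<not> (\<exists>k\<le>T + T2. reaches (links x (out \<union> e)) v r k))) \<le> 2 ^ j * ((1 + q0) / 2) ^ T"
  using out v
proof (induction T arbitrary: out v r j)
  case 0
  have "bernoulli_mean p (inner_pairs (gap v))
      (\<lambda>e. of_bool (\<not> (\<exists>k\<le>0 + T2. reaches (links x (out \<union> e)) v r k)))
    \<le> bernoulli_mean p (inner_pairs (gap v)) (\<lambda>_. 1)"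
    using p01 by (intro bernoulli_mean_mono) auto
  also have "\<dots> \<le> 2 ^ j * ((1 + q0) / 2) ^ 0"
    by (simp add: bernoulli_mean_const)
  finally show ?case .
next
  case (Suc T)
  note out = Suc.prems(1) and v = Suc.prems(2-)
  let ?q = "(1 + q0) / 2"
  let ?fail = "\<lambda>T v r e. \<not> (\<exists>k\<le>T + T2. reaches (links x e) v r k)"
  have sub: "out \<union> e \<subseteq> index_pairs m" if "e \<subseteq> inner_pairs s" for e s
    using out that by (auto simp: inner_pairs_def index_pairs_def)
  consider (near) "t \<in> near v" | (low) "r < r1" | (main) "t \<notin> near v" "r1 \<le> r" by linarith
  then show ?case
  proof cases
    case near
    then have "reaches S v r 1" for S by (rule deliver)
    then have "\<not> ?fail (Suc T) v r e" for e using T2 by auto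
    then show ?thesis using q0 by (simp add: bernoulli_mean_const)
  next
    case low
    have "bernoulli_mean p (inner_pairs (gap v)) (\<lambda>e. of_bool (?fail (Suc T) v r (out \<union> e)))
        \<le> bernoulli_mean p (inner_pairs (gap v)) (\<lambda>_. 0)"
    proof (intro bernoulli_mean_mono)
      fix e assume "e \<subseteq> inner_pairs (gap v)"
      then have S: "links x (out \<union> e) \<subseteq> V \<times> V" by (intro links_subset sub)
      have "r < 2 ^ J * R" using low r1 by linarith
      moreover have cb: "card {u\<in>V. gap u \<le> r} \<le> B"
        by (rule order.trans[OF card_mono B]) (use low in auto)
      ultimately obtain k where k: "k \<le> 1 + J * (B + 1) + card {u\<in>V. gap u < gap v}"
          "reaches (links x (out \<union> e)) v r k"
        using deterministic_hops[OF S v(1-3)] by blast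
      have "card {u\<in>V. gap u < gap v} \<le> B"
        by (rule order.trans[OF card_mono cb]) (use v in auto)
      then have "k \<le> Suc T + T2" using k(1) T2 by simp
      then show "of_bool (?fail (Suc T) v r (out \<union> e)) \<le> (0::real)" using k(2) by auto
    qed (use p01 in auto)
    then have "bernoulli_mean p (inner_pairs (gap v)) (\<lambda>e. of_bool (?fail (Suc T) v r (out \<union> e))) \<le> 0"
      unfolding bernoulli_mean_const[OF finite_inner_pairs(1)] .
    moreover have "0 \<le> 2 ^ j * ?q ^ Suc T"
      using q0 by (intro mult_nonneg_nonneg zero_le_power) auto
    ultimately show ?thesis by (rule order.trans)
  next
    case main
    have "r1 > 0" using r1 R_pos by linarith
    have "j \<noteq> 0" using v(6) main(2) by (intro notI) simp
    then obtain j' where j': "j = Suc j'" by (cases j) auto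
    have "\<exists>Q\<subseteq>index_pairs m. (\<forall>(i, k)\<in>Q. (x i = v \<and> x k \<in> annulus L t r) \<or> (x k = v \<and> x i \<in> annulus L t r))
        \<and> (\<Prod>e\<in>Q. 1 - p e) \<le> q0"
      by (rule success[OF v(1) main(2) v(5) v(4)[OF main(2)] v(3)])
    then obtain Q where Q1: "Q \<subseteq> index_pairs m" and Q3: "(\<Prod>e\<in>Q. 1 - p e) \<le> q0"
      and Q: "\<forall>(i, k)\<in>Q. (x i = v \<and> x k \<in> annulus L t r) \<or> (x k = v \<and> x i \<in> annulus L t r)"
      by (elim exE conjE)
    have Q2: "(x i = v \<and> x k \<in> annulus L t r) \<or> (x k = v \<and> x i \<in> annulus L t r)" if "(i, k) \<in> Q" for i k
      using bspec[OF Q that] by simp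
    define W where "W = strictly_inner_pairs (gap v)"
    define A where "A = inner_pairs (gap v) - W"
    have fin: "finite A" "finite W" by (auto simp: A_def W_def)
    have AW: "inner_pairs (gap v) = A \<union> W"
      by (auto simp: A_def W_def inner_pairs_def strictly_inner_pairs_def)
    have half: "r / 2 < gap v" using v(4) main(2) by blast
    have QA: "Q \<subseteq> A"
    proof
      fix z assume z: "z \<in> Q"
      obtain i k where ik: "z = (i, k)" by (cases z)
      show "z \<in> A"
        using subsetD[OF Q1 z] Q2[of i k] z half annulus_gap[of "x i" r] annulus_gap[of "x k" r]
        unfolding ik by (auto simp: A_def W_def index_pairs_def inner_pairs_def strictly_inner_pairs_def)
    qed
    \<comment> \<open>Once the edges \<open>a\<close> with an endpoint at the distance of \<open>v\<close> are revealed, the next hop is determined.\<close>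
    have inner: "bernoulli_mean p W (\<lambda>b. of_bool (?fail (Suc T) v r (out \<union> (a \<union> b))))
        \<le> 2 ^ j' * ?q ^ T * (1 + of_bool (a \<inter> Q = {}))" if a: "a \<subseteq> A" for a
    proof -
      define S where "S = links x (out \<union> a)"
      define y where "y = next_hop S v r"
      define r' where "r' = next_radius y r"
      have SV: "S \<subseteq> V \<times> V"
        unfolding S_def by (intro links_subset sub[of a "gap v"]) (use a A_def in auto)
      note hop = next_hop_cases[OF SV v(1,2) main(1) v(3), folded y_def]
      have closer: "gap y < gap v" using hop(5) annulus_gap[of y r] half by auto
      have gy: "gap y \<le> r'" "r' \<le> r"
        using closer v(3) torus_dist_nonneg[of L v t] by (auto simp: r'_def)
      have inv: "r' / 2 < gap y" if "r1 \<le> r'"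
      proof (cases "gap y \<le> r / 2")
        case True
        then have r': "r' = r / 2" by (simp add: r'_def)
        have "r / 4 < gap y"
        proof (cases "y \<in> annulus L t r")
          case False
          then have "torus_dist L v y < R" using hop(5) by blast
          moreover have "gap v \<le> torus_dist L v y + gap y"
            using v(1) hop(2) target by (intro torus_dist_triangle) (auto intro: in_square)
          ultimately show ?thesis using half that r1 r' R_pos by linarith
        qed (use annulus_gap in blast)
        then show ?thesis using r' by simp
      qed (use r'_def torus_dist_nonneg[of L y t] closer v in auto)
      define jj where "jj = (if a \<inter> Q = {} then j else j')"
      have rjj: "r' < 2 ^ jj * r1"
      proof (cases "a \<inter> Q = {}")
        case False
        then obtain i k where ik: "(i, k) \<in> a" "(i, k) \<in> Q" by auto
        then have "shortcut_contacts S v \<inter> annulus L t r \<noteq> {}"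
          using Q2[OF ik(2)] by (force simp: S_def links_def shortcut_contacts_def)
        then have "gap y \<le> r / 2" using hop(4) annulus_gap by blast
        then show ?thesis using v(6) False by (simp add: jj_def r'_def j')
      qed (use gy v(6) jj_def in auto)
      have step: "?fail T y r' (out \<union> (a \<union> b))" if b: "b \<subseteq> W" and f: "?fail (Suc T) v r (out \<union> (a \<union> b))" for b
      proof
        assume "\<exists>k\<le>T + T2. reaches (links x (out \<union> (a \<union> b))) y r' k"
        then obtain k where k: "k \<le> T + T2" "reaches (links x (out \<union> (a \<union> b))) y r' k" by blast
        have sc: "shortcut_contacts (links x (out \<union> (a \<union> b))) v = shortcut_contacts S v"
          using shortcut_contacts_inner[of b v "out \<union> a"] b by (simp add: W_def S_def Un_assoc)
        have "reaches (links x (out \<union> (a \<union> b))) v r (Suc k)"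
          using reaches_step[OF main(1), of "links x (out \<union> (a \<union> b))" r k] hop(1) k(2)
          unfolding sc by (simp add: y_def r'_def)
        then show False using f k(1) by auto
      qed
      \<comment> \<open>The induction hypothesis at \<open>y\<close> allows for arbitrary fixed edges outside its inner pairs.\<close>
      define W' where "W' = W - inner_pairs (gap y)"
      have Wsplit: "W = W' \<union> inner_pairs (gap y)"
        using closer by (auto simp: W'_def W_def strictly_inner_pairs_def inner_pairs_def)
      have "bernoulli_mean p W (\<lambda>b. of_bool (?fail (Suc T) v r (out \<union> (a \<union> b))))
          \<le> bernoulli_mean p W (\<lambda>b. of_bool (?fail T y r' (out \<union> (a \<union> b))))"
        using step p01 by (intro bernoulli_mean_mono) auto
      also have "\<dots> = bernoulli_mean p W' (\<lambda>b. bernoulli_mean p (inner_pairs (gap y))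
          (\<lambda>b'. of_bool (?fail T y r' (out \<union> (a \<union> (b \<union> b'))))))"
        unfolding Wsplit by (rule bernoulli_mean_Un) (auto simp: W'_def W_def)
      also have "\<dots> \<le> bernoulli_mean p W' (\<lambda>b. 2 ^ jj * ?q ^ T)"
      proof (intro bernoulli_mean_mono)
        fix b assume b: "b \<subseteq> W'"
        have "out \<union> (a \<union> b) \<subseteq> index_pairs m"
          using a b by (intro sub[of _ "gap v"]) (auto simp: A_def W'_def W_def strictly_inner_pairs_def inner_pairs_def)
        from Suc.IH[OF this hop(2,3) gy(1) inv _ rjj] gy(2) v(5)
        show "bernoulli_mean p (inner_pairs (gap y))
            (\<lambda>b'. of_bool (?fail T y r' (out \<union> (a \<union> (b \<union> b'))))) \<le> 2 ^ jj * ?q ^ T"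
          by (simp add: Un_assoc)
      qed (use p01 in auto)
      also have "\<dots> = 2 ^ j' * ?q ^ T * (1 + of_bool (a \<inter> Q = {}))"
        by (subst bernoulli_mean_const) (auto simp: W'_def W_def jj_def j')
      finally show ?thesis .
    qed
    have "bernoulli_mean p (inner_pairs (gap v)) (\<lambda>e. of_bool (?fail (Suc T) v r (out \<union> e)))
        = bernoulli_mean p A (\<lambda>a. bernoulli_mean p W (\<lambda>b. of_bool (?fail (Suc T) v r (out \<union> (a \<union> b)))))"
      unfolding AW using fin by (intro bernoulli_mean_Un) (auto simp: A_def)
    also have "\<dots> \<le> bernoulli_mean p A (\<lambda>a. 2 ^ j' * ?q ^ T * (1 + of_bool (a \<inter> Q = {})))"
      using inner p01 by (intro bernoulli_mean_mono) auto
    also have "\<dots> = 2 ^ j' * ?q ^ T * (1 + (\<Prod>e\<in>Q. 1 - p e))"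
      by (simp add: bernoulli_mean_cmult bernoulli_mean_add bernoulli_mean_const fin
          bernoulli_mean_avoid[OF fin(1) QA])
    also have "\<dots> \<le> 2 ^ j' * ?q ^ T * (1 + q0)"
      using Q3 q0 by (intro mult_left_mono) auto
    also have "\<dots> = 2 ^ j * ?q ^ Suc T" by (simp add: j')
    finally show ?thesis .
  qed
qed

end


section \<open>Measurability of the routing\<close>

lemma Int_nonempty_image:
  "B \<subseteq> f ` J \<Longrightarrow> B \<inter> A \<noteq> {} \<longleftrightarrow> (\<exists>j\<in>J. f j \<in> B \<and> f j \<in> A)"
  by (auto simp: disjoint_iff)

lemma mem_image_Collect:
  "u \<in> f ` {j. j < m \<and> P j} \<longleftrightarrow> (\<exists>j\<in>{..<m}. u = f j \<and> P j)"
  by auto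

lemma pred_eq_borel [measurable (raw)]:
  fixes f g :: "'s \<Rightarrow> point"
  assumes [measurable]: "f \<in> borel_measurable S" "g \<in> borel_measurable S"
  shows "Measurable.pred S (\<lambda>s. f s = g s)"
  unfolding pred_def by (rule measurable_equality_set[OF assms])

context
  fixes L R :: real and m :: nat and e :: "(nat \<times> nat) set" and \<rho> :: rule
    and S :: "'s measure" and x :: "'s \<Rightarrow> nat \<Rightarrow> point" and t :: "'s \<Rightarrow> point"
  assumes e: "e \<subseteq> index_pairs m"
    and rule: "routing_rule L \<rho>"
    and x [measurable]: "\<And>i. (\<lambda>s. x s i) \<in> borel_measurable S"
    and t [measurable]: "t \<in> borel_measurable S"
begin

abbreviation (input) "near_indices s v \<equiv> {j. j < m \<and> x s j \<noteq> v \<and> torus_dist L v (x s j) < R}"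
abbreviation (input) "shortcut_indices s v \<equiv> {j. j < m \<and> (\<exists>i<m. (i, j) \<in> e \<union> e\<inverse> \<and> x s i = v)}"

lemma local_contacts_indices: "local_contacts L R (x s ` {..<m}) v = x s ` near_indices s v"
  by (auto simp: local_contacts_def)

lemma shortcut_contacts_indices: "shortcut_contacts (links (x s) e) v = x s ` shortcut_indices s v"
proof
  show "shortcut_contacts (links (x s) e) v \<subseteq> x s ` shortcut_indices s v"
  proof
    fix y assume "y \<in> shortcut_contacts (links (x s) e) v"
    then obtain p where "p \<in> e \<union> e\<inverse>" "(v, y) = (case p of (i, j) \<Rightarrow> (x s i, x s j))"
      unfolding shortcut_contacts_def links_def mem_Collect_eq by (rule imageE)
    then obtain i j where ij: "(i, j) \<in> e \<union> e\<inverse>" "v = x s i" "y = x s j"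
      by (cases p) simp
    have "i < m" "j < m" using ij(1) e by (auto simp: index_pairs_def)
    then have "j \<in> shortcut_indices s v" using ij by blast
    then show "y \<in> x s ` shortcut_indices s v" using ij(3) by (rule image_eqI[rotated])
  qed
  show "x s ` shortcut_indices s v \<subseteq> shortcut_contacts (links (x s) e) v"
  proof
    fix y assume "y \<in> x s ` shortcut_indices s v"
    then obtain i j where ij: "(i, j) \<in> e \<union> e\<inverse>" "x s i = v" "y = x s j" by blast
    then have "(v, y) \<in> links (x s) e"
      unfolding links_def by (intro image_eqI[of _ _ "(i, j)"]) simp_all
    then show "y \<in> shortcut_contacts (links (x s) e) v" by (simp add: shortcut_contacts_def)
  qed
qed

lemma local_contacts_mem:
  "u \<in> local_contacts L R (x s ` {..<m}) v \<longleftrightarrow>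
    (\<exists>j\<in>{..<m}. u = x s j) \<and> u \<noteq> v \<and> torus_dist L v u < R"
  by (auto simp: local_contacts_def)

lemma shortcut_contacts_mem:
  "u \<in> shortcut_contacts (links (x s) e) v \<longleftrightarrow>
    (\<exists>j\<in>{..<m}. u = x s j \<and> (\<exists>i\<in>{..<m}. (i, j) \<in> e \<union> e\<inverse> \<and> x s i = v))"
  unfolding shortcut_contacts_indices mem_image_Collect by (simp only: Bex_def lessThan_iff)

text \<open>
  Measurability of a rule is given for sets enumerated by initial segments of the natural numbers;
  a fixed finite index set is brought into this form by any enumeration of it.
\<close>
lemma rule_measurable_finite:
  assumes [measurable]: "v \<in> borel_measurable S" "r \<in> borel_measurable S"
    and fin: "finite J" "finite I"
  shows "(\<lambda>s. \<rho> (v s) (x s ` J) (x s ` I) (t s) (r s)) \<in> borel_measurable S"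
proof -
  obtain f k where f: "J = f ` {..<k::nat}"
    using finite_imp_nat_seg_image_inj_on[OF fin(1)] by (auto simp: lessThan_def)
  obtain g l where g: "I = g ` {..<l::nat}"
    using finite_imp_nat_seg_image_inj_on[OF fin(2)] by (auto simp: lessThan_def)
  let ?F = "\<lambda>(x, t, r, y, z). \<rho> x (y ` {..<k}) (z ` {..<l}) t r"
  let ?h = "\<lambda>s. (v s, t s, r s, \<lambda>i\<in>{..<k}. x s (f i), \<lambda>i\<in>{..<l}. x s (g i))"
  have F: "?F \<in> borel_measurable
      (borel \<Otimes>\<^sub>M borel \<Otimes>\<^sub>M borel \<Otimes>\<^sub>M PiM {..<k} (\<lambda>_. borel) \<Otimes>\<^sub>M PiM {..<l} (\<lambda>_. borel))"
    using rule unfolding routing_rule_def by blast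
  have "?h \<in> measurable S
      (borel \<Otimes>\<^sub>M borel \<Otimes>\<^sub>M borel \<Otimes>\<^sub>M PiM {..<k} (\<lambda>_. borel) \<Otimes>\<^sub>M PiM {..<l} (\<lambda>_. borel))"
    by (intro measurable_Pair measurable_restrict x assms t)
  from measurable_compose[OF this F] show ?thesis
    by (simp add: f g image_image)
qed

text \<open>
  The sets of indices of the contacts take finitely many values, and on each of the corresponding
  events \<open>rule_measurable_finite\<close> applies.
\<close>
lemma next_hop_measurable:
  assumes v [measurable]: "v \<in> borel_measurable S" and r [measurable]: "r \<in> borel_measurable S"
  shows "(\<lambda>s. \<rho> (v s) (local_contacts L R (x s ` {..<m}) (v s))
      (shortcut_contacts (links (x s) e) (v s)) (t s) (r s)) \<in> borel_measurable S"
proof -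
  let ?P = "Pow {..<m} \<times> Pow {..<m}"
  have "(\<lambda>s. (\<lambda>(J, I) s. \<rho> (v s) (x s ` J) (x s ` I) (t s) (r s))
      (near_indices s (v s), shortcut_indices s (v s)) s) \<in> borel_measurable S"
  proof (rule measurable_compose_countable'[where I = ?P])
    fix p assume "p \<in> ?P"
    then show "(case p of (J, I) \<Rightarrow> \<lambda>s. \<rho> (v s) (x s ` J) (x s ` I) (t s) (r s)) \<in> borel_measurable S"
      by (auto intro!: rule_measurable_finite[OF v r] intro: finite_subset)
  next
    show "(\<lambda>s. (near_indices s (v s), shortcut_indices s (v s))) \<in> measurable S (count_space ?P)"
    proof (subst measurable_count_space_eq2, simp, intro conjI ballI)
      fix p assume "p \<in> ?P"
      then obtain J I where p: "p = (J, I)" "J \<subseteq> {..<m}" "I \<subseteq> {..<m}" by auto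
      have "(\<lambda>s. (near_indices s (v s), shortcut_indices s (v s))) -` {p} \<inter> space S =
          {s\<in>space S. (\<forall>j\<in>{..<m}. (j \<in> J) = (x s j \<noteq> v s \<and> torus_dist L (v s) (x s j) < R)) \<and>
             (\<forall>j\<in>{..<m}. (j \<in> I) = (\<exists>i\<in>{..<m}. (i, j) \<in> e \<union> e\<inverse> \<and> x s i = v s))}"
        using p by (auto simp: set_eq_iff)
      also have "\<dots> \<in> sets S" by measurable
      finally show "(\<lambda>s. (near_indices s (v s), shortcut_indices s (v s))) -` {p} \<inter> space S \<in> sets S" .
    qed auto
  qed (intro countable_finite, simp)
  then show ?thesis
    by (simp add: local_contacts_indices shortcut_contacts_indices)
qed

lemma forwards_zero: "\<not> forwards L' R' V' S' \<rho>' t' v' r' 0"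
proof
  assume "forwards L' R' V' S' \<rho>' t' v' r' 0"
  then show False by cases simp_all
qed

text \<open>
  The inductive definition as a recursion on the number of hops, for any arguments.
\<close>
lemma forwards_Suc:
  "forwards L' R' V' S' \<rho>' t' v' r' (Suc k) \<longleftrightarrow>
    (if t' \<in> local_contacts L' R' V' v' then k = 0
     else \<rho>' v' (local_contacts L' R' V' v') (shortcut_contacts S' v') t' r'
            \<in> allowed_hops L' v' (local_contacts L' R' V' v') (shortcut_contacts S' v') t' r' \<and>
          forwards L' R' V' S' \<rho>' t' (\<rho>' v' (local_contacts L' R' V' v') (shortcut_contacts S' v') t' r')
            (if torus_dist L' (\<rho>' v' (local_contacts L' R' V' v') (shortcut_contacts S' v') t' r') t' \<le> r' / 2
             then r' / 2 else r') k)"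
proof (cases "t' \<in> local_contacts L' R' V' v'")
  case True
  then have "forwards L' R' V' S' \<rho>' t' v' r' (Suc 0)"
    using deliver by (metis One_nat_def)
  moreover have "k = 0" if "forwards L' R' V' S' \<rho>' t' v' r' (Suc k)"
    using that True by cases simp_all
  ultimately show ?thesis using True by auto
next
  case False
  show ?thesis
    unfolding if_not_P[OF False]
  proof
    assume "forwards L' R' V' S' \<rho>' t' v' r' (Suc k)"
    then show "\<rho>' v' (local_contacts L' R' V' v') (shortcut_contacts S' v') t' r'
            \<in> allowed_hops L' v' (local_contacts L' R' V' v') (shortcut_contacts S' v') t' r' \<and>
          forwards L' R' V' S' \<rho>' t' (\<rho>' v' (local_contacts L' R' V' v') (shortcut_contacts S' v') t' r')
            (if torus_dist L' (\<rho>' v' (local_contacts L' R' V' v') (shortcut_contacts S' v') t' r') t' \<le> r' / 2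
             then r' / 2 else r') k"
      by cases (use False in simp_all)
  qed (use forward[OF False refl] in blast)
qed

lemma forwards_measurable:
  assumes "v \<in> borel_measurable S" "r \<in> borel_measurable S"
  shows "Measurable.pred S (\<lambda>s. forwards L R (x s ` {..<m}) (links (x s) e) \<rho> (t s) (v s) (r s) k)"
  using assms
proof (induction k arbitrary: v r)
  case 0
  then show ?case by (simp add: forwards_zero)
next
  case (Suc k)
  note [measurable] = Suc.prems
  let ?C = "\<lambda>s. local_contacts L R (x s ` {..<m}) (v s)"
  let ?D = "\<lambda>s. shortcut_contacts (links (x s) e) (v s)"
  define y where "y s = \<rho> (v s) (?C s) (?D s) (t s) (r s)" for s
  have [measurable]: "y \<in> borel_measurable S"
    unfolding y_def using next_hop_measurable[OF Suc.prems] .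
  have C [measurable]: "Measurable.pred S (\<lambda>s. u s \<in> ?C s)" if [measurable]: "u \<in> borel_measurable S" for u
    unfolding local_contacts_mem by measurable
  have D [measurable]: "Measurable.pred S (\<lambda>s. u s \<in> ?D s)" if [measurable]: "u \<in> borel_measurable S" for u
    unfolding shortcut_contacts_mem by measurable
  have A: "Measurable.pred S (\<lambda>s. ?D s \<inter> annulus L (t s) (r s) \<noteq> {})"
  proof -
    have "?D s \<subseteq> x s ` {..<m}" for s by (auto simp: shortcut_contacts_indices)
    then have "?D s \<inter> annulus L (t s) (r s) \<noteq> {} \<longleftrightarrow>
        (\<exists>j\<in>{..<m}. x s j \<in> ?D s \<and> x s j \<in> annulus L (t s) (r s))" for s
      by (rule Int_nonempty_image)
    then have "?D s \<inter> annulus L (t s) (r s) \<noteq> {} \<longleftrightarrow>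
        (\<exists>j\<in>{..<m}. x s j \<in> ?D s \<and> r s / 4 < torus_dist L (t s) (x s j) \<and> torus_dist L (t s) (x s j) \<le> r s / 2)" for s
      by (simp add: annulus_def)
    then show ?thesis by simp
  qed
  have [measurable]: "Measurable.pred S (\<lambda>s. y s \<in> allowed_hops L (v s) (?C s) (?D s) (t s) (r s))"
  proof -
    have "y s \<in> allowed_hops L (v s) (?C s) (?D s) (t s) (r s) \<longleftrightarrow>
        (if ?D s \<inter> annulus L (t s) (r s) \<noteq> {}
         then y s \<in> ?D s \<and> r s / 4 < torus_dist L (t s) (y s) \<and> torus_dist L (t s) (y s) \<le> r s / 2
         else y s \<in> ?C s \<and> torus_dist L (y s) (t s) < torus_dist L (v s) (t s))" for s
      by (simp add: allowed_hops_def annulus_def)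
    then show ?thesis using A by simp
  qed
  have [measurable]: "Measurable.pred S (\<lambda>s. forwards L R (x s ` {..<m}) (links (x s) e) \<rho> (t s) (y s)
      (if torus_dist L (y s) (t s) \<le> r s / 2 then r s / 2 else r s) k)"
    by (rule Suc.IH) measurable
  show ?case
    unfolding forwards_Suc y_def[symmetric] by measurable
qed

lemma delivers_measurable:
  assumes [measurable]: "v \<in> borel_measurable S"
  shows "Measurable.pred S (\<lambda>s. delivers L R (x s ` {..<m}) (links (x s) e) \<rho> (v s) (t s) k)"
proof -
  have [measurable]: "Measurable.pred S (\<lambda>s. forwards L R (x s ` {..<m}) (links (x s) e) \<rho> (t s) (v s)
      (torus_dist L (v s) (t s)) k)"
    by (rule forwards_measurable) measurable
  show ?thesis
    unfolding delivers_def Un_iff local_contacts_mem shortcut_contacts_mem by measurable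
qed

end


section \<open>Counts and pairs of points of a Poisson process\<close>

lemma markov_space:
  assumes "u \<in> borel_measurable M"
  shows "emeasure M {\<omega>\<in>space M. 1 \<le> c * u \<omega>} \<le> c * (\<integral>\<^sup>+\<omega>. u \<omega> \<partial>M)"
proof -
  have "(\<integral>\<^sup>+\<omega>. u \<omega> * indicator (space M) \<omega> \<partial>M) = (\<integral>\<^sup>+\<omega>. u \<omega> \<partial>M)"
    by (intro nn_integral_cong) simp
  then show ?thesis
    using nn_integral_Markov_inequality[where u = u and A = "space M" and M = M and c = c] assms by simp
qed

locale poisson_points = prob_space M for M :: "'a measure" +
  fixes Q :: "point set" and N :: "'a \<Rightarrow> nat" and X :: "'a \<Rightarrow> nat \<Rightarrow> point"
  assumes process: "poisson_process M Q N X"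
    and Q_borel [measurable]: "Q \<in> sets borel"
    and Q_finite: "emeasure lborel Q < \<infinity>"
begin

lemma N_measurable [measurable]: "N \<in> measurable M (count_space UNIV)"
  using process by (simp add: poisson_process_def)

lemma X_measurable [measurable]: "(\<lambda>\<omega>. X \<omega> i) \<in> borel_measurable M"
  using process by (simp add: poisson_process_def)

lemma point_in: "\<omega> \<in> space M \<Longrightarrow> i < N \<omega> \<Longrightarrow> X \<omega> i \<in> Q"
  using process by (auto simp: poisson_process_def nodes_def)

lemma point_count_measurable [measurable]:
  assumes [measurable]: "A \<in> sets borel"
  shows "point_count N X A \<in> measurable M (count_space UNIV)"
  unfolding point_count_def[abs_def] by measurable

lemma emeasure_region:
  assumes "A \<in> sets borel" "A \<subseteq> Q"
  shows "emeasure lborel A = ennreal (measure lborel A)"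
  using assms Q_finite emeasure_mono[of A Q lborel]
  by (intro emeasure_eq_ennreal_measure) (auto simp: top_unique)

lemma nn_integral_point_count:
  assumes [measurable]: "A \<in> sets borel" and A: "A \<subseteq> Q"
  shows "(\<integral>\<^sup>+\<omega>. f (point_count N X A \<omega>) \<partial>M) =
    (\<Sum>k. f k * ennreal (exp (- measure lborel A) * measure lborel A ^ k / fact k))"
proof -
  let ?p = "\<lambda>k. ennreal (exp (- measure lborel A) * measure lborel A ^ k / fact k)"
  have "distr M (count_space UNIV) (point_count N X A) = density (count_space UNIV) ?p"
  proof (rule measure_eqI_countable)
    fix k :: nat
    have "emeasure (distr M (count_space UNIV) (point_count N X A)) {k} =
        emeasure M {\<omega>\<in>space M. point_count N X A \<omega> = k}"
      by (subst emeasure_distr) (auto intro!: arg_cong[where f = "emeasure M"])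
    also have "\<dots> = ?p k"
      using process assms by (simp add: emeasure_eq_measure poisson_process_def)
    also have "\<dots> = emeasure (density (count_space UNIV) ?p) {k}"
      by (subst emeasure_density) (auto simp: nn_integral_count_space_indicator[symmetric] nn_integral_count_space_finite)
    finally show "emeasure (distr M (count_space UNIV) (point_count N X A)) {k} =
        emeasure (density (count_space UNIV) ?p) {k}" .
  qed auto
  then have "(\<integral>\<^sup>+k. f k \<partial>distr M (count_space UNIV) (point_count N X A)) =
      (\<integral>\<^sup>+k. f k \<partial>density (count_space UNIV) ?p)" by simp
  then show ?thesis
    by (simp add: nn_integral_distr nn_integral_density nn_integral_count_space_nat mult.commute)
qed

lemma point_count_mgf:
  assumes "A \<in> sets borel" "A \<subseteq> Q"
  shows "(\<integral>\<^sup>+\<omega>. ennreal (exp (s * real (point_count N X A \<omega>))) \<partial>M) =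
    ennreal (exp (measure lborel A * (exp s - 1)))"
proof -
  let ?l = "measure lborel A"
  have "(\<lambda>k. exp (- ?l) * ((exp s * ?l) ^ k /\<^sub>R fact k)) sums (exp (- ?l) * exp (exp s * ?l))"
    by (intro sums_mult exp_converges)
  moreover have "exp (- ?l) * ((exp s * ?l) ^ k /\<^sub>R fact k) =
      exp (s * real k) * (exp (- ?l) * ?l ^ k / fact k)" for k
    by (simp add: power_mult_distrib exp_of_nat_mult[symmetric] mult.commute divide_simps)
  ultimately have "(\<lambda>k. exp (s * real k) * (exp (- ?l) * ?l ^ k / fact k)) sums
      exp (?l * (exp s - 1))"
    by (simp add: exp_add[symmetric] algebra_simps)
  then have "(\<Sum>k. ennreal (exp (s * real k) * (exp (- ?l) * ?l ^ k / fact k))) =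
      ennreal (exp (?l * (exp s - 1)))"
    by (intro suminf_ennreal_eq) auto
  then show ?thesis
    using nn_integral_point_count[OF assms, of "\<lambda>k. ennreal (exp (s * real k))"]
    by (simp add: ennreal_mult[symmetric])
qed

text \<open>
  Chernoff's bound with parameter \<open>s = 1\<close>, using \<open>exp 1 - 1 \<le> 2\<close>.
\<close>
lemma point_count_upper_tail:
  assumes [measurable]: "A \<in> sets borel" and A: "A \<subseteq> Q" and l: "measure lborel A \<le> l"
  shows "prob {\<omega>\<in>space M. y \<le> real (point_count N X A \<omega>)} \<le> exp (2 * l - y)"
proof -
  have "emeasure M {\<omega>\<in>space M. y \<le> real (point_count N X A \<omega>)} \<le>
      emeasure M {\<omega>\<in>space M. 1 \<le> ennreal (exp (- y)) * ennreal (exp (1 * real (point_count N X A \<omega>)))}"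
    by (intro emeasure_mono) (auto simp: ennreal_mult[symmetric] exp_add[symmetric])
  also have "\<dots> \<le> ennreal (exp (- y)) * (\<integral>\<^sup>+\<omega>. ennreal (exp (1 * real (point_count N X A \<omega>))) \<partial>M)"
    by (rule markov_space) measurable
  also have "\<dots> = ennreal (exp (measure lborel A * (exp 1 - 1) - y))"
    by (subst point_count_mgf[OF assms(1,2)]) (simp add: ennreal_mult[symmetric] exp_add[symmetric])
  also have "\<dots> \<le> ennreal (exp (2 * l - y))"
  proof -
    have "measure lborel A * (exp 1 - 1) \<le> measure lborel A * 2"
      using exp_le by (intro mult_left_mono) auto
    then show ?thesis using l by (intro ennreal_leI) simp
  qed
  finally show ?thesis by (simp add: emeasure_eq_measure)
qed

text \<open>
  Chernoff's bound with parameter \<open>s = - 1\<close>, using \<open>exp (- 1) \<le> 1 / 2\<close>.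
\<close>
lemma point_count_lower_tail:
  assumes [measurable]: "A \<in> sets borel" and A: "A \<subseteq> Q"
  shows "prob {\<omega>\<in>space M. real (point_count N X A \<omega>) \<le> y} \<le> exp (y - measure lborel A / 2)"
proof -
  have "emeasure M {\<omega>\<in>space M. real (point_count N X A \<omega>) \<le> y} \<le>
      emeasure M {\<omega>\<in>space M. 1 \<le> ennreal (exp y) * ennreal (exp (- 1 * real (point_count N X A \<omega>)))}"
    by (intro emeasure_mono) (auto simp: ennreal_mult[symmetric] exp_add[symmetric])
  also have "\<dots> \<le> ennreal (exp y) * (\<integral>\<^sup>+\<omega>. ennreal (exp (- 1 * real (point_count N X A \<omega>))) \<partial>M)"
    by (rule markov_space) measurable
  also have "\<dots> = ennreal (exp (y + measure lborel A * (exp (- 1) - 1)))"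
    by (subst point_count_mgf[OF assms(1,2)]) (simp add: ennreal_mult[symmetric] exp_add[symmetric])
  also have "\<dots> \<le> ennreal (exp (y - measure lborel A / 2))"
  proof -
    have "(2::real) \<le> exp 1" using exp_ge_add_one_self[of "1::real"] by simp
    then have "exp (- 1 :: real) \<le> 1 / 2" by (simp add: exp_minus field_simps)
    then have "measure lborel A * (exp (- 1) - 1) \<le> measure lborel A * (- 1 / 2)"
      by (intro mult_left_mono) auto
    then show ?thesis by (intro ennreal_leI) simp
  qed
  finally show ?thesis by (simp add: emeasure_eq_measure)
qed

lemma point_count_mean:
  assumes "A \<in> sets borel" "A \<subseteq> Q"
  shows "(\<integral>\<^sup>+\<omega>. ennreal (real (point_count N X A \<omega>)) \<partial>M) = emeasure lborel A"
proof -
  let ?l = "measure lborel A"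
  let ?p = "\<lambda>k. exp (- ?l) * ?l ^ k / fact k"
  have p: "?p sums (exp (- ?l) * exp ?l)"
    using sums_mult[OF exp_converges[of ?l], of "exp (- ?l)"] by (simp add: divide_inverse mult_ac)
  have "(\<lambda>k. real (Suc k) * ?p (Suc k)) sums ?l"
    using sums_mult[OF p, of ?l]
    by (simp add: exp_minus field_simps del: of_nat_Suc)
  then have "(\<lambda>k. real k * ?p k) sums ?l"
    using sums_Suc[of "\<lambda>k. real k * ?p k" ?l] by simp
  then have "(\<Sum>k. ennreal (real k * ?p k)) = ennreal ?l"
    by (intro suminf_ennreal_eq) auto
  then show ?thesis
    using nn_integral_point_count[OF assms, of "\<lambda>k. ennreal (real k)"]
    by (simp add: ennreal_mult[symmetric] emeasure_region[OF assms])
qed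

lemma point_count_factorial_moment:
  assumes "A \<in> sets borel" "A \<subseteq> Q"
  shows "(\<integral>\<^sup>+\<omega>. ennreal (real (point_count N X A \<omega> * (point_count N X A \<omega> - 1))) \<partial>M) =
    emeasure lborel A * emeasure lborel A"
proof -
  let ?l = "measure lborel A"
  let ?p = "\<lambda>k. exp (- ?l) * ?l ^ k / fact k"
  let ?f = "\<lambda>k::nat. real (k * (k - 1))"
  have p: "?p sums (exp (- ?l) * exp ?l)"
    using sums_mult[OF exp_converges[of ?l], of "exp (- ?l)"] by (simp add: divide_inverse mult_ac)
  have "?f (Suc (Suc k)) * ?p (Suc (Suc k)) = ?l * ?l * ?p k" for k
  proof -
    have cancel: "(a * b) * (z / (a * (b * F))) = z / F" if "a \<noteq> 0" "b \<noteq> 0" for a b z F :: real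
      using that by (simp add: field_simps)
    have "?f (Suc (Suc k)) = real (Suc (Suc k)) * real (Suc k)"
      "fact (Suc (Suc k)) = real (Suc (Suc k)) * (real (Suc k) * fact k)"
      by (simp_all add: algebra_simps)
    then have "?f (Suc (Suc k)) * ?p (Suc (Suc k)) = exp (- ?l) * ?l ^ Suc (Suc k) / fact k"
      using cancel[of "real (Suc (Suc k))" "real (Suc k)" "exp (- ?l) * ?l ^ Suc (Suc k)" "fact k"]
      by (metis of_nat_neq_0)
    then show ?thesis by simp
  qed
  then have "(\<lambda>k. ?f (Suc (Suc k)) * ?p (Suc (Suc k))) sums (?l * ?l)"
    using sums_mult[OF p, of "?l * ?l"] by (simp add: exp_minus)
  then have "(\<lambda>k. ?f k * ?p k) sums (?l * ?l)"
    using sums_Suc[of "\<lambda>k. ?f (Suc k) * ?p (Suc k)" "?l * ?l"]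
      sums_Suc[of "\<lambda>k. ?f k * ?p k" "?l * ?l"] by simp
  then have "(\<Sum>k. ennreal (?f k * ?p k)) = ennreal (?l * ?l)"
    by (intro suminf_ennreal_eq) auto
  then show ?thesis
    using nn_integral_point_count[OF assms, of "\<lambda>k. ennreal (?f k)"]
    by (simp add: ennreal_mult[symmetric] emeasure_region[OF assms])
qed

lemma point_count_product:
  assumes "A \<in> sets borel" "A \<subseteq> Q" "B \<in> sets borel" "B \<subseteq> Q" "A \<inter> B = {}"
  shows "(\<integral>\<^sup>+\<omega>. ennreal (real (point_count N X A \<omega>)) * ennreal (real (point_count N X B \<omega>)) \<partial>M) =
    emeasure lborel A * emeasure lborel B"
proof -
  \<comment> \<open>Independence is stated for infinite families; the other members are empty.\<close>
  define C :: "nat \<Rightarrow> point set" where "C i = (if i = 0 then A else if i = 1 then B else {})" for i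
  have indep: "\<forall>A :: nat \<Rightarrow> point set. range A \<subseteq> sets borel \<and> (\<forall>i. A i \<subseteq> Q) \<and> disjoint_family A \<longrightarrow>
      indep_vars (\<lambda>_. count_space UNIV) (\<lambda>i. point_count N X (A i)) UNIV"
    using process unfolding poisson_process_def by (elim conjE)
  have "range C \<subseteq> sets borel \<and> (\<forall>i. C i \<subseteq> Q) \<and> disjoint_family C"
    using assms by (auto simp: C_def disjoint_family_on_def)
  then have "indep_vars (\<lambda>_. count_space UNIV) (\<lambda>i. point_count N X (C i)) UNIV"
    by (rule indep[rule_format])
  then have "indep_vars (\<lambda>_. count_space UNIV) (\<lambda>i. point_count N X (C i)) {0, 1}"
    by (rule indep_vars_subset) auto
  from indep_vars_compose2[OF this, where Y = "\<lambda>i k. ennreal (real k)" and N = "\<lambda>_. borel"]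
  have "indep_vars (\<lambda>_. borel) (\<lambda>i \<omega>. ennreal (real (point_count N X (C i) \<omega>))) {0, 1}"
    by simp
  then have "(\<integral>\<^sup>+\<omega>. (\<Prod>i\<in>{0, 1}. ennreal (real (point_count N X (C i) \<omega>))) \<partial>M) =
      (\<Prod>i\<in>{0, 1}. \<integral>\<^sup>+\<omega>. ennreal (real (point_count N X (C i) \<omega>)) \<partial>M)"
    by (intro indep_vars_nn_integral) auto
  then show ?thesis
    using assms by (simp add: C_def point_count_mean)
qed

text \<open>
  Splitting the two regions into their common part and the rest leaves products of counts in disjoint
  regions and one factorial square, whose means are known.
\<close>
lemma card_distinct_pairs:
  fixes Y :: "nat \<Rightarrow> point"
  assumes "\<And>i. i < k \<Longrightarrow> Y i \<in> Q"
  defines "c \<equiv> \<lambda>A. card {i. i < k \<and> Y i \<in> A}"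
  shows "card {(i, j). i < k \<and> j < k \<and> i \<noteq> j \<and> Y i \<in> A \<and> Y j \<in> B} =
    c (A \<inter> Q - B) * c (B \<inter> Q - A) + c (A \<inter> Q - B) * c (A \<inter> B \<inter> Q) +
    c (A \<inter> B \<inter> Q) * c (B \<inter> Q - A) + c (A \<inter> B \<inter> Q) * (c (A \<inter> B \<inter> Q) - 1)"
proof -
  let ?I = "\<lambda>A. {i. i < k \<and> Y i \<in> A}"
  have split: "c (C \<inter> Q - D) + c (C \<inter> D \<inter> Q) = card (?I C)" for C D
    unfolding c_def by (subst card_Un_disjoint[symmetric]) (auto intro!: arg_cong[where f = card] assms)
  have "{(i, j). i < k \<and> j < k \<and> i \<noteq> j \<and> Y i \<in> A \<and> Y j \<in> B} =
      ?I A \<times> ?I B - (\<lambda>i. (i, i)) ` ?I (A \<inter> B \<inter> Q)"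
    using assms by auto
  also have "card \<dots> = card (?I A \<times> ?I B) - card ((\<lambda>i. (i, i)) ` ?I (A \<inter> B \<inter> Q))"
    by (intro card_Diff_subset) auto
  also have "\<dots> = card (?I A) * card (?I B) - c (A \<inter> B \<inter> Q)"
    by (simp add: card_image inj_on_def card_cartesian_product c_def)
  also have "\<dots> = (c (A \<inter> Q - B) + c (A \<inter> B \<inter> Q)) * (c (B \<inter> Q - A) + c (A \<inter> B \<inter> Q)) - c (A \<inter> B \<inter> Q)"
    using split[of A B] split[of B A] by (simp add: Int_commute[of B A])
  also have "\<dots> = c (A \<inter> Q - B) * c (B \<inter> Q - A) + c (A \<inter> Q - B) * c (A \<inter> B \<inter> Q) +
    c (A \<inter> B \<inter> Q) * c (B \<inter> Q - A) + c (A \<inter> B \<inter> Q) * (c (A \<inter> B \<inter> Q) - 1)"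
    by (cases "c (A \<inter> B \<inter> Q)") (simp_all add: algebra_simps)
  finally show ?thesis .
qed

lemma second_factorial_moment_rectangle:
  assumes [measurable]: "A \<in> sets borel" "B \<in> sets borel"
  shows "(\<integral>\<^sup>+\<omega>. ennreal (real (card {(i, j). i < N \<omega> \<and> j < N \<omega> \<and> i \<noteq> j \<and> X \<omega> i \<in> A \<and> X \<omega> j \<in> B})) \<partial>M) =
    emeasure lborel (A \<inter> Q) * emeasure lborel (B \<inter> Q)"
proof -
  let ?c = "\<lambda>A \<omega>. ennreal (real (point_count N X A \<omega>))"
  define D1 D2 C where "D1 = A \<inter> Q - B" and "D2 = B \<inter> Q - A" and "C = A \<inter> B \<inter> Q"
  have [measurable]: "D1 \<in> sets borel" "D2 \<in> sets borel" "C \<in> sets borel"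
    unfolding D1_def D2_def C_def by auto
  have sub: "D1 \<subseteq> Q" "D2 \<subseteq> Q" "C \<subseteq> Q" and disj: "D1 \<inter> D2 = {}" "D1 \<inter> C = {}" "C \<inter> D2 = {}"
    by (auto simp: D1_def D2_def C_def)
  have "(\<integral>\<^sup>+\<omega>. ennreal (real (card {(i, j). i < N \<omega> \<and> j < N \<omega> \<and> i \<noteq> j \<and> X \<omega> i \<in> A \<and> X \<omega> j \<in> B})) \<partial>M) =
    (\<integral>\<^sup>+\<omega>. ?c D1 \<omega> * ?c D2 \<omega> + ?c D1 \<omega> * ?c C \<omega> + ?c C \<omega> * ?c D2 \<omega> +
       ennreal (real (point_count N X C \<omega> * (point_count N X C \<omega> - 1))) \<partial>M)"
  proof (rule nn_integral_cong)
    fix \<omega> assume "\<omega> \<in> space M"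
    then show "ennreal (real (card {(i, j). i < N \<omega> \<and> j < N \<omega> \<and> i \<noteq> j \<and> X \<omega> i \<in> A \<and> X \<omega> j \<in> B})) =
      ?c D1 \<omega> * ?c D2 \<omega> + ?c D1 \<omega> * ?c C \<omega> + ?c C \<omega> * ?c D2 \<omega> +
       ennreal (real (point_count N X C \<omega> * (point_count N X C \<omega> - 1)))"
      by (subst card_distinct_pairs) (auto simp: point_in D1_def D2_def C_def point_count_def
          ennreal_plus[symmetric] ennreal_mult[symmetric] simp del: ennreal_plus)
  qed
  also have "\<dots> = emeasure lborel D1 * emeasure lborel D2 + emeasure lborel D1 * emeasure lborel C +
      emeasure lborel C * emeasure lborel D2 + emeasure lborel C * emeasure lborel C"
    using sub disj by (simp add: nn_integral_add point_count_product point_count_factorial_moment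
        del: of_nat_mult One_nat_def)
  also have "\<dots> = (emeasure lborel D1 + emeasure lborel C) * (emeasure lborel D2 + emeasure lborel C)"
    by (simp add: algebra_simps)
  also have "emeasure lborel D1 + emeasure lborel C = emeasure lborel (A \<inter> Q)"
    using disj by (subst plus_emeasure) (auto simp: D1_def C_def intro!: arg_cong[where f = "emeasure lborel"])
  also have "emeasure lborel D2 + emeasure lborel C = emeasure lborel (B \<inter> Q)"
    using disj by (subst plus_emeasure) (auto simp: D2_def C_def intro!: arg_cong[where f = "emeasure lborel"])
  finally show ?thesis .
qed

text \<open>
  In the mean, ordered pairs of distinct points see each other as independent: their intensity is the
  product of the two intensities. Both sides are integrals of \<open>f\<close> against measures on pairs of points;
  these measures agree on rectangles by \<open>second_factorial_moment_rectangle\<close>, hence are equal.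
\<close>
lemma second_factorial_moment:
  assumes [measurable]: "f \<in> borel_measurable (borel \<Otimes>\<^sub>M borel)"
  shows "(\<integral>\<^sup>+\<omega>. (\<integral>\<^sup>+(i, j). (if i < N \<omega> \<and> j < N \<omega> \<and> i \<noteq> j then f (X \<omega> i, X \<omega> j) else 0) \<partial>count_space UNIV) \<partial>M) =
    (\<integral>\<^sup>+x. \<integral>\<^sup>+y. f (x, y) * (indicator Q x * indicator Q y) \<partial>lborel \<partial>lborel)"
proof -
  let ?C = "count_space (UNIV :: (nat \<times> nat) set)"
  define D where "D = {(\<omega>, i, j). i < N \<omega> \<and> j < N \<omega> \<and> i \<noteq> j}"
  define g where "g = (\<lambda>(\<omega>, i, j). (X \<omega> i, X \<omega> j))"
  interpret C: sigma_finite_measure ?C by (rule sigma_finite_measure_count_space)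
  have [measurable]: "Measurable.pred (M \<Otimes>\<^sub>M ?C) (\<lambda>z. z \<in> D)"
  proof -
    have "Measurable.pred (M \<Otimes>\<^sub>M ?C) (\<lambda>z. fst p < N (fst z) \<and> snd p < N (fst z) \<and> fst p \<noteq> snd p)"
      for p :: "nat \<times> nat"
      by measurable
    then have "Measurable.pred (M \<Otimes>\<^sub>M ?C)
        (\<lambda>z. fst (snd z) < N (fst z) \<and> snd (snd z) < N (fst z) \<and> fst (snd z) \<noteq> snd (snd z))"
      by (rule measurable_compose_countable[where g = snd
          and f = "\<lambda>p z. fst p < N (fst z) \<and> snd p < N (fst z) \<and> fst p \<noteq> snd p"]) measurable
    then show ?thesis by (simp add: D_def split_beta')
  qed
  have [measurable]: "g \<in> measurable (M \<Otimes>\<^sub>M ?C) (borel \<Otimes>\<^sub>M borel)"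
  proof -
    have X: "(\<lambda>z. X (fst z) i) \<in> borel_measurable (M \<Otimes>\<^sub>M ?C)" for i by measurable
    have 1: "(\<lambda>z. X (fst z) (fst (snd z))) \<in> borel_measurable (M \<Otimes>\<^sub>M ?C)"
      by (rule measurable_compose_countable[where f = "\<lambda>i z. X (fst z) i"], rule X, rule measurable_compose[OF measurable_snd]) simp
    have 2: "(\<lambda>z. X (fst z) (snd (snd z))) \<in> borel_measurable (M \<Otimes>\<^sub>M ?C)"
      by (rule measurable_compose_countable[where f = "\<lambda>i z. X (fst z) i"], rule X, rule measurable_compose[OF measurable_snd]) simp
    show ?thesis using measurable_Pair[OF 1 2] by (simp add: g_def split_beta')
  qed
  \<comment> \<open>The mean of the sum over the pairs is an integral against the image of the product of \<open>M\<close> with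
    the counting measure, restricted to the pairs of distinct indices of points.\<close>
  define \<mu> where "\<mu> = distr (density (M \<Otimes>\<^sub>M ?C) (indicator D)) (borel \<Otimes>\<^sub>M borel) g"
  have int: "(\<integral>\<^sup>+z. h z \<partial>\<mu>) = (\<integral>\<^sup>+\<omega>. (\<integral>\<^sup>+(i, j). (if i < N \<omega> \<and> j < N \<omega> \<and> i \<noteq> j then h (X \<omega> i, X \<omega> j) else 0) \<partial>?C) \<partial>M)"
    if [measurable]: "h \<in> borel_measurable (borel \<Otimes>\<^sub>M borel)" for h :: "point \<times> point \<Rightarrow> ennreal"
  proof -
    have "(\<integral>\<^sup>+z. h z \<partial>\<mu>) = (\<integral>\<^sup>+z. indicator D z * h (g z) \<partial>(M \<Otimes>\<^sub>M ?C))"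
      unfolding \<mu>_def by (simp add: nn_integral_distr nn_integral_density)
    also have "\<dots> = (\<integral>\<^sup>+\<omega>. \<integral>\<^sup>+p. indicator D (\<omega>, p) * h (g (\<omega>, p)) \<partial>?C \<partial>M)"
      by (subst C.nn_integral_fst) auto
    also have "\<dots> = (\<integral>\<^sup>+\<omega>. (\<integral>\<^sup>+(i, j). (if i < N \<omega> \<and> j < N \<omega> \<and> i \<noteq> j then h (X \<omega> i, X \<omega> j) else 0) \<partial>?C) \<partial>M)"
      by (intro nn_integral_cong) (auto simp: D_def g_def)
    finally show ?thesis .
  qed
  define \<nu> where "\<nu> = density lborel (indicator Q)"
  have \<nu>A: "emeasure \<nu> A = emeasure lborel (A \<inter> Q)" if "A \<in> sets borel" for A
    using that unfolding \<nu>_def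
    by (subst emeasure_density) (auto simp: nn_integral_indicator[symmetric] indicator_inter_arith mult.commute simp del: nn_integral_indicator)
  have "finite_measure \<nu>"
    using Q_finite by (intro finite_measureI) (simp add: \<nu>A[of UNIV] \<nu>A \<nu>_def[THEN arg_cong[where f = space]])
  then have sf: "sigma_finite_measure \<nu>" by (rule finite_measure.sigma_finite_measure)
  have sets_\<nu>: "sets \<nu> = sets borel" by (simp add: \<nu>_def)
  have "\<nu> \<Otimes>\<^sub>M \<nu> = \<mu>"
  proof (rule pair_measure_eqI[OF sf sf])
    show "sets (\<nu> \<Otimes>\<^sub>M \<nu>) = sets \<mu>"
      unfolding \<mu>_def by (simp add: sets_\<nu> cong: sets_pair_measure_cong)
    fix A B assume "A \<in> sets \<nu>" "B \<in> sets \<nu>"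
    then have [measurable]: "A \<in> sets borel" "B \<in> sets borel" by (auto simp: sets_\<nu>)
    have "emeasure \<mu> (A \<times> B) = (\<integral>\<^sup>+z. indicator (A \<times> B) z \<partial>\<mu>)"
      by (subst nn_integral_indicator) (auto simp: \<mu>_def)
    also have "\<dots> = (\<integral>\<^sup>+\<omega>. ennreal (real (card {(i, j). i < N \<omega> \<and> j < N \<omega> \<and> i \<noteq> j \<and> X \<omega> i \<in> A \<and> X \<omega> j \<in> B})) \<partial>M)"
    proof (subst int, measurable, intro nn_integral_cong)
      fix \<omega>
      let ?S = "{(i, j). i < N \<omega> \<and> j < N \<omega> \<and> i \<noteq> j \<and> X \<omega> i \<in> A \<and> X \<omega> j \<in> B}"
      have fin: "finite ?S" by (rule finite_subset[of _ "{..<N \<omega>} \<times> {..<N \<omega>}"]) auto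
      have "(\<integral>\<^sup>+(i, j). (if i < N \<omega> \<and> j < N \<omega> \<and> i \<noteq> j then indicator (A \<times> B) (X \<omega> i, X \<omega> j) else 0) \<partial>?C) =
          (\<integral>\<^sup>+p. indicator ?S p \<partial>?C)"
        by (intro nn_integral_cong) (auto simp: indicator_def split: if_splits)
      then show "(\<integral>\<^sup>+(i, j). (if i < N \<omega> \<and> j < N \<omega> \<and> i \<noteq> j then indicator (A \<times> B) (X \<omega> i, X \<omega> j) else 0) \<partial>?C) =
          ennreal (real (card ?S))"
        using fin by (simp add: emeasure_count_space ennreal_of_nat_eq_real_of_nat)
    qed
    also have "\<dots> = emeasure \<nu> A * emeasure \<nu> B"
      by (simp add: second_factorial_moment_rectangle \<nu>A)
    finally show "emeasure \<nu> A * emeasure \<nu> B = emeasure \<mu> (A \<times> B)" ..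
  qed
  then have "(\<integral>\<^sup>+z. f z \<partial>\<mu>) = (\<integral>\<^sup>+z. f z \<partial>(\<nu> \<Otimes>\<^sub>M \<nu>))" by simp
  also have "\<dots> = (\<integral>\<^sup>+x. \<integral>\<^sup>+y. f (x, y) \<partial>\<nu> \<partial>\<nu>)"
    by (subst sigma_finite_measure.nn_integral_fst[OF sf])
      (auto simp: sets_\<nu> cong: measurable_cong_sets sets_pair_measure_cong)
  also have "\<dots> = (\<integral>\<^sup>+x. \<integral>\<^sup>+y. f (x, y) * (indicator Q x * indicator Q y) \<partial>lborel \<partial>lborel)"
    unfolding \<nu>_def
    by (simp add: nn_integral_density nn_integral_cmult[symmetric] mult_ac)
  finally show ?thesis by (simp add: int)
qed

end


section \<open>The shortcuts given the positions\<close>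

sublocale poisson_small_world \<subseteq> points: poisson_points M "square (side n)" N X
  using positions by unfold_locales (auto simp: emeasure_square side_def)

context poisson_small_world
begin

definition pair_prob :: "(nat \<Rightarrow> point) \<Rightarrow> nat \<times> nat \<Rightarrow> real" where
  "pair_prob x = (\<lambda>(i, j). shortcut_prob (local_radius c n) a \<alpha> (torus_dist (side n) (x i) (x j)))"

text \<open>
  The conditional law is given for pairs with increasing indices; by symmetry and irreflexivity they
  determine all shortcuts.
\<close>
definition ordered_shortcuts :: "'a \<Rightarrow> (nat \<times> nat) set" where
  "ordered_shortcuts \<omega> = {(i, j). (i, j) \<in> E \<omega> \<and> i < j}"

abbreviation "positions_space \<equiv> PiM (UNIV :: nat set) (\<lambda>_. borel :: point measure)"

lemma pair_prob_bounds: "0 \<le> pair_prob x z \<and> pair_prob x z \<le> 1"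
  using a_pos by (cases z) (auto simp: pair_prob_def shortcut_prob_def)

lemma ordered_shortcuts_index_pairs: "\<omega> \<in> space M \<Longrightarrow> ordered_shortcuts \<omega> \<subseteq> index_pairs (N \<omega>)"
  using shortcuts_between_nodes by (fastforce simp: ordered_shortcuts_def index_pairs_def)

lemma shortcuts_eq_links:
  assumes "\<omega> \<in> space M"
  shows "shortcuts X E \<omega> = links (X \<omega>) (ordered_shortcuts \<omega>)"
proof -
  have "E \<omega> = ordered_shortcuts \<omega> \<union> (ordered_shortcuts \<omega>)\<inverse>"
  proof
    show "E \<omega> \<subseteq> ordered_shortcuts \<omega> \<union> (ordered_shortcuts \<omega>)\<inverse>"
    proof
      fix z assume z: "z \<in> E \<omega>"
      obtain i j where ij: "z = (i, j)" by (cases z)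
      have "(j, i) \<in> E \<omega>" using shortcuts_sym[OF assms] z ij by (auto dest: symD)
      moreover have "i \<noteq> j" using shortcuts_irrefl[OF assms] z ij by (auto simp: irrefl_def)
      ultimately show "z \<in> ordered_shortcuts \<omega> \<union> (ordered_shortcuts \<omega>)\<inverse>"
        using z ij by (auto simp: ordered_shortcuts_def)
    qed
    show "ordered_shortcuts \<omega> \<union> (ordered_shortcuts \<omega>)\<inverse> \<subseteq> E \<omega>"
      using shortcuts_sym[OF assms] by (auto simp: ordered_shortcuts_def dest: symD)
  qed
  then show ?thesis by (simp add: shortcuts_def links_def)
qed

lemma positions_measurable [measurable]: "X \<in> measurable M positions_space"
  by (rule measurable_PiM_single') auto

lemma position_algebra_measurable:
  "(\<lambda>\<omega>. (N \<omega>, X \<omega>)) \<in> measurable (position_algebra M N X) (count_space UNIV \<Otimes>\<^sub>M positions_space)"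
  unfolding position_algebra_def
  by (rule measurable_vimage_algebra1) (auto simp: space_pair_measure space_PiM)

lemma N_position_measurable [measurable]: "N \<in> measurable (position_algebra M N X) (count_space UNIV)"
  using measurable_compose[OF position_algebra_measurable measurable_fst] by simp

lemma X_position_measurable [measurable]: "X \<in> measurable (position_algebra M N X) positions_space"
  using measurable_compose[OF position_algebra_measurable measurable_snd] by simp

lemma space_position_algebra [simp]: "space (position_algebra M N X) = space M"
  by (simp add: position_algebra_def)

lemma subalgebra_positions: "subalgebra M (position_algebra M N X)"
proof -
  have "sets (position_algebra M N X) =
      {(\<lambda>\<omega>. (N \<omega>, X \<omega>)) -` A \<inter> space M |A. A \<in> sets (count_space UNIV \<Otimes>\<^sub>M positions_space)}"
    unfolding position_algebra_def
    by (rule sets_vimage_algebra2) (auto simp: space_pair_measure space_PiM)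
  moreover have "(\<lambda>\<omega>. (N \<omega>, X \<omega>)) \<in> measurable M (count_space UNIV \<Otimes>\<^sub>M positions_space)"
    by measurable
  ultimately have "sets (position_algebra M N X) \<subseteq> sets M"
    by (auto intro: measurable_sets)
  then show ?thesis by (simp add: subalgebra_def)
qed

lemma pair_prob_measurable [measurable]: "(\<lambda>\<omega>. pair_prob (X \<omega>) z) \<in> borel_measurable M"
  unfolding pair_prob_def shortcut_prob_def split_beta' by measurable

lemma shortcut_events_measurable [measurable]: "Measurable.pred M (\<lambda>\<omega>. z \<in> E \<omega>)"
  using shortcuts_measurable[of "fst z" "snd z"] by (simp add: pred_def)

lemma pattern_measurable [measurable]:
  assumes "finite I" "finite J"
  shows "{\<omega>\<in>space M. I \<subseteq> E \<omega> \<and> J \<inter> E \<omega> = {}} \<in> sets M"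
proof -
  have "{\<omega>\<in>space M. I \<subseteq> E \<omega> \<and> J \<inter> E \<omega> = {}} =
      {\<omega>\<in>space M. (\<forall>z\<in>I. z \<in> E \<omega>) \<and> (\<forall>z\<in>J. z \<notin> E \<omega>)}" by auto
  also have "\<dots> \<in> sets M" using assms by measurable
  finally show ?thesis .
qed

text \<open>
  Inclusion and exclusion, one forbidden edge at a time: the edges of \<open>I\<close> are present and those of \<open>J\<close>
  are absent with the product of the respective probabilities, integrated over any event \<open>H\<close> that
  is determined by the positions.
\<close>
lemma shortcuts_pattern:
  assumes H: "H \<in> sets (position_algebra M N X)"
    and "finite I" "finite J" "I \<inter> J = {}" "I \<union> J \<subseteq> {(i, j). i < j}"
    and "\<And>\<omega>. \<omega> \<in> H \<Longrightarrow> I \<union> J \<subseteq> {..<N \<omega>} \<times> {..<N \<omega>}"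
  shows "prob (H \<inter> {\<omega>\<in>space M. I \<subseteq> E \<omega> \<and> J \<inter> E \<omega> = {}}) =
    (\<integral>\<omega>. indicator H \<omega> * ((\<Prod>z\<in>I. pair_prob (X \<omega>) z) * (\<Prod>z\<in>J. 1 - pair_prob (X \<omega>) z)) \<partial>M)"
  using assms(3,2,4-)
proof (induction J arbitrary: I rule: finite_induct)
  case empty
  let ?A = "{\<omega>\<in>space M. I \<subseteq> E \<omega>}"
  interpret F: finite_measure_subalgebra M "position_algebra M N X"
    by unfold_locales (rule subalgebra_positions)
  have HM [measurable]: "H \<in> sets M" using H subalgebra_positions by (auto simp: subalgebra_def)
  have A [measurable]: "?A \<in> sets M" using pattern_measurable[of I "{}"] empty by simp
  have "prob (H \<inter> ?A) = (\<integral>\<omega>. indicator (H \<inter> ?A) \<omega> \<partial>M)" by simp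
  also have "\<dots> = (LINT \<omega>:H|M. indicator ?A \<omega>)"
    unfolding set_lebesgue_integral_def by (simp add: indicator_inter_arith)
  also have "\<dots> = (LINT \<omega>:H|M. real_cond_exp M (position_algebra M N X) (indicator ?A) \<omega>)"
    using H by (intro F.real_cond_exp_intA integrable_real_indicator A) (simp_all add: emeasure_eq_measure)
  also have "\<dots> = (\<integral>\<omega>. indicator H \<omega> * (\<Prod>z\<in>I. pair_prob (X \<omega>) z) \<partial>M)"
    unfolding set_lebesgue_integral_def
  proof (rule integral_cong_AE)
    show "AE \<omega> in M. indicator H \<omega> *\<^sub>R real_cond_exp M (position_algebra M N X) (indicator ?A) \<omega> =
        indicator H \<omega> * (\<Prod>z\<in>I. pair_prob (X \<omega>) z)"
      using shortcuts_cond_indep[of I] empty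
      by (auto simp: pair_prob_def split_beta' indicator_def)
  qed measurable
  finally show ?case by simp
next
  case (insert z J)
  have HM [measurable]: "H \<in> sets M" using H subalgebra_positions by (auto simp: subalgebra_def)
  let ?A = "\<lambda>I J. H \<inter> {\<omega>\<in>space M. I \<subseteq> E \<omega> \<and> J \<inter> E \<omega> = {}}"
  let ?w = "\<lambda>I J \<omega>. indicator H \<omega> * ((\<Prod>z\<in>I. pair_prob (X \<omega>) z) * (\<Prod>z\<in>J. 1 - pair_prob (X \<omega>) z))"
  have meas: "?A I' J' \<in> sets M" if "finite I'" "finite J'" for I' J'
    using pattern_measurable[OF that] by auto
  have int: "integrable M (?w I' J')" for I' J'
  proof (rule integrable_const_bound[where B = 1])
    show "AE \<omega> in M. norm (?w I' J' \<omega>) \<le> 1"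
      using pair_prob_bounds
      by (intro AE_I2) (auto simp: indicator_def abs_mult prod_nonneg intro!: mult_le_one prod_le_1 prod_nonneg)
  qed measurable
  have "?A I (insert z J) = ?A I J - ?A (insert z I) J" by auto
  then have "prob (?A I (insert z J)) = prob (?A I J) - prob (?A (insert z I) J)"
    using insert.prems insert.hyps
    by (simp only:) (intro finite_measure_Diff meas; auto)
  also have "prob (?A I J) = (\<integral>\<omega>. ?w I J \<omega> \<partial>M)"
    using insert.prems by (intro insert.IH) auto
  also have "prob (?A (insert z I) J) = (\<integral>\<omega>. ?w (insert z I) J \<omega> \<partial>M)"
    using insert.prems insert.hyps by (intro insert.IH) auto
  also have "(\<integral>\<omega>. ?w I J \<omega> \<partial>M) - (\<integral>\<omega>. ?w (insert z I) J \<omega> \<partial>M) = (\<integral>\<omega>. ?w I J \<omega> - ?w (insert z I) J \<omega> \<partial>M)"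
    by (intro Bochner_Integration.integral_diff[symmetric] int)
  also have "\<dots> = (\<integral>\<omega>. ?w I (insert z J) \<omega> \<partial>M)"
    using insert.prems insert.hyps
    by (intro Bochner_Integration.integral_cong) (auto simp: algebra_simps)
  finally show ?case .
qed

lemma ordered_shortcuts_pattern:
  assumes "\<omega> \<in> space M" "N \<omega> = m" "e \<subseteq> index_pairs m"
  shows "ordered_shortcuts \<omega> = e \<longleftrightarrow> e \<subseteq> E \<omega> \<and> (index_pairs m - e) \<inter> E \<omega> = {}"
proof -
  have "ordered_shortcuts \<omega> = E \<omega> \<inter> index_pairs m"
    using ordered_shortcuts_index_pairs[OF assms(1)] assms(2)
    by (auto simp: ordered_shortcuts_def index_pairs_def)
  then show ?thesis using assms(3) by auto
qed

text \<open>
  Given the number of nodes there are finitely many possible edge sets, so measurability for each of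
  them suffices.
\<close>
lemma edge_event_measurable:
  assumes bad: "\<And>m e. e \<subseteq> index_pairs m \<Longrightarrow> Measurable.pred positions_space (\<lambda>x. bad m e x)"
  shows "{\<omega>\<in>space M. bad (N \<omega>) (ordered_shortcuts \<omega>) (X \<omega>)} \<in> sets M"
proof -
  let ?A = "\<lambda>m e. {\<omega>\<in>space M. N \<omega> = m \<and> bad m e (X \<omega>)} \<inter>
      {\<omega>\<in>space M. e \<subseteq> E \<omega> \<and> (index_pairs m - e) \<inter> E \<omega> = {}}"
  have "?A m e \<in> sets M" if "e \<subseteq> index_pairs m" for m e
  proof -
    have [measurable]: "Measurable.pred M (\<lambda>\<omega>. bad m e (X \<omega>))"
      by (rule measurable_compose[OF positions_measurable bad[OF that]])
    have "finite e" using that finite_subset finite_index_pairs by blast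
    then show ?thesis by (intro sets.Int pattern_measurable) auto
  qed
  then have "(\<Union>m. \<Union>e\<in>Pow (index_pairs m). ?A m e) \<in> sets M"
    by (intro sets.countable_UN' sets.finite_UN countableI_type) auto
  also have "(\<Union>m. \<Union>e\<in>Pow (index_pairs m). ?A m e) =
      {\<omega>\<in>space M. bad (N \<omega>) (ordered_shortcuts \<omega>) (X \<omega>)}" (is "?L = ?R")
  proof
    show "?L \<subseteq> ?R"
    proof
      fix \<omega> assume "\<omega> \<in> ?L"
      then obtain m e where w: "e \<subseteq> index_pairs m" "\<omega> \<in> space M" "N \<omega> = m" "bad m e (X \<omega>)"
        "e \<subseteq> E \<omega> \<and> (index_pairs m - e) \<inter> E \<omega> = {}" by blast
      then show "\<omega> \<in> ?R" using ordered_shortcuts_pattern[OF w(2,3,1)] by simp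
    qed
    show "?R \<subseteq> ?L"
    proof
      fix \<omega> assume "\<omega> \<in> ?R"
      then have w: "\<omega> \<in> space M" "bad (N \<omega>) (ordered_shortcuts \<omega>) (X \<omega>)" by auto
      note sub = ordered_shortcuts_index_pairs[OF w(1)]
      then have "\<omega> \<in> ?A (N \<omega>) (ordered_shortcuts \<omega>)"
        using w ordered_shortcuts_pattern[OF w(1) refl sub] by simp
      then show "\<omega> \<in> ?L" using sub by blast
    qed
  qed
  finally show ?thesis .
qed

text \<open>
  A bound for independent edges that is uniform over the good positions passes to the random graph: the
  event is split according to the number of nodes and the edge set, and for a given number of nodes
  the integrals of the edge weights add up to a Bernoulli mean.
\<close>
lemma prob_edge_event_le:
  assumes good: "\<And>m. Measurable.pred positions_space (good m)"
    and bad: "\<And>m e. e \<subseteq> index_pairs m \<Longrightarrow> Measurable.pred positions_space (bad m e)"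
    and bound: "\<And>m x. good m x \<Longrightarrow> (\<And>i. i < m \<Longrightarrow> x i \<in> square (side n)) \<Longrightarrow>
      bernoulli_mean (pair_prob x) (index_pairs m) (\<lambda>e. of_bool (bad m e x)) \<le> \<epsilon>"
    and m0: "\<And>m x. good m x \<Longrightarrow> m \<le> m0" and \<epsilon>: "0 \<le> \<epsilon>"
  shows "prob {\<omega>\<in>space M. good (N \<omega>) (X \<omega>) \<and> bad (N \<omega>) (ordered_shortcuts \<omega>) (X \<omega>)} \<le> \<epsilon>"
proof -
  let ?pos = "position_algebra M N X"
  define H where "H m e = {\<omega>\<in>space M. N \<omega> = m \<and> good m (X \<omega>) \<and> bad m e (X \<omega>)}" for m e
  define A where "A m e = H m e \<inter> {\<omega>\<in>space M. e \<subseteq> E \<omega> \<and> (index_pairs m - e) \<inter> E \<omega> = {}}" for m e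
  define w where "w m e \<omega> = (\<Prod>z\<in>e. pair_prob (X \<omega>) z) * (\<Prod>z\<in>index_pairs m - e. 1 - pair_prob (X \<omega>) z)" for m e \<omega>
  have Hpos: "H m e \<in> sets ?pos" if "e \<subseteq> index_pairs m" for m e
  proof -
    have [measurable]: "Measurable.pred ?pos (\<lambda>\<omega>. good m (X \<omega>))" "Measurable.pred ?pos (\<lambda>\<omega>. bad m e (X \<omega>))"
      by (rule measurable_compose[OF X_position_measurable good]
          measurable_compose[OF X_position_measurable bad[OF that]])+
    have "{\<omega>\<in>space ?pos. N \<omega> = m \<and> good m (X \<omega>) \<and> bad m e (X \<omega>)} \<in> sets ?pos" by measurable
    then show ?thesis by (simp add: H_def)
  qed
  have HM [measurable]: "H m e \<in> sets M" if "e \<subseteq> index_pairs m" for m e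
    using Hpos[OF that] subalgebra_positions by (auto simp: subalgebra_def)
  have AM: "A m e \<in> sets M" if "e \<subseteq> index_pairs m" for m e
    unfolding A_def using HM[OF that] finite_subset[OF that finite_index_pairs]
    by (intro sets.Int pattern_measurable) auto
  have w01: "0 \<le> w m e \<omega> \<and> w m e \<omega> \<le> 1" for m e \<omega>
    unfolding w_def using pair_prob_bounds by (auto intro!: mult_le_one prod_le_1 prod_nonneg mult_nonneg_nonneg)
  have [measurable]: "w m e \<in> borel_measurable M" for m e
    unfolding w_def by measurable
  have int: "integrable M (\<lambda>\<omega>. indicator (H m e) \<omega> * w m e \<omega>)" if "e \<subseteq> index_pairs m" for m e
    using HM[OF that] w01[of m e]
    by (intro integrable_const_bound[where B = 1]) (auto simp: indicator_def)
  have level: "(\<Sum>e\<in>Pow (index_pairs m). prob (A m e)) \<le> \<epsilon> * prob {\<omega>\<in>space M. N \<omega> = m}" for m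
  proof -
    have "(\<Sum>e\<in>Pow (index_pairs m). prob (A m e)) =
        (\<Sum>e\<in>Pow (index_pairs m). \<integral>\<omega>. indicator (H m e) \<omega> * w m e \<omega> \<partial>M)"
    proof (rule sum.cong[OF refl])
      fix e assume "e \<in> Pow (index_pairs m)"
      then have e: "e \<subseteq> index_pairs m" by simp
      show "prob (A m e) = (\<integral>\<omega>. indicator (H m e) \<omega> * w m e \<omega> \<partial>M)"
        unfolding A_def w_def
      proof (rule shortcuts_pattern[OF Hpos[OF e]])
        show "finite e" "finite (index_pairs m - e)"
          using finite_subset[OF e finite_index_pairs] by simp_all
      qed (use e in \<open>auto simp: index_pairs_def H_def\<close>)
    qed
    also have "\<dots> = (\<integral>\<omega>. (\<Sum>e\<in>Pow (index_pairs m). indicator (H m e) \<omega> * w m e \<omega>) \<partial>M)"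
      by (rule Bochner_Integration.integral_sum[symmetric]) (auto intro: int)
    also have "\<dots> \<le> (\<integral>\<omega>. \<epsilon> * indicator {\<omega>\<in>space M. N \<omega> = m} \<omega> \<partial>M)"
    proof (rule integral_mono)
      show "integrable M (\<lambda>\<omega>. \<Sum>e\<in>Pow (index_pairs m). indicator (H m e) \<omega> * w m e \<omega>)"
        by (intro Bochner_Integration.integrable_sum int) auto
      show "integrable M (\<lambda>\<omega>. \<epsilon> * indicator {\<omega>\<in>space M. N \<omega> = m} \<omega>)"
        by (intro integrable_mult_right integrable_real_indicator) (auto simp: emeasure_eq_measure)
      fix \<omega> assume \<omega>: "\<omega> \<in> space M"
      show "(\<Sum>e\<in>Pow (index_pairs m). indicator (H m e) \<omega> * w m e \<omega>) \<le>
          \<epsilon> * indicator {\<omega>\<in>space M. N \<omega> = m} \<omega>"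
      proof (cases "N \<omega> = m \<and> good m (X \<omega>)")
        case True
        have "(\<Sum>e\<in>Pow (index_pairs m). indicator (H m e) \<omega> * w m e \<omega>) =
            bernoulli_mean (pair_prob (X \<omega>)) (index_pairs m) (\<lambda>e. of_bool (bad m e (X \<omega>)))"
          unfolding bernoulli_mean_def w_def
          using \<omega> True by (intro sum.cong) (auto simp: H_def indicator_def)
        also have "\<dots> \<le> \<epsilon>"
          using True points.point_in[OF \<omega>] by (intro bound) auto
        finally show ?thesis using True \<omega> by simp
      next
        case False
        then have "indicator (H m e) \<omega> = (0::real)" for e by (auto simp: H_def indicator_def)
        then show ?thesis using \<epsilon> by simp
      qed
    qed
    also have "\<dots> = \<epsilon> * prob {\<omega>\<in>space M. N \<omega> = m}" by simp
    finally show ?thesis .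
  qed
  have "prob {\<omega>\<in>space M. good (N \<omega>) (X \<omega>) \<and> bad (N \<omega>) (ordered_shortcuts \<omega>) (X \<omega>)} \<le>
      prob (\<Union>m\<in>{..m0}. \<Union>e\<in>Pow (index_pairs m). A m e)"
  proof (rule finite_measure_mono)
    show "(\<Union>m\<in>{..m0}. \<Union>e\<in>Pow (index_pairs m). A m e) \<in> sets M"
      using AM by (intro sets.finite_UN) auto
    show "{\<omega>\<in>space M. good (N \<omega>) (X \<omega>) \<and> bad (N \<omega>) (ordered_shortcuts \<omega>) (X \<omega>)} \<subseteq>
        (\<Union>m\<in>{..m0}. \<Union>e\<in>Pow (index_pairs m). A m e)"
    proof
      fix \<omega> assume "\<omega> \<in> {\<omega>\<in>space M. good (N \<omega>) (X \<omega>) \<and> bad (N \<omega>) (ordered_shortcuts \<omega>) (X \<omega>)}"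
      then have \<omega>: "\<omega> \<in> space M" "good (N \<omega>) (X \<omega>)" "bad (N \<omega>) (ordered_shortcuts \<omega>) (X \<omega>)" by auto
      note sub = ordered_shortcuts_index_pairs[OF \<omega>(1)]
      have "\<omega> \<in> A (N \<omega>) (ordered_shortcuts \<omega>)"
        using \<omega> ordered_shortcuts_pattern[OF \<omega>(1) refl sub] by (simp add: A_def H_def)
      then show "\<omega> \<in> (\<Union>m\<in>{..m0}. \<Union>e\<in>Pow (index_pairs m). A m e)"
        using sub m0[OF \<omega>(2)] by blast
    qed
  qed
  also have "\<dots> \<le> (\<Sum>m\<le>m0. prob (\<Union>e\<in>Pow (index_pairs m). A m e))"
    using AM by (intro measure_UNION_le) auto
  also have "\<dots> \<le> (\<Sum>m\<le>m0. \<Sum>e\<in>Pow (index_pairs m). prob (A m e))"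
    using AM by (intro sum_mono measure_UNION_le) auto
  also have "\<dots> \<le> (\<Sum>m\<le>m0. \<epsilon> * prob {\<omega>\<in>space M. N \<omega> = m})"
    by (intro sum_mono level)
  also have "\<dots> = \<epsilon> * prob (\<Union>m\<in>{..m0}. {\<omega>\<in>space M. N \<omega> = m})"
    unfolding sum_distrib_left[symmetric]
    by (subst finite_measure_finite_Union) (auto simp: disjoint_family_on_def)
  also have "\<dots> \<le> \<epsilon>" using \<epsilon> prob_le_1 by (simp add: mult_left_le)
  finally show ?thesis .
qed

end


section \<open>The normalisation forces a lower bound on the shortcut intensity\<close>

text \<open>
  A distance \<open>r > R\<close> is compared with the dyadic scale \<open>k\<close> with \<open>2 ^ k * R < r \<le> 2 ^ Suc k * R\<close>.
\<close>
lemma shortcut_prob_dyadic: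
  assumes R: "0 < R" and a: "0 < a" and r: "r \<le> 2 ^ K * R"
  shows "shortcut_prob R a 2 r \<le> (\<Sum>k<K. a / (2 ^ k * R)\<^sup>2 * of_bool (r \<le> 2 ^ Suc k * R))"
proof (cases "R < r")
  case False
  then show ?thesis using R a by (auto simp: shortcut_prob_def intro!: sum_nonneg)
next
  case True
  define k where "k = (LEAST k. r \<le> 2 ^ Suc k * R)"
  have "K \<noteq> 0" using True r by (intro notI) simp
  then obtain K' where K': "K = Suc K'" by (cases K) auto
  have le: "r \<le> 2 ^ Suc k * R" unfolding k_def by (rule LeastI[of _ K']) (use r K' in auto)
  have kK: "k < K" unfolding k_def K' using r K' by (auto intro!: Least_le simp: less_Suc_eq_le)
  have lower: "2 ^ k * R < r"
  proof (cases k)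
    case (Suc k')
    then have "\<not> r \<le> 2 ^ Suc k' * R" using not_less_Least[of k' "\<lambda>k. r \<le> 2 ^ Suc k * R"] k_def by auto
    then show ?thesis using Suc by simp
  qed (use True in simp)
  have "shortcut_prob R a 2 r \<le> a * r powr - 2" using True by (simp add: shortcut_prob_def)
  also have "\<dots> = a / r\<^sup>2" using True R by (simp add: powr_minus powr_numeral divide_inverse)
  also have "\<dots> \<le> a / (2 ^ k * R)\<^sup>2 * of_bool (r \<le> 2 ^ Suc k * R)"
    using lower R a le by (auto intro!: divide_left_mono power_mono mult_pos_pos)
  also have "\<dots> \<le> (\<Sum>k<K. a / (2 ^ k * R)\<^sup>2 * of_bool (r \<le> 2 ^ Suc k * R))"
    using kK a by (intro member_le_sum) auto
  finally show ?thesis .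
qed

text \<open>
  Every dyadic scale contributes at most \<open>a / (2 ^ k * R)\<^sup>2\<close> times the area
  \<open>36 * (2 ^ Suc k * R)\<^sup>2\<close> of a ball, that is \<open>144 * a\<close>, independently of the scale.
\<close>
lemma shortcut_prob_integral_le:
  assumes R: "0 < R" and a: "0 < a" and x: "x \<in> square L" and L: "L \<le> 2 ^ K * R"
  shows "(\<integral>\<^sup>+y. ennreal (shortcut_prob R a 2 (torus_dist L x y)) * indicator (square L) y \<partial>lborel) \<le>
    ennreal (144 * a * real K)"
proof -
  define B where "B k = {y\<in>square L. torus_dist L x y \<le> 2 ^ Suc k * R}" for k
  have [measurable]: "B k \<in> sets borel" for k unfolding B_def by measurable
  have "(\<integral>\<^sup>+y. ennreal (shortcut_prob R a 2 (torus_dist L x y)) * indicator (square L) y \<partial>lborel) \<le>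
      (\<integral>\<^sup>+y. (\<Sum>k<K. ennreal (a / (2 ^ k * R)\<^sup>2) * indicator (B k) y) \<partial>lborel)"
  proof (rule nn_integral_mono)
    fix y
    show "ennreal (shortcut_prob R a 2 (torus_dist L x y)) * indicator (square L) y \<le>
        (\<Sum>k<K. ennreal (a / (2 ^ k * R)\<^sup>2) * indicator (B k) y)"
    proof (cases "y \<in> square L")
      case True
      then have "torus_dist L x y \<le> 2 ^ K * R" using torus_dist_le_side[OF x] L by fastforce
      from shortcut_prob_dyadic[OF R a this]
      have "ennreal (shortcut_prob R a 2 (torus_dist L x y)) \<le>
          ennreal (\<Sum>k<K. a / (2 ^ k * R)\<^sup>2 * of_bool (torus_dist L x y \<le> 2 ^ Suc k * R))"
        by (rule ennreal_leI)
      also have "\<dots> = (\<Sum>k<K. ennreal (a / (2 ^ k * R)\<^sup>2 * of_bool (torus_dist L x y \<le> 2 ^ Suc k * R)))"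
        using a by (intro sum_ennreal[symmetric]) auto
      also have "\<dots> = (\<Sum>k<K. ennreal (a / (2 ^ k * R)\<^sup>2) * indicator (B k) y)"
        using True by (intro sum.cong) (auto simp: B_def indicator_def)
      finally show ?thesis using True by simp
    qed simp
  qed
  also have "\<dots> = (\<Sum>k<K. ennreal (a / (2 ^ k * R)\<^sup>2) * emeasure lborel (B k))"
    by (subst nn_integral_sum) (auto intro!: sum.cong nn_integral_cmult_indicator)
  also have "\<dots> \<le> (\<Sum>k<K. ennreal (a / (2 ^ k * R)\<^sup>2) * ennreal (36 * (2 ^ Suc k * R)\<^sup>2))"
    unfolding B_def using x R by (intro sum_mono mult_left_mono emeasure_torus_ball_le) auto
  also have "\<dots> = (\<Sum>k<K. ennreal (144 * a))"
  proof (rule sum.cong[OF refl])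
    fix k
    have "a / (2 ^ k * R)\<^sup>2 * (36 * (2 ^ Suc k * R)\<^sup>2) = 144 * a"
      using R by (simp add: power_mult_distrib)
    then show "ennreal (a / (2 ^ k * R)\<^sup>2) * ennreal (36 * (2 ^ Suc k * R)\<^sup>2) = ennreal (144 * a)"
      using a by (simp add: ennreal_mult[symmetric])
  qed
  also have "\<dots> = ennreal (144 * a * real K)"
    using a by (subst sum_ennreal) (auto simp: mult.commute)
  finally show ?thesis .
qed

context poisson_small_world
begin

lemma pair_prob_swap: "pair_prob x (i, j) = pair_prob x (j, i)"
  by (simp add: pair_prob_def torus_dist_commute)

lemma emeasure_shortcut:
  "emeasure M {\<omega>\<in>space M. (i, j) \<in> E \<omega>} =
    (\<integral>\<^sup>+\<omega>. (if i < N \<omega> \<and> j < N \<omega> \<and> i \<noteq> j then ennreal (pair_prob (X \<omega>) (i, j)) else 0) \<partial>M)"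
proof -
  have up: "emeasure M {\<omega>\<in>space M. (i, j) \<in> E \<omega>} =
    (\<integral>\<^sup>+\<omega>. (if i < N \<omega> \<and> j < N \<omega> \<and> i \<noteq> j then ennreal (pair_prob (X \<omega>) (i, j)) else 0) \<partial>M)"
    if ij: "i < j" for i j
  proof -
    define H where "H = {\<omega>\<in>space M. j < N \<omega>}"
    have "{\<omega>\<in>space (position_algebra M N X). j < N \<omega>} \<in> sets (position_algebra M N X)" by measurable
    then have H: "H \<in> sets (position_algebra M N X)" by (simp add: H_def)
    have [measurable]: "H \<in> sets M" unfolding H_def by measurable
    have "prob (H \<inter> {\<omega>\<in>space M. {(i, j)} \<subseteq> E \<omega> \<and> {} \<inter> E \<omega> = {}}) =
        (\<integral>\<omega>. indicator H \<omega> * ((\<Prod>z\<in>{(i, j)}. pair_prob (X \<omega>) z) * (\<Prod>z\<in>{}. 1 - pair_prob (X \<omega>) z)) \<partial>M)"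
      using ij by (intro shortcuts_pattern[OF H]) (auto simp: H_def)
    also have "H \<inter> {\<omega>\<in>space M. {(i, j)} \<subseteq> E \<omega> \<and> {} \<inter> E \<omega> = {}} = {\<omega>\<in>space M. (i, j) \<in> E \<omega>}"
      using shortcuts_between_nodes by (auto simp: H_def)
    finally have "prob {\<omega>\<in>space M. (i, j) \<in> E \<omega>} = (\<integral>\<omega>. indicator H \<omega> * pair_prob (X \<omega>) (i, j) \<partial>M)"
      by simp
    moreover have "(\<integral>\<^sup>+\<omega>. ennreal (indicator H \<omega> * pair_prob (X \<omega>) (i, j)) \<partial>M) =
        ennreal (\<integral>\<omega>. indicator H \<omega> * pair_prob (X \<omega>) (i, j) \<partial>M)"
      using pair_prob_bounds
      by (intro nn_integral_eq_integral integrable_const_bound[where B = 1] AE_I2)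
        (auto simp: indicator_def)
    ultimately have "emeasure M {\<omega>\<in>space M. (i, j) \<in> E \<omega>} =
        (\<integral>\<^sup>+\<omega>. ennreal (indicator H \<omega> * pair_prob (X \<omega>) (i, j)) \<partial>M)"
      by (simp add: emeasure_eq_measure)
    also have "\<dots> = (\<integral>\<^sup>+\<omega>. (if i < N \<omega> \<and> j < N \<omega> \<and> i \<noteq> j then ennreal (pair_prob (X \<omega>) (i, j)) else 0) \<partial>M)"
      using ij by (intro nn_integral_cong) (auto simp: H_def indicator_def)
    finally show ?thesis .
  qed
  consider "i < j" | "j < i" | "i = j" by linarith
  then show ?thesis
  proof cases
    case 2
    have "{\<omega>\<in>space M. (i, j) \<in> E \<omega>} = {\<omega>\<in>space M. (j, i) \<in> E \<omega>}"
      using shortcuts_sym by (auto dest: symD)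
    also have "emeasure M {\<omega>\<in>space M. (j, i) \<in> E \<omega>} =
        (\<integral>\<^sup>+\<omega>. (if j < N \<omega> \<and> i < N \<omega> \<and> j \<noteq> i then ennreal (pair_prob (X \<omega>) (j, i)) else 0) \<partial>M)"
      by (rule up[OF 2])
    also have "\<dots> = (\<integral>\<^sup>+\<omega>. (if i < N \<omega> \<and> j < N \<omega> \<and> i \<noteq> j then ennreal (pair_prob (X \<omega>) (i, j)) else 0) \<partial>M)"
    proof (rule nn_integral_cong)
      fix \<omega>
      show "(if j < N \<omega> \<and> i < N \<omega> \<and> j \<noteq> i then ennreal (pair_prob (X \<omega>) (j, i)) else 0) =
          (if i < N \<omega> \<and> j < N \<omega> \<and> i \<noteq> j then ennreal (pair_prob (X \<omega>) (i, j)) else 0)"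
        using pair_prob_swap[of "X \<omega>" i j] by auto
    qed
    finally show ?thesis .
  next
    case 3
    have "{\<omega>\<in>space M. (i, j) \<in> E \<omega>} = {}"
      using shortcuts_irrefl 3 by (auto simp: irrefl_def)
    then have "emeasure M {\<omega>\<in>space M. (i, j) \<in> E \<omega>} = 0" by (simp only: emeasure_empty)
    then show ?thesis by (simp add: 3)
  qed (rule up)
qed

lemma mean_number_of_shortcuts:
  "(\<integral>\<^sup>+\<omega>. ennreal (real (card (E \<omega>))) \<partial>M) =
    (\<integral>\<^sup>+x. \<integral>\<^sup>+y. ennreal (shortcut_prob (local_radius c n) a \<alpha> (torus_dist (side n) x y)) *
       (indicator (square (side n)) x * indicator (square (side n)) y) \<partial>lborel \<partial>lborel)"
proof -
  let ?C = "count_space (UNIV :: (nat \<times> nat) set)"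
  interpret C: sigma_finite_measure ?C by (rule sigma_finite_measure_count_space)
  interpret MC: pair_sigma_finite M ?C ..
  have "Measurable.pred (M \<Otimes>\<^sub>M ?C) (\<lambda>z. p \<in> E (fst z))" for p by measurable
  then have D: "Measurable.pred (M \<Otimes>\<^sub>M ?C) (\<lambda>z. snd z \<in> E (fst z))"
    by (rule measurable_compose_countable[where g = snd]) simp
  have "(\<integral>\<^sup>+\<omega>. ennreal (real (card (E \<omega>))) \<partial>M) = (\<integral>\<^sup>+\<omega>. \<integral>\<^sup>+p. indicator {z. snd z \<in> E (fst z)} (\<omega>, p) \<partial>?C \<partial>M)"
  proof (rule nn_integral_cong)
    fix \<omega> assume "\<omega> \<in> space M"
    then have "finite (E \<omega>)"
      using shortcuts_between_nodes finite_subset[of "E \<omega>" "{..<N \<omega>} \<times> {..<N \<omega>}"] by auto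
    moreover have "(\<integral>\<^sup>+p. indicator {z. snd z \<in> E (fst z)} (\<omega>, p) \<partial>?C) = (\<integral>\<^sup>+p. indicator (E \<omega>) p \<partial>?C)"
      by (intro nn_integral_cong) (auto simp: indicator_def)
    ultimately show "ennreal (real (card (E \<omega>))) = (\<integral>\<^sup>+p. indicator {z. snd z \<in> E (fst z)} (\<omega>, p) \<partial>?C)"
      by (simp add: emeasure_count_space ennreal_of_nat_eq_real_of_nat)
  qed
  also have "\<dots> = (\<integral>\<^sup>+p. \<integral>\<^sup>+\<omega>. indicator {z. snd z \<in> E (fst z)} (\<omega>, p) \<partial>M \<partial>?C)"
    using D by (intro MC.Fubini'[symmetric]) simp
  also have "\<dots> = (\<integral>\<^sup>+p. (\<integral>\<^sup>+\<omega>. (case p of (i, j) \<Rightarrow> if i < N \<omega> \<and> j < N \<omega> \<and> i \<noteq> j then ennreal (pair_prob (X \<omega>) (i, j)) else 0) \<partial>M) \<partial>?C)"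
  proof (rule nn_integral_cong)
    fix p :: "nat \<times> nat"
    obtain i j where p: "p = (i, j)" by (cases p)
    have "(\<integral>\<^sup>+\<omega>. indicator {z. snd z \<in> E (fst z)} (\<omega>, p) \<partial>M) = (\<integral>\<^sup>+\<omega>. indicator {\<omega>\<in>space M. (i, j) \<in> E \<omega>} \<omega> \<partial>M)"
      by (intro nn_integral_cong) (auto simp: p indicator_def)
    then show "(\<integral>\<^sup>+\<omega>. indicator {z. snd z \<in> E (fst z)} (\<omega>, p) \<partial>M) =
        (\<integral>\<^sup>+\<omega>. (case p of (i, j) \<Rightarrow> if i < N \<omega> \<and> j < N \<omega> \<and> i \<noteq> j then ennreal (pair_prob (X \<omega>) (i, j)) else 0) \<partial>M)"
      by (simp add: p emeasure_shortcut)
  qed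
  also have "\<dots> = (\<integral>\<^sup>+\<omega>. (\<integral>\<^sup>+(i, j). (if i < N \<omega> \<and> j < N \<omega> \<and> i \<noteq> j then ennreal (pair_prob (X \<omega>) (i, j)) else 0) \<partial>?C) \<partial>M)"
  proof (rule MC.Fubini')
    have "(\<lambda>z. case p of (i, j) \<Rightarrow> if i < N (fst z) \<and> j < N (fst z) \<and> i \<noteq> j
          then ennreal (pair_prob (X (fst z)) (i, j)) else 0) \<in> borel_measurable (M \<Otimes>\<^sub>M ?C)" for p
      by (cases p) (simp, measurable)
    then have "(\<lambda>z. (\<lambda>p z. case p of (i, j) \<Rightarrow> if i < N (fst z) \<and> j < N (fst z) \<and> i \<noteq> j
          then ennreal (pair_prob (X (fst z)) (i, j)) else 0) (snd z) z) \<in> borel_measurable (M \<Otimes>\<^sub>M ?C)"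
      by (rule measurable_compose_countable[where g = snd]) simp
    then show "(\<lambda>(\<omega>, p). case p of (i, j) \<Rightarrow> if i < N \<omega> \<and> j < N \<omega> \<and> i \<noteq> j
          then ennreal (pair_prob (X \<omega>) (i, j)) else 0) \<in> borel_measurable (M \<Otimes>\<^sub>M ?C)"
      by (simp add: split_beta')
  qed
  also have "\<dots> = (\<integral>\<^sup>+x. \<integral>\<^sup>+y. ennreal (shortcut_prob (local_radius c n) a \<alpha> (torus_dist (side n) x y)) *
       (indicator (square (side n)) x * indicator (square (side n)) y) \<partial>lborel \<partial>lborel)"
  proof -
    have "(\<lambda>z. ennreal (shortcut_prob (local_radius c n) a \<alpha> (torus_dist (side n) (fst z) (snd z)))) \<in>
        borel_measurable (borel \<Otimes>\<^sub>M borel)"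
      unfolding shortcut_prob_def by measurable
    from points.second_factorial_moment[OF this] show ?thesis
      unfolding pair_prob_def split_beta' fst_conv snd_conv .
  qed
  finally show ?thesis .
qed

lemma mean_number_of_nodes: "(\<integral>\<^sup>+\<omega>. ennreal (real (N \<omega>)) \<partial>M) = ennreal (real n)"
proof -
  have "(\<integral>\<^sup>+\<omega>. ennreal (real (N \<omega>)) \<partial>M) =
      (\<integral>\<^sup>+\<omega>. ennreal (real (point_count N X (square (side n)) \<omega>)) \<partial>M)"
  proof (rule nn_integral_cong)
    fix \<omega> assume "\<omega> \<in> space M"
    then have "{i. i < N \<omega> \<and> X \<omega> i \<in> square (side n)} = {..<N \<omega>}"
      using points.point_in by auto
    then show "ennreal (real (N \<omega>)) = ennreal (real (point_count N X (square (side n)) \<omega>))"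
      by (simp add: point_count_def)
  qed
  also have "\<dots> = ennreal (real n)"
    by (subst points.point_count_mean) (auto simp: emeasure_square side_def)
  finally show ?thesis .
qed

text \<open>
  The mean number of shortcuts equals the mean number \<open>n\<close> of nodes and is at most \<open>n\<close> times the bound of
  \<open>shortcut_prob_integral_le\<close>. Here \<open>K\<close> is the number of dyadic scales, so \<open>a\<close> is at least of order
  \<open>1 / ln n\<close>.
\<close>
lemma shortcut_intensity_lower_bound:
  assumes "\<alpha> = 2" "d = 1" "0 < n" and R: "0 < local_radius c n" and K: "side n \<le> 2 ^ K * local_radius c n"
  shows "1 \<le> 144 * a * real K"
proof -
  let ?R = "local_radius c n" and ?Q = "square (side n)"
  have EN: "expectation (\<lambda>\<omega>. real (N \<omega>)) = real n"
    by (subst integral_eq_nn_integral) (auto simp: mean_number_of_nodes)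
  have EE: "expectation (\<lambda>\<omega>. real (card (E \<omega>))) = real n"
    using mean_shortcuts_per_node EN assms by (simp add: divide_eq_1_iff)
  then have "integrable M (\<lambda>\<omega>. real (card (E \<omega>)))"
    using not_integrable_integral_eq assms(3) by fastforce
  then have "ennreal (real n) = (\<integral>\<^sup>+\<omega>. ennreal (real (card (E \<omega>))) \<partial>M)"
    by (subst nn_integral_eq_integral) (auto simp: EE)
  also have "\<dots> = (\<integral>\<^sup>+x. (\<integral>\<^sup>+y. ennreal (shortcut_prob ?R a 2 (torus_dist (side n) x y)) * indicator ?Q y \<partial>lborel) *
      indicator ?Q x \<partial>lborel)"
    unfolding mean_number_of_shortcuts assms(1)
    by (intro nn_integral_cong) (auto simp: indicator_def)
  also have "\<dots> \<le> (\<integral>\<^sup>+x. ennreal (144 * a * real K) * indicator ?Q x \<partial>lborel)"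
  proof (rule nn_integral_mono)
    fix x
    show "(\<integral>\<^sup>+y. ennreal (shortcut_prob ?R a 2 (torus_dist (side n) x y)) * indicator ?Q y \<partial>lborel) * indicator ?Q x \<le>
        ennreal (144 * a * real K) * indicator ?Q x"
      using shortcut_prob_integral_le[OF R a_pos _ K, of x] by (cases "x \<in> ?Q") auto
  qed
  also have "\<dots> = ennreal (144 * a * real K) * ennreal (real n)"
    by (subst nn_integral_cmult_indicator) (auto simp: emeasure_square side_def)
  also have "\<dots> = ennreal (144 * a * real K * real n)"
    using a_pos by (subst ennreal_mult) auto
  finally have "real n \<le> 144 * a * real K * real n"
    using a_pos by (simp add: ennreal_le_iff)
  then show ?thesis using assms(3) by simp
qed

end


section \<open>Regular positions are favourable for routing\<close>

text \<open>
  The regularity of the positions on which the routing bound rests: not too many nodes, greedy progress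
  between nodes, few nodes near each node, and no sparse box of area at least \<open>\<Lambda>\<close>. Boxes with integer
  corners are used because there are only polynomially many of them; every square of side at
  least 4 contains one with sides at least half as long.
\<close>
definition good_positions ::
  "real \<Rightarrow> real \<Rightarrow> real \<Rightarrow> real \<Rightarrow> nat \<Rightarrow> nat \<Rightarrow> nat \<Rightarrow> (nat \<Rightarrow> point) \<Rightarrow> bool" where
  "good_positions L R r1 \<Lambda> m0 B m x \<longleftrightarrow>
     m \<le> m0 \<and>
     (\<forall>i<m. \<forall>j<m. R \<le> torus_dist L (x i) (x j) \<longrightarrow>
        (\<exists>k<m. torus_dist L (x k) (x j) < torus_dist L (x i) (x j) \<and> torus_dist L (x i) (x k) < R)) \<and>
     (\<forall>j<m. card {i. i < m \<and> torus_dist L (x i) (x j) \<le> r1} \<le> B) \<and>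
     (\<forall>i i' j j' :: nat. i \<le> i' \<and> j \<le> j' \<and> real i' \<le> L \<and> real j' \<le> L \<and>
        \<Lambda> \<le> (real i' - real i) * (real j' - real j) \<longrightarrow>
        (real i' - real i) * (real j' - real j) / 4 \<le>
          real (card {k. k < m \<and> x k \<in> {real i..real i'} \<times> {real j..real j'}}))"

lemma good_positions_measurable:
  "Measurable.pred (PiM UNIV (\<lambda>_. borel)) (good_positions L R r1 \<Lambda> m0 B m)"
proof -
  have [measurable]: "{real i..real i'} \<times> {real j..real j'} \<in> sets (borel :: point measure)" for i i' j j'
    by (intro borel_closed closed_Times) auto
  show ?thesis
    unfolding good_positions_def by measurable
qed

lemma good_positions_box_count:
  assumes good: "good_positions L R r1 \<Lambda> m0 B m x"
    and w: "4 \<le> w" "\<Lambda> \<le> (w / 2)\<^sup>2"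
    and u: "0 \<le> u1" "0 \<le> u2" "u1 + w \<le> L" "u2 + w \<le> L"
  shows "w\<^sup>2 / 16 \<le> real (card {k. k < m \<and> x k \<in> {u1..u1 + w} \<times> {u2..u2 + w}})"
proof -
  \<comment> \<open>Rounding inwards shortens each side by at most 2, hence by at most half of it.\<close>
  define i i' j j' where "i = nat \<lceil>u1\<rceil>" and "i' = nat \<lfloor>u1 + w\<rfloor>" and "j = nat \<lceil>u2\<rceil>" and "j' = nat \<lfloor>u2 + w\<rfloor>"
  have ii: "u1 \<le> real i" "real i \<le> u1 + 1" "real i' \<le> u1 + w" "u1 + w - 1 \<le> real i'"
    and jj: "u2 \<le> real j" "real j \<le> u2 + 1" "real j' \<le> u2 + w" "u2 + w - 1 \<le> real j'"
    unfolding i_def i'_def j_def j'_def using u w by linarith+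
  have wi: "w / 2 \<le> real i' - real i" and wj: "w / 2 \<le> real j' - real j"
    using ii jj w by linarith+
  then have area: "(w / 2)\<^sup>2 \<le> (real i' - real i) * (real j' - real j)"
    unfolding power2_eq_square using w by (intro mult_mono) auto
  have "real i \<le> real i'" "real j \<le> real j'" using wi wj w by linarith+
  then have "(real i' - real i) * (real j' - real j) / 4 \<le>
      real (card {k. k < m \<and> x k \<in> {real i..real i'} \<times> {real j..real j'}})"
    using good area w u ii jj unfolding good_positions_def by auto
  also have "\<dots> \<le> real (card {k. k < m \<and> x k \<in> {u1..u1 + w} \<times> {u2..u2 + w}})"
    using ii jj by (intro of_nat_mono card_mono) (auto simp: mem_Times_iff)
  finally show ?thesis using area by (simp add: power2_eq_square)
qed

lemma shortcut_prob_lower: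
  assumes "R < s" "s \<le> 3 / 2 * r" "0 < R" "0 < a"
  shows "min (4 / 9 * a / r\<^sup>2) 1 \<le> shortcut_prob R a 2 s"
proof -
  have s: "0 < s" using assms by linarith
  have "4 / 9 * a / r\<^sup>2 = a / (3 / 2 * r)\<^sup>2" by (simp add: power2_eq_square)
  also have "\<dots> \<le> a / s\<^sup>2"
    using assms s by (intro divide_left_mono power_mono mult_pos_pos) auto
  also have "\<dots> = a * s powr - 2" using s by (simp add: powr_minus powr_numeral divide_inverse)
  finally show ?thesis using assms by (auto simp: shortcut_prob_def)
qed

text \<open>
  The box of \<open>annulus_contains_box\<close> has side \<open>r / 8\<close>, hence contains at least \<open>r\<^sup>2 / 1024\<close> nodes. Each of
  them is at distance more than \<open>r / 25 \<ge> R\<close> and at most \<open>3 / 2 * r\<close> from the current node, so it is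
  joined to it with probability at least \<open>min (4 / 9 * a / r\<^sup>2) 1\<close>; the two powers of \<open>r\<close> cancel.
\<close>
lemma good_positions_shortcut:
  fixes a :: real
  assumes good: "good_positions L R r1 \<Lambda> m0 B m x"
    and sq: "\<And>i. i < m \<Longrightarrow> x i \<in> square L"
    and R: "0 < R" "25 * R \<le> r1" and r1: "32 \<le> r1" "\<Lambda> \<le> (r1 / 16)\<^sup>2"
    and a: "0 < a" and b: "0 \<le> b" "b \<le> 1" "b \<le> 4 / 9 * a"
    and i: "i < m" and t: "t \<in> square L"
    and r: "r1 \<le> r" "r \<le> L" "r / 2 < torus_dist L (x i) t" "torus_dist L (x i) t \<le> r"
  defines "p \<equiv> \<lambda>(i, j). shortcut_prob R a 2 (torus_dist L (x i) (x j))"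
  shows "\<exists>Q\<subseteq>index_pairs m.
      (\<forall>(j, k)\<in>Q. (x j = x i \<and> x k \<in> annulus L t r) \<or> (x k = x i \<and> x j \<in> annulus L t r)) \<and>
      (\<Prod>e\<in>Q. 1 - p e) \<le> exp (- b / 1024)"
proof -
  have rpos: "0 < r" using r1 r by linarith
  obtain u1 u2 where u: "0 \<le> u1" "0 \<le> u2" "u1 + r / 8 \<le> L" "u2 + r / 8 \<le> L"
    and box: "\<And>y. y \<in> {u1..u1 + r / 8} \<times> {u2..u2 + r / 8} \<Longrightarrow>
       r / 4 < torus_dist L t y \<and> torus_dist L t y \<le> 23 / 50 * r"
    using annulus_contains_box[OF t rpos r(2)] by metis
  define K where "K = {k. k < m \<and> x k \<in> {u1..u1 + r / 8} \<times> {u2..u2 + r / 8}}"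
  have finK: "finite K" unfolding K_def by simp
  have "\<Lambda> \<le> (r / 8 / 2)\<^sup>2"
    by (rule order.trans[OF r1(2)]) (use r r1 in \<open>auto intro!: power_mono\<close>)
  then have cardK: "r\<^sup>2 / 1024 \<le> real (card K)"
    using good_positions_box_count[OF good _ _ u] r r1
    by (simp add: K_def power2_eq_square)
  have K: "k < m" "x k \<in> annulus L t r" "R < torus_dist L (x i) (x k)"
      "torus_dist L (x i) (x k) \<le> 3 / 2 * r" "k \<noteq> i" if "k \<in> K" for k
  proof -
    show km: "k < m" using that by (simp add: K_def)
    have d: "r / 4 < torus_dist L t (x k)" "torus_dist L t (x k) \<le> 23 / 50 * r"
      using box[of "x k"] that by (auto simp: K_def)
    show "x k \<in> annulus L t r" using d rpos by (simp add: annulus_def)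
    have "torus_dist L (x i) t \<le> torus_dist L (x i) (x k) + torus_dist L (x k) t"
      "torus_dist L (x i) (x k) \<le> torus_dist L (x i) t + torus_dist L t (x k)"
      by (intro torus_dist_triangle sq i km t)+
    then show "R < torus_dist L (x i) (x k)" "torus_dist L (x i) (x k) \<le> 3 / 2 * r"
      using d r R rpos torus_dist_commute[of L "x k" t] by linarith+
    show "k \<noteq> i" using d r rpos torus_dist_commute[of L "x k" t] by auto
  qed
  define pr where "pr k = (min i k, max i k)" for k
  have inj: "inj_on pr K"
    by (auto simp: inj_on_def pr_def min_def max_def split: if_splits)
  have ppr: "p (pr k) = shortcut_prob R a 2 (torus_dist L (x i) (x k))" for k
    by (auto simp: p_def pr_def min_def max_def torus_dist_commute)
  define q where "q = min (4 / 9 * a / r\<^sup>2) 1"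
  have q: "0 \<le> q" "q \<le> 1" using a by (auto simp: q_def)
  have plo: "q \<le> p (pr k)" if "k \<in> K" for k
    unfolding ppr q_def using K[OF that] R a by (intro shortcut_prob_lower) auto
  have phi: "p (pr k) \<le> 1" for k
    unfolding ppr shortcut_prob_def by auto
  have "(\<Prod>e\<in>pr ` K. 1 - p e) = (\<Prod>k\<in>K. 1 - p (pr k))"
    by (simp add: prod.reindex[OF inj])
  also have "\<dots> \<le> (\<Prod>k\<in>K. exp (- q))"
  proof (rule prod_mono)
    fix k assume k: "k \<in> K"
    have "1 - p (pr k) \<le> 1 + (- q)" using plo[OF k] by simp
    also have "\<dots> \<le> exp (- q)" by (rule exp_ge_add_one_self)
    finally show "0 \<le> 1 - p (pr k) \<and> 1 - p (pr k) \<le> exp (- q)" using phi by simp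
  qed
  also have "\<dots> = exp (- (q * real (card K)))"
    by (simp add: exp_of_nat_mult[symmetric])
  also have "\<dots> \<le> exp (- b / 1024)"
  proof -
    have "b \<le> q * r\<^sup>2"
    proof (cases "4 / 9 * a / r\<^sup>2 \<le> 1")
      case True
      then show ?thesis using b rpos by (simp add: q_def)
    next
      case False
      have "1 \<le> r\<^sup>2" using r r1 by (intro one_le_power) linarith
      then show ?thesis using False b by (simp add: q_def)
    qed
    also have "\<dots> \<le> q * (1024 * real (card K))"
      using cardK q by (intro mult_left_mono) auto
    finally show ?thesis by simp
  qed
  finally have prod: "(\<Prod>e\<in>pr ` K. 1 - p e) \<le> exp (- b / 1024)" .
  have "pr k \<in> index_pairs m" if "k \<in> K" for k
    using K[OF that] i by (auto simp: pr_def index_pairs_def min_def max_def)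
  moreover have "case pr k of (j, k) \<Rightarrow> (x j = x i \<and> x k \<in> annulus L t r) \<or> (x k = x i \<and> x j \<in> annulus L t r)"
    if "k \<in> K" for k
    using K(2)[OF that] by (auto simp: pr_def min_def max_def)
  ultimately show ?thesis using prod by (intro exI[of _ "pr ` K"]) auto
qed

text \<open>
  The exploration starts at the source with radius equal to its distance from the destination; the edges
  between farther nodes are fixed beforehand.
\<close>
lemma good_positions_delivery:
  fixes a :: real
  assumes good: "good_positions L R r1 \<Lambda> m0 B m x"
    and sq: "\<And>i. i < m \<Longrightarrow> x i \<in> square L"
    and R: "0 < R" "25 * R \<le> r1" "r1 \<le> 2 ^ J * R" and r1: "32 \<le> r1" "\<Lambda> \<le> (r1 / 16)\<^sup>2"
    and a: "0 < a" and b: "0 \<le> b" "b \<le> 1" "b \<le> 4 / 9 * a"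
    and \<rho>: "routing_rule L \<rho>" and L: "0 \<le> L" "L < 2 ^ j * r1"
    and ij: "i < m" "i' < m" "x i \<noteq> x i'"
    and T2: "T2 = 1 + J * (B + 1) + B"
  defines "p \<equiv> \<lambda>(i, j). shortcut_prob R a 2 (torus_dist L (x i) (x j))"
  shows "bernoulli_mean p (index_pairs m)
      (\<lambda>e. of_bool (\<not> (\<exists>k\<le>T + T2. delivers L R (x ` {..<m}) (links x e) \<rho> (x i) (x i') k)))
    \<le> 2 ^ j * ((1 + exp (- b / 1024)) / 2) ^ T"
proof -
  interpret torus_routing L R m x \<rho> "x i'"
  proof
    show "\<exists>u\<in>x ` {..<m}. torus_dist L u (x i') < torus_dist L v (x i') \<and> torus_dist L v u < R"
      if v: "v \<in> x ` {..<m}" "R \<le> torus_dist L v (x i')" for v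
    proof -
      obtain l where "l < m" "v = x l" using v(1) by auto
      then obtain k where "k < m" "torus_dist L (x k) (x i') < torus_dist L v (x i')" "torus_dist L v (x k) < R"
        using good ij v(2) unfolding good_positions_def by meson
      then show ?thesis by auto
    qed
  qed (use L R sq \<rho> ij in auto)
  have p01: "0 \<le> p z \<and> p z \<le> 1" for z
    using a by (cases z) (auto simp: p_def shortcut_prob_def)
  let ?r = "torus_dist L (x i) (x i')"
  let ?q = "exp (- b / 1024)"
  define A where "A = index_pairs m - inner_pairs ?r"
  have sub: "inner_pairs ?r \<subseteq> index_pairs m" by (auto simp: inner_pairs_def index_pairs_def)
  have split: "index_pairs m = A \<union> inner_pairs ?r" using sub by (auto simp: A_def)
  have finA: "finite A" by (simp add: A_def)
  have cardB: "card {u\<in>x ` {..<m}. torus_dist L u (x i') \<le> r1} \<le> B"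
  proof -
    have "card (x ` {i. i < m \<and> torus_dist L (x i) (x i') \<le> r1}) \<le> B"
      using good ij unfolding good_positions_def by (intro order.trans[OF card_image_le]) auto
    moreover have "{u\<in>x ` {..<m}. torus_dist L u (x i') \<le> r1} = x ` {i. i < m \<and> torus_dist L (x i) (x i') \<le> r1}"
      by auto
    ultimately show ?thesis by simp
  qed
  have success: "\<exists>Q\<subseteq>index_pairs m.
      (\<forall>(j, k)\<in>Q. (x j = v \<and> x k \<in> annulus L (x i') r) \<or> (x k = v \<and> x j \<in> annulus L (x i') r)) \<and>
      (\<Prod>e\<in>Q. 1 - p e) \<le> ?q"
    if v: "v \<in> x ` {..<m}" and r: "r1 \<le> r" "r \<le> L" "r / 2 < torus_dist L v (x i')" "torus_dist L v (x i') \<le> r" for v r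
  proof -
    obtain l where l: "l < m" "v = x l" using v by auto
    show ?thesis
      unfolding p_def l(2)
      by (rule good_positions_shortcut[OF good sq R(1,2) r1 a b l(1) sq[OF ij(2)]]) (use r l in auto)
  qed
  have rL: "?r \<le> L" using ij sq by (intro torus_dist_le_side) auto
  have start: "bernoulli_mean p (inner_pairs ?r)
      (\<lambda>e. of_bool (\<not> (\<exists>k\<le>T + T2. reaches (links x (out \<union> e)) (x i) ?r k))) \<le> 2 ^ j * ((1 + ?q) / 2) ^ T"
    if out: "out \<subseteq> A" for out
  proof (rule exploration[where ?r1.0 = r1 and B = B and J = J])
    show "?r / 2 < torus_dist L (x i) (x i')" if "r1 \<le> ?r" using that r1 by auto
    show "?r < 2 ^ j * r1" using rL L by linarith
    show "out \<subseteq> index_pairs m" using out by (auto simp: A_def)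
    show "4 * R \<le> r1" using R by linarith
  qed (use p01 R cardB T2 ij rL success in auto)
  have "bernoulli_mean p (index_pairs m)
      (\<lambda>e. of_bool (\<not> (\<exists>k\<le>T + T2. delivers L R (x ` {..<m}) (links x e) \<rho> (x i) (x i') k))) \<le>
    bernoulli_mean p (index_pairs m) (\<lambda>e. of_bool (\<not> (\<exists>k\<le>T + T2. reaches (links x e) (x i) ?r k)))"
  proof (rule bernoulli_mean_mono)
    fix e
    have "\<exists>k\<le>T + T2. delivers L R (x ` {..<m}) (links x e) \<rho> (x i) (x i') k"
      if "\<exists>k\<le>T + T2. reaches (links x e) (x i) ?r k"
      using that T2 unfolding delivers_def
      by (cases "x i' \<in> near (x i) \<union> shortcut_contacts (links x e) (x i)") auto
    then show "of_bool (\<not> (\<exists>k\<le>T + T2. delivers L R (x ` {..<m}) (links x e) \<rho> (x i) (x i') k)) \<le>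
        (of_bool (\<not> (\<exists>k\<le>T + T2. reaches (links x e) (x i) ?r k)) :: real)"
      by (auto simp: of_bool_def)
  qed (use p01 in auto)
  also have "\<dots> = bernoulli_mean p A (\<lambda>out. bernoulli_mean p (inner_pairs ?r)
      (\<lambda>e. of_bool (\<not> (\<exists>k\<le>T + T2. reaches (links x (out \<union> e)) (x i) ?r k))))"
    unfolding split by (rule bernoulli_mean_Un) (auto simp: A_def finA)
  also have "\<dots> \<le> bernoulli_mean p A (\<lambda>_. 2 ^ j * ((1 + ?q) / 2) ^ T)"
    using start p01 by (intro bernoulli_mean_mono) auto
  also have "\<dots> = 2 ^ j * ((1 + ?q) / 2) ^ T"
    by (rule bernoulli_mean_const[OF finA])
  finally show ?thesis .
qed


section \<open>Regular positions are likely\<close>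

lemma progress_imp_node_progress:
  assumes prog: "progress_everywhere L R (x ` {..<m})"
    and sq: "\<And>i. i < m \<Longrightarrow> x i \<in> square L"
    and generic: "\<And>i j. i < m \<Longrightarrow> j < m \<Longrightarrow> i \<noteq> j \<Longrightarrow> torus_dist L (x i) (x j) \<noteq> R"
    and ij: "i < m" "j < m" "R \<le> torus_dist L (x i) (x j)"
  shows "\<exists>k<m. torus_dist L (x k) (x j) < torus_dist L (x i) (x j) \<and> torus_dist L (x i) (x k) < R"
proof -
  obtain k where k: "k < m" "torus_dist L (x k) (x j) < torus_dist L (x i) (x j)" "torus_dist L (x k) (x i) \<le> R"
    using prog sq[OF ij(1)] sq[OF ij(2)] ij(3) unfolding progress_everywhere_def by blast
  have "k \<noteq> i" using k(2) by auto
  then have "torus_dist L (x i) (x k) < R"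
    using generic[OF ij(1) k(1)] k(3) torus_dist_commute[of L "x k" "x i"] by force
  then show ?thesis using k by blast
qed

lemma grid_point_near:
  assumes y: "y \<in> square L" and s: "2 \<le> s"
  obtains i j where "i \<le> nat \<lfloor>L\<rfloor>" "j \<le> nat \<lfloor>L\<rfloor>" "(real i, real j) \<in> square L" "torus_dist L (real i, real j) y \<le> s"
proof -
  obtain a b where ab: "y = (a, b)" "0 \<le> a" "a \<le> L" "0 \<le> b" "b \<le> L"
    using y by (cases y) (auto simp: square_def)
  define i j where "i = nat \<lfloor>a\<rfloor>" and "j = nat \<lfloor>b\<rfloor>"
  have i: "real i \<le> a" "a \<le> real i + 1" and j: "real j \<le> b" "b \<le> real j + 1"
    using ab by (auto simp: i_def j_def)
  have ij: "i \<le> nat \<lfloor>L\<rfloor>" "j \<le> nat \<lfloor>L\<rfloor>" using ab by (auto simp: i_def j_def intro!: nat_mono floor_mono)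
  have sq: "(real i, real j) \<in> square L" using i j ab by (auto simp: square_def)
  have c: "0 \<le> circle_dist L (real i) a" "circle_dist L (real i) a \<le> 1"
    "0 \<le> circle_dist L (real j) b" "circle_dist L (real j) b \<le> 1"
    using i j ab by (auto simp: circle_dist_def min_def abs_if)
  then have "(circle_dist L (real i) a)\<^sup>2 + (circle_dist L (real j) b)\<^sup>2 \<le> 1\<^sup>2 + 1\<^sup>2"
    by (intro add_mono power_mono) auto
  also have "\<dots> \<le> s\<^sup>2" using power_mono[OF s, of 2] by simp
  finally have "torus_dist L (real i, real j) y \<le> s"
    unfolding torus_dist_def ab using s by (intro real_le_lsqrt) auto
  then show thesis using that ij sq by blast
qed

context poisson_small_world
begin

text \<open>
  The mean number of such pairs is the Lebesgue measure of a union of null spheres.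
\<close>
lemma AE_no_pair_at_distance:
  "AE \<omega> in M. \<forall>i j. i < N \<omega> \<longrightarrow> j < N \<omega> \<longrightarrow> i \<noteq> j \<longrightarrow> torus_dist (side n) (X \<omega> i) (X \<omega> j) \<noteq> s"
proof -
  let ?L = "side n"
  have "AE \<omega> in M. i < N \<omega> \<longrightarrow> j < N \<omega> \<longrightarrow> i \<noteq> j \<longrightarrow> torus_dist ?L (X \<omega> i) (X \<omega> j) \<noteq> s" for i j
  proof -
    let ?f = "\<lambda>z. indicator {z. torus_dist ?L (fst z) (snd z) = s} z :: ennreal"
    have f: "?f \<in> borel_measurable (borel \<Otimes>\<^sub>M borel)" by measurable
    have "(\<integral>\<^sup>+\<omega>. (\<integral>\<^sup>+(i, j). (if i < N \<omega> \<and> j < N \<omega> \<and> i \<noteq> j then ?f (X \<omega> i, X \<omega> j) else 0) \<partial>count_space UNIV) \<partial>M) =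
      (\<integral>\<^sup>+x. \<integral>\<^sup>+y. ?f (x, y) * (indicator (square ?L) x * indicator (square ?L) y) \<partial>lborel \<partial>lborel)"
      by (rule points.second_factorial_moment[OF f])
    also have "\<dots> \<le> (\<integral>\<^sup>+x. \<integral>\<^sup>+y. indicator {y. torus_dist ?L x y = s} y \<partial>lborel \<partial>lborel)"
      by (intro nn_integral_mono) (auto simp: indicator_def)
    also have "\<dots> = (\<integral>\<^sup>+x. 0 \<partial>(lborel :: point measure))"
    proof (rule nn_integral_cong)
      fix x
      have "{y. torus_dist ?L x y = s} \<in> sets lborel" by measurable
      then show "(\<integral>\<^sup>+y. indicator {y. torus_dist ?L x y = s} y \<partial>lborel) = 0"
        by (simp add: torus_sphere_null)
    qed
    finally have zero: "(\<integral>\<^sup>+\<omega>. (\<integral>\<^sup>+(i, j). (if i < N \<omega> \<and> j < N \<omega> \<and> i \<noteq> j then ?f (X \<omega> i, X \<omega> j) else 0) \<partial>count_space UNIV) \<partial>M) = 0"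
      by simp
    have "(\<integral>\<^sup>+\<omega>. (if i < N \<omega> \<and> j < N \<omega> \<and> i \<noteq> j then ?f (X \<omega> i, X \<omega> j) else 0) \<partial>M) \<le>
      (\<integral>\<^sup>+\<omega>. (\<integral>\<^sup>+(i, j). (if i < N \<omega> \<and> j < N \<omega> \<and> i \<noteq> j then ?f (X \<omega> i, X \<omega> j) else 0) \<partial>count_space UNIV) \<partial>M)"
    proof (rule nn_integral_mono)
      fix \<omega>
      let ?g = "\<lambda>p. case p of (i, j) \<Rightarrow> (if i < N \<omega> \<and> j < N \<omega> \<and> i \<noteq> j then ?f (X \<omega> i, X \<omega> j) else 0)"
      show "(if i < N \<omega> \<and> j < N \<omega> \<and> i \<noteq> j then ?f (X \<omega> i, X \<omega> j) else 0) \<le> (\<integral>\<^sup>+p. ?g p \<partial>count_space UNIV)"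
        using nn_integral_ge_point[of "(i, j)" UNIV ?g] by simp
    qed
    then have "(\<integral>\<^sup>+\<omega>. (if i < N \<omega> \<and> j < N \<omega> \<and> i \<noteq> j then ?f (X \<omega> i, X \<omega> j) else 0) \<partial>M) = 0"
      using zero by simp
    moreover have "(\<lambda>\<omega>. if i < N \<omega> \<and> j < N \<omega> \<and> i \<noteq> j then ?f (X \<omega> i, X \<omega> j) else 0) \<in> borel_measurable M"
      by measurable
    ultimately have "AE \<omega> in M. (if i < N \<omega> \<and> j < N \<omega> \<and> i \<noteq> j then ?f (X \<omega> i, X \<omega> j) else 0) = 0"
      by (simp add: nn_integral_0_iff_AE)
    then show ?thesis by eventually_elim (auto split: if_splits)
  qed
  then show ?thesis unfolding AE_all_countable by (intro allI)
qed

lemma prob_many_nodes: "prob {\<omega>\<in>space M. 3 * n < N \<omega>} \<le> exp (- real n)"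
proof -
  let ?Q = "square (side n)"
  have "prob {\<omega>\<in>space M. 3 * n < N \<omega>} \<le> prob {\<omega>\<in>space M. 3 * real n \<le> real (point_count N X ?Q \<omega>)}"
  proof (rule finite_measure_mono)
    show "{\<omega>\<in>space M. 3 * n < N \<omega>} \<subseteq> {\<omega>\<in>space M. 3 * real n \<le> real (point_count N X ?Q \<omega>)}"
    proof safe
      fix \<omega> assume \<omega>: "\<omega> \<in> space M" "3 * n < N \<omega>"
      have "{i. i < N \<omega> \<and> X \<omega> i \<in> ?Q} = {..<N \<omega>}" using points.point_in[OF \<omega>(1)] by auto
      then show "3 * real n \<le> real (point_count N X ?Q \<omega>)" using \<omega>(2) by (simp add: point_count_def)
    qed
  qed measurable
  also have "\<dots> \<le> exp (2 * real n - 3 * real n)"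
    by (rule points.point_count_upper_tail) (auto simp: measure_def emeasure_square side_def)
  finally show ?thesis by simp
qed

lemma grid_size:
  assumes "0 < n"
  shows "real (nat \<lfloor>side n\<rfloor> + 1) \<le> 2 * sqrt (real n)"
proof -
  have "1 \<le> sqrt (real n)" using assms by (intro real_sqrt_ge_one) simp
  moreover have "real (nat \<lfloor>sqrt (real n)\<rfloor>) \<le> sqrt (real n)" by simp
  ultimately show ?thesis unfolding side_def of_nat_add of_nat_1 by linarith
qed

text \<open>
  Every node is within \<open>r1\<close> of a grid point, so its ball of radius \<open>r1\<close> lies in the ball of radius
  \<open>2 * r1\<close> around that grid point, whose area is at most \<open>36 * (2 * r1)\<^sup>2 = 144 * r1\<^sup>2\<close>.
\<close>
lemma prob_crowded:
  assumes n: "0 < n" and r1: "2 \<le> r1"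
  shows "prob {\<omega>\<in>space M. \<exists>j<N \<omega>. B < card {i. i < N \<omega> \<and> torus_dist (side n) (X \<omega> i) (X \<omega> j) \<le> r1}} \<le>
    4 * real n * exp (288 * r1\<^sup>2 - real B)"
proof -
  let ?L = "side n"
  let ?I = "{..nat \<lfloor>?L\<rfloor>}"
  define A where "A p = {y\<in>square ?L. (real (fst p), real (snd p)) \<in> square ?L \<and>
      torus_dist ?L (real (fst p), real (snd p)) y \<le> 2 * r1}" for p :: "nat \<times> nat"
  have [measurable]: "A p \<in> sets borel" for p unfolding A_def by measurable
  have area: "measure lborel (A p) \<le> 144 * r1\<^sup>2" for p
  proof (cases "(real (fst p), real (snd p)) \<in> square ?L")
    case True
    then have "A p = {y\<in>square ?L. torus_dist ?L (real (fst p), real (snd p)) y \<le> 2 * r1}" by (auto simp: A_def)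
    then have "emeasure lborel (A p) \<le> ennreal (36 * (2 * r1)\<^sup>2)"
      using emeasure_torus_ball_le[OF True, of "2 * r1"] r1 by simp
    then have "measure lborel (A p) \<le> 36 * (2 * r1)\<^sup>2"
      unfolding measure_def by (intro enn2real_leI) auto
    then show ?thesis by (simp add: power_mult_distrib)
  next
    case False
    then have "A p = {}" by (auto simp: A_def)
    then show ?thesis by simp
  qed
  have "prob {\<omega>\<in>space M. \<exists>j<N \<omega>. B < card {i. i < N \<omega> \<and> torus_dist ?L (X \<omega> i) (X \<omega> j) \<le> r1}} \<le>
      prob (\<Union>p\<in>?I \<times> ?I. {\<omega>\<in>space M. real B \<le> real (point_count N X (A p) \<omega>)})"
  proof (rule finite_measure_mono)
    show "{\<omega>\<in>space M. \<exists>j<N \<omega>. B < card {i. i < N \<omega> \<and> torus_dist ?L (X \<omega> i) (X \<omega> j) \<le> r1}} \<subseteq>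
      (\<Union>p\<in>?I \<times> ?I. {\<omega>\<in>space M. real B \<le> real (point_count N X (A p) \<omega>)})"
    proof
      fix \<omega> assume "\<omega> \<in> {\<omega>\<in>space M. \<exists>j<N \<omega>. B < card {i. i < N \<omega> \<and> torus_dist ?L (X \<omega> i) (X \<omega> j) \<le> r1}}"
      then obtain j where \<omega>: "\<omega> \<in> space M" and j: "j < N \<omega>"
        and B: "B < card {i. i < N \<omega> \<and> torus_dist ?L (X \<omega> i) (X \<omega> j) \<le> r1}" by auto
      note sq = points.point_in[OF \<omega>]
      obtain k l where kl: "k \<le> nat \<lfloor>?L\<rfloor>" "l \<le> nat \<lfloor>?L\<rfloor>" "(real k, real l) \<in> square ?L"
        "torus_dist ?L (real k, real l) (X \<omega> j) \<le> r1"
        using grid_point_near[OF sq[OF j] r1] by blast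
      have "card {i. i < N \<omega> \<and> torus_dist ?L (X \<omega> i) (X \<omega> j) \<le> r1} \<le> point_count N X (A (k, l)) \<omega>"
        unfolding point_count_def
      proof (rule card_mono)
        show "{i. i < N \<omega> \<and> torus_dist ?L (X \<omega> i) (X \<omega> j) \<le> r1} \<subseteq> {i. i < N \<omega> \<and> X \<omega> i \<in> A (k, l)}"
        proof safe
          fix i assume i: "i < N \<omega>" "torus_dist ?L (X \<omega> i) (X \<omega> j) \<le> r1"
          have "torus_dist ?L (real k, real l) (X \<omega> i) \<le>
              torus_dist ?L (real k, real l) (X \<omega> j) + torus_dist ?L (X \<omega> j) (X \<omega> i)"
            by (intro torus_dist_triangle kl sq i j)
          then show "X \<omega> i \<in> A (k, l)"
            using i(2) kl(3,4) sq[OF i(1)] torus_dist_commute[of ?L "X \<omega> i" "X \<omega> j"] by (auto simp: A_def)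
        qed
      qed simp
      then show "\<omega> \<in> (\<Union>p\<in>?I \<times> ?I. {\<omega>\<in>space M. real B \<le> real (point_count N X (A p) \<omega>)})"
        using \<omega> kl B by (intro UN_I[of "(k, l)"]) auto
    qed
  qed measurable
  also have "\<dots> \<le> (\<Sum>p\<in>?I \<times> ?I. prob {\<omega>\<in>space M. real B \<le> real (point_count N X (A p) \<omega>)})"
    by (intro measure_UNION_le) auto
  also have "\<dots> \<le> (\<Sum>p\<in>?I \<times> ?I. exp (2 * (144 * r1\<^sup>2) - real B))"
    by (intro sum_mono points.point_count_upper_tail area) (auto simp: A_def)
  also have "\<dots> = real (nat \<lfloor>?L\<rfloor> + 1) ^ 2 * exp (288 * r1\<^sup>2 - real B)"
    by (simp add: power2_eq_square card_cartesian_product algebra_simps)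
  also have "\<dots> \<le> (2 * sqrt (real n)) ^ 2 * exp (288 * r1\<^sup>2 - real B)"
    using grid_size[OF n] by (intro mult_right_mono power_mono) auto
  also have "\<dots> = 4 * real n * exp (288 * r1\<^sup>2 - real B)"
    by (simp add: power_mult_distrib)
  finally show ?thesis .
qed

lemma prob_sparse_box:
  assumes n: "0 < n"
  shows "prob {\<omega>\<in>space M. \<exists>i i' j j' :: nat. i \<le> i' \<and> j \<le> j' \<and> real i' \<le> side n \<and> real j' \<le> side n \<and>
        \<Lambda> \<le> (real i' - real i) * (real j' - real j) \<and>
        real (card {k. k < N \<omega> \<and> X \<omega> k \<in> {real i..real i'} \<times> {real j..real j'}}) <
          (real i' - real i) * (real j' - real j) / 4} \<le>
    16 * real n ^ 2 * exp (- \<Lambda> / 4)"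
proof -
  let ?L = "side n"
  let ?I = "{..nat \<lfloor>?L\<rfloor>}"
  define box where "box p = (case p of (i, i', j, j') \<Rightarrow> {real i..real i'} \<times> {real j..real j'})" for p :: "nat \<times> nat \<times> nat \<times> nat"
  define ar where "ar p = (case p of (i, i', j, j') \<Rightarrow> (real i' - real i) * (real j' - real j))" for p :: "nat \<times> nat \<times> nat \<times> nat"
  define G where "G = {(i, i', j, j'). i \<le> i' \<and> j \<le> j' \<and> real i' \<le> ?L \<and> real j' \<le> ?L \<and>
      \<Lambda> \<le> (real i' - real i) * (real j' - real j)}"
  have [measurable]: "box p \<in> sets borel" for p
    unfolding box_def by (cases p) (auto intro!: borel_closed closed_Times)
  have GI: "G \<subseteq> ?I \<times> ?I \<times> ?I \<times> ?I" unfolding G_def by (auto simp: le_nat_floor)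
  have finG: "finite G" using GI finite_subset by blast
  have boxQ: "box p \<subseteq> square ?L" if "p \<in> G" for p
    using that by (auto simp: box_def G_def square_def)
  have area: "measure lborel (box p) = ar p" if "p \<in> G" for p
  proof -
    have "emeasure lborel (box p) = ennreal (ar p)"
      using that unfolding box_def ar_def G_def lborel_prod[symmetric]
      by (auto simp: lborel.emeasure_pair_measure_Times ennreal_mult)
    moreover have "0 \<le> ar p" using that by (auto simp: ar_def G_def)
    ultimately show ?thesis by (simp add: measure_def)
  qed
  have "prob {\<omega>\<in>space M. \<exists>i i' j j' :: nat. i \<le> i' \<and> j \<le> j' \<and> real i' \<le> ?L \<and> real j' \<le> ?L \<and>
        \<Lambda> \<le> (real i' - real i) * (real j' - real j) \<and>
        real (card {k. k < N \<omega> \<and> X \<omega> k \<in> {real i..real i'} \<times> {real j..real j'}}) <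
          (real i' - real i) * (real j' - real j) / 4} \<le>
      prob (\<Union>p\<in>G. {\<omega>\<in>space M. real (point_count N X (box p) \<omega>) \<le> ar p / 4})"
  proof (rule finite_measure_mono)
    show "(\<Union>p\<in>G. {\<omega>\<in>space M. real (point_count N X (box p) \<omega>) \<le> ar p / 4}) \<in> sets M"
      using finG by (intro sets.finite_UN) auto
  qed (fastforce simp: G_def box_def ar_def point_count_def)
  also have "\<dots> \<le> (\<Sum>p\<in>G. prob {\<omega>\<in>space M. real (point_count N X (box p) \<omega>) \<le> ar p / 4})"
    using finG by (intro measure_UNION_le) auto
  also have "\<dots> \<le> (\<Sum>p\<in>G. exp (- \<Lambda> / 4))"
  proof (rule sum_mono)
    fix p assume p: "p \<in> G"
    have "prob {\<omega>\<in>space M. real (point_count N X (box p) \<omega>) \<le> ar p / 4} \<le> exp (ar p / 4 - measure lborel (box p) / 2)"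
      using boxQ[OF p] by (intro points.point_count_lower_tail) auto
    also have "\<dots> \<le> exp (- \<Lambda> / 4)"
      using p unfolding area[OF p] by (auto simp: ar_def G_def)
    finally show "prob {\<omega>\<in>space M. real (point_count N X (box p) \<omega>) \<le> ar p / 4} \<le> exp (- \<Lambda> / 4)" .
  qed
  also have "\<dots> = real (card G) * exp (- \<Lambda> / 4)" by simp
  also have "\<dots> \<le> real ((nat \<lfloor>?L\<rfloor> + 1) ^ 4) * exp (- \<Lambda> / 4)"
    using card_mono[OF _ GI] by (intro mult_right_mono of_nat_mono) (auto simp: card_cartesian_product power4_eq_xxxx algebra_simps)
  also have "\<dots> \<le> (2 * sqrt (real n)) ^ 4 * exp (- \<Lambda> / 4)"
    unfolding of_nat_power using grid_size[OF n] by (intro mult_right_mono power_mono) auto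
  also have "(2 * sqrt (real n)) ^ 4 = 16 * real n ^ 2"
    by (simp add: power_mult_distrib power4_eq_xxxx power2_eq_square)
  finally show ?thesis .
qed

text \<open>
  If the event of greedy progress everywhere is not measurable its \<open>measure\<close> is 0 by convention, and
  the inequality is trivial.
\<close>
lemma prob_good_positions:
  assumes n: "0 < n" and r1: "2 \<le> r1"
  shows "prob {\<omega>\<in>space M. progress_everywhere (side n) (local_radius c n) (nodes N X \<omega>)} \<le>
    prob {\<omega>\<in>space M. good_positions (side n) (local_radius c n) r1 \<Lambda> (3 * n) B (N \<omega>) (X \<omega>)} +
    exp (- real n) + 4 * real n * exp (288 * r1\<^sup>2 - real B) + 16 * real n ^ 2 * exp (- \<Lambda> / 4)"
proof -
  let ?L = "side n" and ?R = "local_radius c n"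
  let ?P = "{\<omega>\<in>space M. progress_everywhere ?L ?R (nodes N X \<omega>)}"
  let ?G = "{\<omega>\<in>space M. good_positions ?L ?R r1 \<Lambda> (3 * n) B (N \<omega>) (X \<omega>)}"
  let ?B1 = "{\<omega>\<in>space M. 3 * n < N \<omega>}"
  let ?B2 = "{\<omega>\<in>space M. \<exists>j<N \<omega>. B < card {i. i < N \<omega> \<and> torus_dist ?L (X \<omega> i) (X \<omega> j) \<le> r1}}"
  let ?B3 = "{\<omega>\<in>space M. \<exists>i i' j j' :: nat. i \<le> i' \<and> j \<le> j' \<and> real i' \<le> ?L \<and> real j' \<le> ?L \<and>
        \<Lambda> \<le> (real i' - real i) * (real j' - real j) \<and>
        real (card {k. k < N \<omega> \<and> X \<omega> k \<in> {real i..real i'} \<times> {real j..real j'}}) <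
          (real i' - real i) * (real j' - real j) / 4}"
  have G: "?G \<in> sets M"
    by (rule edge_event_measurable[where bad = "\<lambda>m e. good_positions ?L ?R r1 \<Lambda> (3 * n) B m"])
      (rule good_positions_measurable)
  have [measurable]: "Measurable.pred M (\<lambda>\<omega>. X \<omega> k \<in> {real i..real i'} \<times> {real j..real j'})" for k i i' j j'
    by (rule pred_sets2[OF borel_closed]) (auto intro!: closed_Times)
  have B2: "?B2 \<in> sets M"
  proof -
    have "Measurable.pred M (\<lambda>\<omega>. torus_dist ?L (X \<omega> i) (X \<omega> j) \<le> r1)" for i j by measurable
    then have "Measurable.pred M (\<lambda>\<omega>. j < N \<omega> \<and> B < card {i. i < N \<omega> \<and> torus_dist ?L (X \<omega> i) (X \<omega> j) \<le> r1})" for j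
      by measurable
    then show ?thesis by measurable
  qed
  have B3: "?B3 \<in> sets M" by measurable
  have B1: "?B1 \<in> sets M" by measurable
  show ?thesis
  proof (cases "?P \<in> sets M")
    case False
    then have "prob ?P = 0" by (rule measure_notin_sets)
    then show ?thesis by (simp add: add_nonneg_nonneg)
  next
    case True
    have "AE \<omega> in M. \<omega> \<in> ?P \<longrightarrow> \<omega> \<in> ?G \<union> ?B1 \<union> ?B2 \<union> ?B3"
      using AE_no_pair_at_distance[of ?R]
    proof (eventually_elim, intro impI)
      fix \<omega>
      assume gen: "\<forall>i j. i < N \<omega> \<longrightarrow> j < N \<omega> \<longrightarrow> i \<noteq> j \<longrightarrow> torus_dist ?L (X \<omega> i) (X \<omega> j) \<noteq> ?R"
        and "\<omega> \<in> ?P"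
      then have \<omega>: "\<omega> \<in> space M" and prog: "progress_everywhere ?L ?R (X \<omega> ` {..<N \<omega>})"
        by (auto simp: nodes_def)
      have np: "\<forall>i<N \<omega>. \<forall>j<N \<omega>. ?R \<le> torus_dist ?L (X \<omega> i) (X \<omega> j) \<longrightarrow>
        (\<exists>k<N \<omega>. torus_dist ?L (X \<omega> k) (X \<omega> j) < torus_dist ?L (X \<omega> i) (X \<omega> j) \<and> torus_dist ?L (X \<omega> i) (X \<omega> k) < ?R)"
        using progress_imp_node_progress[OF prog points.point_in[OF \<omega>]] gen by blast
      show "\<omega> \<in> ?G \<union> ?B1 \<union> ?B2 \<union> ?B3"
      proof (rule ccontr)
        assume "\<omega> \<notin> ?G \<union> ?B1 \<union> ?B2 \<union> ?B3"
        then have no: "\<omega> \<notin> ?G" "\<omega> \<notin> ?B1" "\<omega> \<notin> ?B2" "\<omega> \<notin> ?B3" by blast+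
        have "good_positions ?L ?R r1 \<Lambda> (3 * n) B (N \<omega>) (X \<omega>)"
          unfolding good_positions_def
        proof (intro conjI np)
          show "N \<omega> \<le> 3 * n" using no(2) \<omega> by auto
          show "\<forall>j<N \<omega>. card {i. i < N \<omega> \<and> torus_dist ?L (X \<omega> i) (X \<omega> j) \<le> r1} \<le> B"
            using no(3) \<omega> unfolding mem_Collect_eq by (meson not_less)
          show "\<forall>i i' j j' :: nat. i \<le> i' \<and> j \<le> j' \<and> real i' \<le> ?L \<and> real j' \<le> ?L \<and>
            \<Lambda> \<le> (real i' - real i) * (real j' - real j) \<longrightarrow>
            (real i' - real i) * (real j' - real j) / 4 \<le>
            real (card {k. k < N \<omega> \<and> X \<omega> k \<in> {real i..real i'} \<times> {real j..real j'}})"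
            using no(4) \<omega> unfolding mem_Collect_eq not_less[symmetric] by blast
        qed
        then show False using no(1) \<omega> by blast
      qed
    qed
    then have "prob ?P \<le> prob (?G \<union> ?B1 \<union> ?B2 \<union> ?B3)"
      using G B1 B2 B3 by (intro finite_measure_mono_AE) auto
    also have "\<dots> \<le> prob ?G + prob ?B1 + prob ?B2 + prob ?B3"
      using G B1 B2 B3
      by (intro order.trans[OF measure_Un_le] add_mono order.refl sets.Un) auto
    also have "\<dots> \<le> prob ?G + exp (- real n) + 4 * real n * exp (288 * r1\<^sup>2 - real B) + 16 * real n ^ 2 * exp (- \<Lambda> / 4)"
      by (intro add_mono order.refl prob_many_nodes prob_crowded[OF n r1] prob_sparse_box[OF n])
    finally show ?thesis .
  qed
qed

end


section \<open>Number of hops between all pairs of nodes\<close>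

text \<open>
  The loss per attempt in \<open>exploration\<close>, with \<open>u\<close> of order \<open>1 / ln n\<close>.
\<close>
lemma half_exp_power_le:
  fixes u :: real
  assumes "0 \<le> u" "u \<le> 1"
  shows "((1 + exp (- u)) / 2) ^ T \<le> exp (- u * real T / 4)"
proof -
  have "exp (- u) \<le> 1 / (1 + u)"
    using exp_ge_add_one_self[of u] assms by (simp add: exp_minus divide_simps)
  also have "\<dots> \<le> 1 - u / 2"
  proof -
    have "0 \<le> u * (1 - u)" using assms by (intro mult_nonneg_nonneg) auto
    then have "1 \<le> (1 - u / 2) * (1 + u)" by (simp add: algebra_simps)
    then show ?thesis using assms by (simp add: divide_le_eq)
  qed
  finally have "(1 + exp (- u)) / 2 \<le> 1 + (- u / 4)" by simp
  also have "\<dots> \<le> exp (- u / 4)" by (rule exp_ge_add_one_self)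
  finally have "((1 + exp (- u)) / 2) ^ T \<le> exp (- u / 4) ^ T"
    by (intro power_mono add_nonneg_nonneg divide_nonneg_nonneg) auto
  also have "\<dots> = exp (- u * real T / 4)"
    by (simp add: exp_of_nat_mult[symmetric] mult.commute)
  finally show ?thesis .
qed

lemma power_of_two_near:
  fixes n :: nat
  assumes "1 \<le> n"
  obtains j :: nat where "n \<le> 2 ^ j" "2 ^ j \<le> 2 * n"
proof -
  define j where "j = (LEAST j. n \<le> (2::nat) ^ j)"
  have ex: "n \<le> 2 ^ n" by (rule less_imp_le[OF less_exp])
  have le: "n \<le> 2 ^ j" unfolding j_def by (rule LeastI[of "\<lambda>j. n \<le> 2 ^ j" n]) (rule ex)
  have "2 ^ j \<le> 2 * n"
  proof (cases j)
    case (Suc i)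
    then have "\<not> n \<le> 2 ^ i" using not_less_Least[of i "\<lambda>j. n \<le> (2::nat) ^ j"] by (auto simp: j_def)
    then show ?thesis using Suc by simp
  qed (use assms in simp)
  with le show thesis using that by blast
qed

text \<open>
  The first summand is \<open>16 * 1024 * 1296\<close>: with a lower bound \<open>1 / (1296 * ln n)\<close> for \<open>4 / 9 * a\<close> an attempt
  fails with probability at most \<open>exp (- u)\<close> for \<open>u = 1 / (1024 * 1296 * ln n)\<close>, and that many times
  \<open>(ln n)\<^sup>2\<close> attempts make \<open>exp (- u * T / 4)\<close> at most \<open>n powr (- 4)\<close>. The 2 absorbs roundings. The last summand accounts for the
  final hops at distance of order \<open>\<kappa> * R\<close>, where \<open>2 ^ J\<close> is at least \<open>\<kappa>\<close>.
\<close>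
definition delivery_constant :: "real \<Rightarrow> real \<Rightarrow> nat \<Rightarrow> real" where
  "delivery_constant c \<kappa> J = 21233664 + 2 + (real J + 1) * (288 * \<kappa>\<^sup>2 * c + 4)"

context poisson_small_world
begin

definition all_delivered :: "real \<Rightarrow> rule \<Rightarrow> nat \<Rightarrow> (nat \<times> nat) set \<Rightarrow> (nat \<Rightarrow> point) \<Rightarrow> bool" where
  "all_delivered h \<rho> m e x \<longleftrightarrow> (\<forall>i<m. \<forall>j<m. x i \<noteq> x j \<longrightarrow>
     (\<exists>k. real k \<le> h \<and> delivers (side n) (local_radius c n) (x ` {..<m}) (links x e) \<rho> (x i) (x j) k))"

lemma all_delivered_measurable:
  assumes "routing_rule (side n) \<rho>" "e \<subseteq> index_pairs m"
  shows "Measurable.pred positions_space (all_delivered h \<rho> m e)"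
proof -
  have [measurable]: "Measurable.pred positions_space (\<lambda>x. delivers (side n) (local_radius c n)
      (x ` {..<m}) (links x e) \<rho> (x i) (x j) k)" for i j k
    by (rule delivers_measurable[OF assms(2,1)]) measurable
  show ?thesis unfolding all_delivered_def by measurable
qed

lemma all_delivered_iff:
  assumes "\<omega> \<in> space M"
  shows "all_delivered h \<rho> (N \<omega>) (ordered_shortcuts \<omega>) (X \<omega>) \<longleftrightarrow>
    (\<forall>s\<in>nodes N X \<omega>. \<forall>t\<in>nodes N X \<omega>. s \<noteq> t \<longrightarrow>
       (\<exists>k. real k \<le> h \<and> delivers (side n) (local_radius c n) (nodes N X \<omega>) (shortcuts X E \<omega>) \<rho> s t k))"
  unfolding all_delivered_def nodes_def shortcuts_eq_links[OF assms]
  by (simp, simp add: Ball_def)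

text \<open>
  The union bound over at most \<open>(3 * n)\<^sup>2\<close> pairs, each failing with probability at most
  \<open>2 ^ j * q ^ T \<le> 2 * n / n ^ 4\<close>.
\<close>
lemma prob_good_undelivered:
  assumes "\<alpha> = 2" "d = 1" and c: "0 < c" and n: "exp 1 \<le> real n" and R: "32 \<le> local_radius c n"
    and \<kappa>: "25 \<le> \<kappa>" "4096 \<le> \<kappa>\<^sup>2 * c" "\<kappa> \<le> 2 ^ J" and \<rho>: "routing_rule (side n) \<rho>"
    and B: "B = nat \<lceil>(288 * \<kappa>\<^sup>2 * c + 2) * ln (real n)\<rceil>"
  defines "r1 \<equiv> \<kappa> * local_radius c n"
  shows "prob {\<omega>\<in>space M. good_positions (side n) (local_radius c n) r1 ((r1 / 16)\<^sup>2) (3 * n) B (N \<omega>) (X \<omega>) \<and>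
      \<not> all_delivered (delivery_constant c \<kappa> J * (ln (real n))\<^sup>2) \<rho> (N \<omega>) (ordered_shortcuts \<omega>) (X \<omega>)} \<le> 18 / real n"
proof -
  let ?L = "side n" and ?R = "local_radius c n" and ?l = "ln (real n)"
  have n0: "0 < real n" using n by (meson exp_gt_zero less_le_trans)
  have l1: "1 \<le> ?l" using n n0 by (subst ln_ge_iff) auto
  have n1: "1 \<le> n" using n0 by simp
  have n2: "2 \<le> real n" using n exp_ge_add_one_self[of "1::real"] by linarith
  obtain j :: nat where j: "n \<le> 2 ^ j" "2 ^ j \<le> 2 * n" using power_of_two_near[OF n1] by blast
  have j': "real n \<le> 2 ^ j" "2 ^ j \<le> 2 * real n"
    using j by (metis of_nat_le_iff of_nat_numeral of_nat_power, metis of_nat_le_iff of_nat_mult of_nat_numeral of_nat_power)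
  have side_n: "0 \<le> ?L" "?L \<le> real n"
    using n1 by (auto simp: side_def power2_eq_square intro!: real_le_lsqrt)
  have jl: "real j \<le> 4 * ?l"
  proof -
    have "real j * ln 2 = ln (2 ^ j)" by (simp add: ln_realpow)
    also have "\<dots> \<le> ln (2 * real n)" using j' n0 by (subst ln_le_cancel_iff) auto
    also have "\<dots> = ln 2 + ?l" using n0 by (simp add: ln_mult)
    also have "\<dots> \<le> 2 * ?l" using n2 by simp
    finally have "real j * ln 2 \<le> 2 * ?l" .
    moreover have "1 / 2 \<le> ln (2::real)" using exp_bound_half[of "1 / 2 :: real"] by (subst ln_ge_iff) auto
    ultimately have "real j * (1 / 2) \<le> 2 * ?l"
      using mult_left_mono[of "1 / 2" "ln 2 :: real" "real j"] by linarith
    then show ?thesis by simp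
  qed
  \<comment> \<open>There are at most \<open>4 * ln n\<close> scales, so \<open>a \<ge> 1 / (144 * 4 * ln n)\<close>, and \<open>4 / 9\<close> of this is \<open>b\<close>.\<close>
  define b where "b = 1 / (1296 * ?l)"
  have b: "0 \<le> b" "b \<le> 1" using l1 by (auto simp: b_def divide_simps)
  have ab: "b \<le> 4 / 9 * a"
  proof -
    have "2 ^ j * 1 \<le> 2 ^ j * ?R" using R by (intro mult_left_mono) auto
    then have "?L \<le> 2 ^ j * ?R" using side_n j' by linarith
    then have "1 \<le> 144 * a * real j"
      using R n1 by (intro shortcut_intensity_lower_bound assms) auto
    also have "\<dots> \<le> 144 * a * (4 * ?l)" using a_pos jl by (intro mult_left_mono) auto
    finally show ?thesis using l1 by (simp add: b_def field_simps)
  qed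
  define T where "T = nat \<lceil>21233664 * ?l\<^sup>2\<rceil>"
  define T2 where "T2 = 1 + J * (B + 1) + B"
  have hops: "real (T + T2) \<le> delivery_constant c \<kappa> J * ?l\<^sup>2"
  proof -
    have l2: "?l \<le> ?l\<^sup>2" "1 \<le> ?l\<^sup>2" using l1 by (auto simp: power2_eq_square mult_ge1_I)
    define C where "C = 288 * \<kappa>\<^sup>2 * c + 2"
    have C: "0 \<le> C" using c by (simp add: C_def)
    have "real B \<le> C * ?l + 1" unfolding B C_def[symmetric] using C l1 by (simp add: of_nat_nat)
    also have "\<dots> \<le> C * ?l\<^sup>2 + ?l\<^sup>2" using l2 C by (intro add_mono mult_left_mono) auto
    finally have "real B + 1 \<le> (C + 2) * ?l\<^sup>2" using l2 by (simp add: algebra_simps)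
    then have "(real J + 1) * (real B + 1) \<le> (real J + 1) * ((C + 2) * ?l\<^sup>2)"
      by (intro mult_left_mono) auto
    moreover have "real T \<le> 21233664 * ?l\<^sup>2 + ?l\<^sup>2" unfolding T_def using l2 by linarith
    moreover have "real T2 = (real J + 1) * (real B + 1)" by (simp add: T2_def algebra_simps)
    ultimately show ?thesis
      using l2 by (simp add: delivery_constant_def C_def algebra_simps)
  qed
  define bad where "bad m e x \<longleftrightarrow> (\<exists>i<m. \<exists>i'<m. x i \<noteq> x i' \<and>
     \<not> (\<exists>k\<le>T + T2. delivers ?L ?R (x ` {..<m}) (links x e) \<rho> (x i) (x i') k))" for m e and x :: "nat \<Rightarrow> point"
  have bad_imp: "bad m e x" if "\<not> all_delivered (delivery_constant c \<kappa> J * ?l\<^sup>2) \<rho> m e x" for m e x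
  proof -
    have "real k \<le> delivery_constant c \<kappa> J * ?l\<^sup>2" if "k \<le> T + T2" for k
      using that hops by linarith
    then show ?thesis using that unfolding bad_def all_delivered_def by blast
  qed
  define \<epsilon> where "\<epsilon> = 2 ^ j * ((1 + exp (- b / 1024)) / 2) ^ T"
  have \<epsilon>: "0 \<le> \<epsilon>" "\<epsilon> \<le> 2 / real n ^ 3"
  proof -
    show "0 \<le> \<epsilon>" unfolding \<epsilon>_def by (intro mult_nonneg_nonneg zero_le_power) (auto intro: add_nonneg_nonneg)
    have "((1 + exp (- (b / 1024))) / 2) ^ T \<le> exp (- (b / 1024) * real T / 4)"
      using b by (intro half_exp_power_le) auto
    also have "\<dots> \<le> exp (- (4 * ?l))"
    proof -
      have "21233664 * ?l\<^sup>2 \<le> real T" unfolding T_def by linarith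
      then have "b * (21233664 * ?l\<^sup>2) \<le> b * real T" using b by (intro mult_left_mono) auto
      moreover have "b * (21233664 * ?l\<^sup>2) = 16384 * ?l"
        using l1 by (simp add: b_def power2_eq_square)
      ultimately show ?thesis by simp
    qed
    also have "\<dots> = 1 / real n ^ 4"
      using n0 by (simp add: exp_minus exp_of_nat_mult[of 4, simplified] divide_inverse)
    finally have "((1 + exp (- b / 1024)) / 2) ^ T \<le> 1 / real n ^ 4" by simp
    then have "\<epsilon> \<le> (2 * real n) * (1 / real n ^ 4)"
      unfolding \<epsilon>_def using j' by (intro mult_mono zero_le_power) (auto intro: add_nonneg_nonneg)
    also have "\<dots> = 2 / real n ^ 3" using n0 by (simp add: power_numeral_reduce)
    finally show "\<epsilon> \<le> 2 / real n ^ 3" .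
  qed
  have r1: "25 * ?R \<le> r1" "r1 \<le> 2 ^ J * ?R" "32 \<le> r1"
  proof -
    show "25 * ?R \<le> r1" "r1 \<le> 2 ^ J * ?R"
      unfolding r1_def using \<kappa> R by (auto intro!: mult_right_mono)
    then show "32 \<le> r1" using R by linarith
  qed
  have "2 ^ j * 32 \<le> 2 ^ j * r1" using r1 by (intro mult_left_mono) auto
  then have Lr: "?L < 2 ^ j * r1" using side_n j' n0 by linarith
  let ?good = "good_positions ?L ?R r1 ((r1 / 16)\<^sup>2) (3 * n) B"
  let ?h = "delivery_constant c \<kappa> J * ?l\<^sup>2"
  have "prob {\<omega>\<in>space M. ?good (N \<omega>) (X \<omega>) \<and> \<not> all_delivered ?h \<rho> (N \<omega>) (ordered_shortcuts \<omega>) (X \<omega>)} \<le>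
    (3 * real n)\<^sup>2 * \<epsilon>"
  proof (rule prob_edge_event_le)
    show "Measurable.pred positions_space (\<lambda>x. \<not> all_delivered ?h \<rho> m e x)" if "e \<subseteq> index_pairs m" for m e
      using all_delivered_measurable[OF \<rho> that] by measurable
    show "m \<le> 3 * n" if "?good m x" for m x
      using that by (simp add: good_positions_def)
    fix m x assume good: "?good m x" and sq: "\<And>i. i < m \<Longrightarrow> x i \<in> square ?L"
    let ?p = "pair_prob x"
    let ?f = "\<lambda>i i' e. of_bool (x i \<noteq> x i' \<and>
        \<not> (\<exists>k\<le>T + T2. delivers ?L ?R (x ` {..<m}) (links x e) \<rho> (x i) (x i') k)) :: real"
    have p: "?p = (\<lambda>(i, j). shortcut_prob ?R a 2 (torus_dist ?L (x i) (x j)))"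
      unfolding pair_prob_def unfolding assms(1) ..
    have pair: "bernoulli_mean ?p (index_pairs m) (?f i i') \<le> \<epsilon>" if ii: "i < m" "i' < m" for i i'
    proof (cases "x i = x i'")
      case True
      then have "bernoulli_mean ?p (index_pairs m) (?f i i') = 0"
        by (simp add: bernoulli_mean_const)
      then show ?thesis using \<epsilon> by simp
    next
      case False
      then have "?f i i' = (\<lambda>e. of_bool (\<not> (\<exists>k\<le>T + T2. delivers ?L ?R (x ` {..<m}) (links x e) \<rho> (x i) (x i') k)))"
        by simp
      then show ?thesis
        unfolding \<epsilon>_def p
        using good_positions_delivery[OF good sq _ r1(1,2,3) order.refl a_pos b ab \<rho> side_n(1) Lr ii False T2_def, of T] R
        by simp
    qed
    have "bernoulli_mean ?p (index_pairs m) (\<lambda>e. of_bool (\<not> all_delivered ?h \<rho> m e x)) \<le>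
        bernoulli_mean ?p (index_pairs m) (\<lambda>e. \<Sum>i<m. \<Sum>i'<m. ?f i i' e)"
    proof (rule bernoulli_mean_mono)
      fix e
      show "of_bool (\<not> all_delivered ?h \<rho> m e x) \<le> (\<Sum>i<m. \<Sum>i'<m. ?f i i' e)"
      proof (cases "all_delivered ?h \<rho> m e x")
        case False
        then obtain i i' where ii: "i < m" "i' < m" "?f i i' e = 1"
          using bad_imp[OF False] unfolding bad_def by auto
        have "1 \<le> (\<Sum>i'<m. ?f i i' e)"
          unfolding ii(3)[symmetric] using ii by (intro member_le_sum) auto
        also have "\<dots> \<le> (\<Sum>i<m. \<Sum>i'<m. ?f i i' e)"
          using ii by (intro member_le_sum[of i "{..<m}" "\<lambda>i. \<Sum>i'<m. ?f i i' e"] sum_nonneg) auto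
        finally show ?thesis by simp
      qed (auto intro!: sum_nonneg)
    qed (use pair_prob_bounds in auto)
    also have "\<dots> = (\<Sum>i<m. \<Sum>i'<m. bernoulli_mean ?p (index_pairs m) (?f i i'))"
      by (simp only: bernoulli_mean_sum)
    also have "\<dots> \<le> (\<Sum>i<m. \<Sum>i'<m. \<epsilon>)"
      by (intro sum_mono pair) auto
    also have "\<dots> = (real m)\<^sup>2 * \<epsilon>" by (simp add: power2_eq_square)
    also have "\<dots> \<le> (3 * real n)\<^sup>2 * \<epsilon>"
    proof -
      have "m \<le> 3 * n" using good by (simp add: good_positions_def)
      then have "real m \<le> 3 * real n" by linarith
      then show ?thesis using \<epsilon> by (intro mult_right_mono power_mono) auto
    qed
    finally show "bernoulli_mean ?p (index_pairs m) (\<lambda>e. of_bool (\<not> all_delivered ?h \<rho> m e x)) \<le> (3 * real n)\<^sup>2 * \<epsilon>" .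
  qed (use \<epsilon> good_positions_measurable in auto)
  also have "\<dots> \<le> (3 * real n)\<^sup>2 * (2 / real n ^ 3)"
    using \<epsilon> by (intro mult_left_mono) auto
  also have "\<dots> = 18 / real n"
    using n0 by (simp add: power2_eq_square power_numeral_reduce field_simps)
  finally show ?thesis .
qed

text \<open>
  The constant \<open>\<kappa>\<close> is so large that the boxes that must not be sparse, of area at least
  \<open>(\<kappa> * R / 16)\<^sup>2\<close>, have area at least \<open>16 * ln n\<close>; each is then sparse with probability at most
  \<open>1 / n ^ 4\<close>, which beats the number \<open>16 * n\<^sup>2\<close> of boxes. The four error terms bound the probabilities of too many nodes, of a
  crowded ball, of a sparse box, and of a failed delivery between good positions.
\<close>
lemma prob_delivery:
  assumes "\<alpha> = 2" "d = 1" and c: "0 < c" and n: "exp 1 \<le> real n" and R: "32 \<le> local_radius c n"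
    and \<kappa>: "25 \<le> \<kappa>" "4096 \<le> \<kappa>\<^sup>2 * c" "\<kappa> \<le> 2 ^ J" and \<rho>: "routing_rule (side n) \<rho>"
  shows "prob {\<omega>\<in>space M. progress_everywhere (side n) (local_radius c n) (nodes N X \<omega>)} -
      (exp (- real n) + 4 / real n + 16 / real n ^ 2 + 18 / real n) \<le>
    prob {\<omega>\<in>space M. \<forall>s\<in>nodes N X \<omega>. \<forall>t\<in>nodes N X \<omega>. s \<noteq> t \<longrightarrow>
       (\<exists>k. real k \<le> delivery_constant c \<kappa> J * (ln (real n))\<^sup>2 \<and>
          delivers (side n) (local_radius c n) (nodes N X \<omega>) (shortcuts X E \<omega>) \<rho> s t k)}"
    (is "?P - ?err \<le> prob ?D")
proof -
  let ?l = "ln (real n)" and ?h = "delivery_constant c \<kappa> J * (ln (real n))\<^sup>2"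
  define B where "B = nat \<lceil>(288 * \<kappa>\<^sup>2 * c + 2) * ?l\<rceil>"
  define r1 where "r1 = \<kappa> * local_radius c n"
  have n0: "0 < real n" using n by (meson exp_gt_zero less_le_trans)
  have l0: "0 \<le> ?l" using n exp_ge_add_one_self[of "1::real"] by (intro ln_ge_zero) linarith
  let ?good = "good_positions (side n) (local_radius c n) r1 ((r1 / 16)\<^sup>2) (3 * n) B"
  let ?G = "{\<omega>\<in>space M. ?good (N \<omega>) (X \<omega>)}"
  let ?U = "{\<omega>\<in>space M. ?good (N \<omega>) (X \<omega>) \<and> \<not> all_delivered ?h \<rho> (N \<omega>) (ordered_shortcuts \<omega>) (X \<omega>)}"
  have r1sq: "r1\<^sup>2 = \<kappa>\<^sup>2 * c * ?l"
    unfolding r1_def local_radius_def using c l0 by (simp add: power_mult_distrib)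
  have r1: "2 \<le> r1" unfolding r1_def using mult_mono[of 25 \<kappa> 32 "local_radius c n"] \<kappa> R by linarith
  have D: "?D = {\<omega>\<in>space M. all_delivered ?h \<rho> (N \<omega>) (ordered_shortcuts \<omega>) (X \<omega>)}"
    by (intro Collect_cong conj_cong refl) (simp only: all_delivered_iff)
  have Dm: "?D \<in> sets M"
    unfolding D by (rule edge_event_measurable) (rule all_delivered_measurable[OF \<rho>])
  have Um: "?U \<in> sets M"
  proof (rule edge_event_measurable[where bad = "\<lambda>m e x. ?good m x \<and> \<not> all_delivered ?h \<rho> m e x"])
    fix m :: nat and e assume "e \<subseteq> index_pairs m"
    note [measurable] = all_delivered_measurable[OF \<rho> this] good_positions_measurable
    show "Measurable.pred positions_space (\<lambda>x. ?good m x \<and> \<not> all_delivered ?h \<rho> m e x)"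
      by measurable
  qed
  have crowd: "4 * real n * exp (288 * r1\<^sup>2 - real B) \<le> 4 / real n"
  proof -
    have "(288 * \<kappa>\<^sup>2 * c + 2) * ?l \<le> real B" unfolding B_def by linarith
    then have "288 * r1\<^sup>2 - real B \<le> - (2 * ?l)" unfolding r1sq by (simp add: algebra_simps)
    then have "exp (288 * r1\<^sup>2 - real B) \<le> exp (- (2 * ?l))" by simp
    also have "\<dots> = 1 / real n ^ 2"
      using n0 by (simp add: exp_minus exp_of_nat_mult[of 2, simplified] divide_inverse)
    finally have "4 * real n * exp (288 * r1\<^sup>2 - real B) \<le> 4 * real n * (1 / real n ^ 2)"
      by (intro mult_left_mono) auto
    then show ?thesis using n0 by (simp add: power2_eq_square)
  qed
  have sparse: "16 * real n ^ 2 * exp (- (r1 / 16)\<^sup>2 / 4) \<le> 16 / real n ^ 2"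
  proof -
    have "4096 * ?l \<le> \<kappa>\<^sup>2 * c * ?l" using \<kappa> l0 by (intro mult_right_mono) auto
    then have "- (r1 / 16)\<^sup>2 / 4 \<le> - (4 * ?l)" using r1sq by (simp add: power_divide)
    then have "exp (- (r1 / 16)\<^sup>2 / 4) \<le> exp (- (4 * ?l))" by simp
    also have "\<dots> = 1 / real n ^ 4"
      using n0 by (simp add: exp_minus exp_of_nat_mult[of 4, simplified] divide_inverse)
    finally have "16 * real n ^ 2 * exp (- (r1 / 16)\<^sup>2 / 4) \<le> 16 * real n ^ 2 * (1 / real n ^ 4)"
      by (intro mult_left_mono) auto
    then show ?thesis using n0 by (simp add: power_numeral_reduce power2_eq_square)
  qed
  have "?P \<le> prob ?G + exp (- real n) + 4 * real n * exp (288 * r1\<^sup>2 - real B) + 16 * real n ^ 2 * exp (- (r1 / 16)\<^sup>2 / 4)"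
    using n0 r1 by (intro prob_good_positions) auto
  moreover have "prob ?G \<le> prob ?D + prob ?U"
  proof -
    have "prob ?G \<le> prob (?D \<union> ?U)"
      unfolding D using Dm[unfolded D] Um by (intro finite_measure_mono) auto
    also have "\<dots> \<le> prob ?D + prob ?U" using Dm Um by (rule measure_Un_le)
    finally show ?thesis .
  qed
  moreover have "prob ?U \<le> 18 / real n"
    unfolding r1_def by (rule prob_good_undelivered[OF assms B_def])
  ultimately show ?thesis using crowd sparse by linarith
qed

end

theorem theorem3p2:
  fixes M :: "nat \<Rightarrow> 'a measure"
    and N :: "nat \<Rightarrow> 'a \<Rightarrow> nat"
    and X :: "nat \<Rightarrow> 'a \<Rightarrow> nat \<Rightarrow> point"
    and E :: "nat \<Rightarrow> 'a \<Rightarrow> (nat \<times> nat) set"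
    and a :: "nat \<Rightarrow> real"
    and c :: real
  assumes "c > 0"
    and "\<forall>\<^sub>F n in sequentially.
           poisson_small_world (M n) n c 2 1 (a n) (N n) (X n) (E n)"
    and "(\<lambda>n. measure (M n) {\<omega>\<in>space (M n).
             progress_everywhere (side n) (local_radius c n) (nodes (N n) (X n) \<omega>)})
           \<longlonglongrightarrow> 1"
  shows "\<exists>K. \<forall>\<rho>. (\<forall>n. routing_rule (side n) (\<rho> n)) \<longrightarrow>
           (\<lambda>n. measure (M n) {\<omega>\<in>space (M n).
              \<forall>s\<in>nodes (N n) (X n) \<omega>. \<forall>t\<in>nodes (N n) (X n) \<omega>. s \<noteq> t \<longrightarrow>
                (\<exists>k. real k \<le> K * (ln (real n))\<^sup>2 \<and>
                     delivers (side n) (local_radius c n) (nodes (N n) (X n) \<omega>)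
                       (shortcuts (X n) (E n) \<omega>) (\<rho> n) s t k)})
             \<longlonglongrightarrow> 1"
proof -
  \<comment> \<open>25 keeps the chosen box inside the annulus farther than \<open>R\<close> from the current node; the other term makes \<open>\<kappa>\<^sup>2 * c\<close> at least 4096.\<close>
  define \<kappa> where "\<kappa> = max 25 (64 / sqrt c)"
  have \<kappa>25: "25 \<le> \<kappa>" by (simp add: \<kappa>_def)
  have "(64 / sqrt c)\<^sup>2 \<le> \<kappa>\<^sup>2" using assms(1) by (intro power_mono) (auto simp: \<kappa>_def)
  then have \<kappa>c: "4096 \<le> \<kappa>\<^sup>2 * c" using assms(1) by (simp add: power_divide field_simps)
  obtain J :: nat where "\<kappa> < 2 ^ J" using real_arch_pow[of 2 \<kappa>] by auto
  then have J: "\<kappa> \<le> 2 ^ J" by simp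
  have large: "\<forall>\<^sub>F n in sequentially. exp 1 \<le> real n \<and> 32 \<le> local_radius c n"
  proof -
    have "filterlim (\<lambda>n. sqrt (c * ln (real n))) at_top sequentially"
      using assms(1)
      by (intro filterlim_compose[OF sqrt_at_top] filterlim_tendsto_pos_mult_at_top[OF tendsto_const]
          filterlim_compose[OF ln_at_top filterlim_real_sequentially])
    then have "\<forall>\<^sub>F n in sequentially. 32 \<le> local_radius c n"
      unfolding local_radius_def filterlim_at_top by blast
    moreover have "\<forall>\<^sub>F n in sequentially. exp 1 \<le> real n"
      using filterlim_real_sequentially unfolding filterlim_at_top by blast
    ultimately show ?thesis by eventually_elim simp
  qed
  show ?thesis
  proof (intro exI[of _ "delivery_constant c \<kappa> J"] allI impI)
    fix \<rho> :: "nat \<Rightarrow> rule" assume \<rho>: "\<forall>n. routing_rule (side n) (\<rho> n)"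
    let ?p = "\<lambda>n. measure (M n) {\<omega>\<in>space (M n).
             progress_everywhere (side n) (local_radius c n) (nodes (N n) (X n) \<omega>)}"
    let ?err = "\<lambda>n. exp (- real n) + 4 / real n + 16 / real n ^ 2 + 18 / real n"
    let ?D = "\<lambda>n. measure (M n) {\<omega>\<in>space (M n).
              \<forall>s\<in>nodes (N n) (X n) \<omega>. \<forall>t\<in>nodes (N n) (X n) \<omega>. s \<noteq> t \<longrightarrow>
                (\<exists>k. real k \<le> delivery_constant c \<kappa> J * (ln (real n))\<^sup>2 \<and>
                     delivers (side n) (local_radius c n) (nodes (N n) (X n) \<omega>)
                       (shortcuts (X n) (E n) \<omega>) (\<rho> n) s t k)}"
    have "?err \<longlonglongrightarrow> 0" by real_asymp
    from tendsto_diff[OF assms(3) this] have lower: "(\<lambda>n. ?p n - ?err n) \<longlonglongrightarrow> 1" by simp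
    show "?D \<longlonglongrightarrow> 1"
    proof (rule tendsto_sandwich[OF _ _ lower tendsto_const])
      show "\<forall>\<^sub>F n in sequentially. ?p n - ?err n \<le> ?D n"
        using assms(2) large
      proof eventually_elim
        case (elim n)
        interpret poisson_small_world "M n" n c 2 1 "a n" "N n" "X n" "E n" by (rule elim(1))
        show ?case
          using elim(2) \<rho> by (intro prob_delivery refl assms(1) \<kappa>25 \<kappa>c J) auto
      qed
      show "\<forall>\<^sub>F n in sequentially. ?D n \<le> 1"
        using assms(2)
      proof eventually_elim
        case (elim n)
        interpret poisson_small_world "M n" n c 2 1 "a n" "N n" "X n" "E n" by (rule elim)
        show ?case by (rule prob_le_1)
      qed
    qed
  qed
qed

end
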